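(* Let $V>0$, $\lambda>0$, $T>0$. For every $\sigma_0\in\mathcal P(\Omega_V)$ there exists a unique weak solution $\sigma\in C([0,T];\mathcal P(\Omega_V))$ to the Kac equation $\partial_t\sigma+v\,\partial_x\sigma=\lambda(\iota_\sharp\sigma-\sigma)$ with initial datum $\sigma|_{t=0}=\sigma_0$. Moreover, a curve $\sigma\in C([0,T];\mathcal P(\Omega_V))$ is a weak solution of this problem if and only if it is a variational solution of it.
   Context: $\mathbb T=\mathbb R/\mathbb Z$ is the one-dimensional torus, $\Omega_V:=\mathbb T\times\{-V,V\}$, $\iota(x,v):=(x,-v)$ and $\iota_\sharp$ is push-forward under $\iota$. $\mathcal P$ and $\mathcal M$ denote probability measures and finite signed Borel measures, with the narrow topology; $C([0,T];\mathcal P(\Omega_V))$ means narrowly continuous curves. $C^{1,0}(\Omega_V)$ is the set of functions on $\Omega_V$ that are $C^1$ in $x$ for each $v$. $\|\cdot\|_{\mathrm{TV}}$ is the total-variation norm. For $a=(a_1,a_2)$ and $b=(b^1,b^2)$, $\langle a,b\rangle=\int_{\Omega_V}a\cdot db$. Weak solution: $\sigma\in C([0,T];\mathcal P(\Omega_V))$ with $\sigma|_{t=0}=\sigma_0$ such that for all $\varphi\in C^{1,0}(\Omega_V)$ and $0\le s\le t\le T$, $$\int_{\Omega_V}\varphi\,d\sigma_t-\int_{\Omega_V}\varphi\,d\sigma_s=\int_s^t\int_{\Omega_V}Q\varphi\,d\sigma_r\,dr,\qquad Q\varphi:=v\,\partial_x\varphi+\lambda(\varphi\circ\iota-\varphi).$$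 Continuity equation: $(\sigma,j)\in\mathrm{CE}(0,T;\Omega_V)$ if $\sigma\in C([0,T];\mathcal P(\Omega_V))$, $(j_t)_{t\in(0,T)}\subset\mathcal M(\Omega_V;\mathbb R^2)$, $j_t=(j_t^1,j_t^2)$, is a measurable family with $\int_0^T\|j_t\|_{\mathrm{TV}}\,dt<\infty$, and for all $\varphi\in C^{1,0}(\Omega_V)$, $0\le s\le t\le T$: $\langle\varphi,\sigma_t\rangle-\langle\varphi,\sigma_s\rangle=\int_s^t\langle\overline\nabla\varphi,j_r\rangle\,dr$, where $\overline\nabla\varphi:=(\partial_x\varphi,\ \varphi\circ\iota-\varphi)$. Relative entropy: $\mathrm{Ent}(\mu\,|\,\nu):=\int(f\log f-f+1)\,d\nu$ if $\mu\ll\nu$ with $f=d\mu/d\nu\ge0$, and $+\infty$ otherwise. Rate functional: $\mathscr I(\sigma,j):=\int_0^T\mathscr L(\sigma_t,j_t)\,dt$ if $(\sigma,j)\in\mathrm{CE}(0,T;\Omega_V)$ and $+\infty$ otherwise, where $\mathscr L(\sigma,j):=\mathrm{Ent}(j^2\,|\,\lambda\sigma)$ if $j^1=v\,\sigma$ and $+\infty$ otherwise. Variational solution: $\sigma\in C([0,T];\mathcal P(\Omega_V))$ for which there is a measurable family $(j_t)_{t\in(0,T)}\subset\mathcal M(\Omega_V;\mathbb R^2)$ with $(\sigma,j)\in\mathrm{CE}(0,T;\Omega_V)$ and $\mathrm{Ent}(\sigma|_{t=0}\,|\,\sigma_0)+\mathscr I(\sigma,j)=0$. *)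

theory Defs
  imports "HOL-Probability.Probability"
begin

section \<open>The torus \<open>\<real> / \<int>\<close> with the quotient topology\<close>

quotient_type torus = real / "\<lambda>x y :: real. x - y \<in> \<int>"
  morphisms rep_torus to_torus
proof (rule equivpI)
  show "reflp (\<lambda>x y :: real. x - y \<in> \<int>)"
    by (simp add: reflp_def)
  show "symp (\<lambda>x y :: real. x - y \<in> \<int>)"
    by (metis (mono_tags, lifting) Ints_minus minus_diff_eq symp_def)
  show "transp (\<lambda>x y :: real. x - y \<in> \<int>)"
    unfolding transp_def by (metis Ints_add diff_add_cancel add_diff_eq)
qed

instantiation torus :: topological_space
begin

definition open_torus :: "torus set \<Rightarrow> bool"
  where "open_torus U \<longleftrightarrow> open (to_torus -` U)"

instance
  by standard (auto simp: open_torus_def vimage_Int vimage_Union)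

end

text \<open>Derivative of a function on the torus, computed on the periodic lift; by
  \<open>torus_deriv_to_torus\<close> it does not depend on the representative.\<close>

definition torus_deriv :: "(torus \<Rightarrow> real) \<Rightarrow> torus \<Rightarrow> real"
  where "torus_deriv f x = deriv (\<lambda>s. f (to_torus s)) (rep_torus x)"

lemma to_torus_eq_iff: "to_torus s = to_torus t \<longleftrightarrow> s - t \<in> \<int>"
  by (rule torus.abs_eq_iff)

lemma torus_deriv_to_torus: "torus_deriv f (to_torus s) = deriv (\<lambda>u. f (to_torus u)) s"
proof -
  define k where "k = rep_torus (to_torus s) - s"
  have "to_torus (rep_torus (to_torus s)) = to_torus s"
    by (metis Quotient3_abs_rep Quotient3_torus)
  then have "k \<in> \<int>"
    by (simp add: k_def to_torus_eq_iff)
  then have per: "to_torus (u + k) = to_torus u" for u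
    by (simp add: to_torus_eq_iff)
  have eq: "rep_torus (to_torus s) = s + k"
    by (simp add: k_def)
  have "((\<lambda>u. f (to_torus u)) has_field_derivative D) (at (s + k)) \<longleftrightarrow>
        ((\<lambda>u. f (to_torus u)) has_field_derivative D) (at s)" for D
    using DERIV_shift[of "\<lambda>u. f (to_torus u)" D s k] by (simp add: per)
  then show ?thesis
    unfolding torus_deriv_def eq deriv_def by presburger
qed


section \<open>Finite signed and vector measures\<close>

text \<open>Values of \<open>\<mu>\<close> outside \<open>sets M\<close> are irrelevant. Finiteness is automatic, because
  the values are finite.\<close>

definition vector_measure :: "'a measure \<Rightarrow> ('a set \<Rightarrow> 'b::real_normed_vector) \<Rightarrow> bool"
  where "vector_measure M \<mu> \<longleftrightarrow> \<mu> {} = 0 \<and>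
    (\<forall>A :: nat \<Rightarrow> 'a set. range A \<subseteq> sets M \<longrightarrow> disjoint_family A \<longrightarrow>
      (\<lambda>n. \<mu> (A n)) sums \<mu> (\<Union>n. A n))"

definition tv_norm :: "'a measure \<Rightarrow> ('a set \<Rightarrow> 'b::real_normed_vector) \<Rightarrow> ennreal"
  where "tv_norm M \<mu> =
    (SUP P \<in> {P. finite P \<and> P \<subseteq> sets M \<and> partition_on (space M) P}.
      \<Sum>A\<in>P. ennreal (norm (\<mu> A)))"

text \<open>Jordan decomposition: the positive part is
  \<open>\<mu>\<^sup>+(A) = sup {\<mu>(B) | B \<subseteq> A measurable}\<close>, the negative part is the
  positive part of \<open>-\<mu>\<close>.\<close>

definition jordan_pos :: "'a measure \<Rightarrow> ('a set \<Rightarrow> real) \<Rightarrow> 'a measure"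
  where "jordan_pos M \<mu> =
    measure_of (space M) (sets M) (\<lambda>A. SUP B \<in> {B \<in> sets M. B \<subseteq> A}. ennreal (\<mu> B))"

definition signed_integral :: "'a measure \<Rightarrow> ('a set \<Rightarrow> real) \<Rightarrow> ('a \<Rightarrow> real) \<Rightarrow> real"
  where "signed_integral M \<mu> f =
    (\<integral>x. f x \<partial>jordan_pos M \<mu>) - (\<integral>x. f x \<partial>jordan_pos M (\<lambda>A. - \<mu> A))"

definition signed_abs_cont :: "('a set \<Rightarrow> real) \<Rightarrow> 'a measure \<Rightarrow> bool"
  where "signed_abs_cont \<mu> \<nu> \<longleftrightarrow> (\<forall>A\<in>null_sets \<nu>. \<mu> A = 0)"

definition is_density :: "('a set \<Rightarrow> real) \<Rightarrow> 'a measure \<Rightarrow> ('a \<Rightarrow> real) \<Rightarrow> bool"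
  where "is_density \<mu> \<nu> f \<longleftrightarrow>
    integrable \<nu> f \<and> (\<forall>A\<in>sets \<nu>. \<mu> A = (LINT x:A|\<nu>. f x))"

definition signed_RN_deriv :: "('a set \<Rightarrow> real) \<Rightarrow> 'a measure \<Rightarrow> 'a \<Rightarrow> real"
  where "signed_RN_deriv \<mu> \<nu> = (SOME f. is_density \<mu> \<nu> f)"

text \<open>The integrand is nonnegative where the density is (note that \<open>0 * ln 0 = 0\<close>), so the
  entropy is a nonnegative integral. The first argument is a set function; a finite measure
  \<open>\<rho>\<close> enters as \<open>measure \<rho>\<close>.\<close>

definition Ent :: "('a set \<Rightarrow> real) \<Rightarrow> 'a measure \<Rightarrow> ennreal"
  where "Ent \<mu> \<nu> =
    (let f = signed_RN_deriv \<mu> \<nu> in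
      if signed_abs_cont \<mu> \<nu> \<and> (AE x in \<nu>. 0 \<le> f x)
      then \<integral>\<^sup>+x. ennreal (f x * ln (f x) - f x + 1) \<partial>\<nu>
      else \<infinity>)"


section \<open>Phase space, test functions and curves\<close>

definition Omega :: "real \<Rightarrow> (torus \<times> real) set"
  where "Omega V = UNIV \<times> {- V, V}"

definition borel_Omega :: "real \<Rightarrow> (torus \<times> real) measure"
  where "borel_Omega V = restrict_space borel (Omega V)"

definition prob_Omega :: "real \<Rightarrow> (torus \<times> real) measure set"
  where "prob_Omega V = {\<mu>. prob_space \<mu> \<and> sets \<mu> = sets (borel_Omega V)}"

definition flip :: "torus \<times> real \<Rightarrow> torus \<times> real"
  where "flip p = (fst p, - snd p)"

definition C10 :: "real \<Rightarrow> (torus \<times> real \<Rightarrow> real) set"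
  where "C10 V = {\<phi>. \<forall>v\<in>{- V, V}. (\<lambda>s. \<phi> (to_torus s, v)) C1_differentiable_on UNIV}"

definition dx :: "(torus \<times> real \<Rightarrow> real) \<Rightarrow> torus \<times> real \<Rightarrow> real"
  where "dx \<phi> p = torus_deriv (\<lambda>y. \<phi> (y, snd p)) (fst p)"

text \<open>Narrowly continuous curves \<open>[0,T] \<rightarrow> \<P>(\<Omega>\<^sub>V)\<close>. The narrow topology is the initial
  topology of the integrals against bounded continuous functions. Membership in the
  extensional function space makes equality of curves mean equality on \<open>[0,T]\<close>.\<close>

definition narrow_curves :: "real \<Rightarrow> real \<Rightarrow> (real \<Rightarrow> (torus \<times> real) measure) set"
  where "narrow_curves V T = {\<sigma> \<in> {0..T} \<rightarrow>\<^sub>E prob_Omega V.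
    \<forall>\<phi>. continuous_on (Omega V) \<phi> \<longrightarrow> bounded (\<phi> ` Omega V) \<longrightarrow>
      continuous_on {0..T} (\<lambda>t. \<integral>p. (\<phi> p :: real) \<partial>\<sigma> t)}"


section \<open>Weak solutions of the Kac equation\<close>

definition Q :: "real \<Rightarrow> (torus \<times> real \<Rightarrow> real) \<Rightarrow> torus \<times> real \<Rightarrow> real"
  where "Q lam \<phi> p = snd p * dx \<phi> p + lam * (\<phi> (flip p) - \<phi> p)"

definition weak_solution ::
  "real \<Rightarrow> real \<Rightarrow> real \<Rightarrow> (torus \<times> real) measure \<Rightarrow> (real \<Rightarrow> (torus \<times> real) measure) \<Rightarrow> bool"
  where "weak_solution V lam T \<sigma>\<^sub>0 \<sigma> \<longleftrightarrow>
    \<sigma> \<in> narrow_curves V T \<and> \<sigma> 0 = \<sigma>\<^sub>0 \<and>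
    (\<forall>\<phi>\<in>C10 V. \<forall>s t. 0 \<le> s \<longrightarrow> s \<le> t \<longrightarrow> t \<le> T \<longrightarrow>
      (\<integral>p. \<phi> p \<partial>\<sigma> t) - (\<integral>p. \<phi> p \<partial>\<sigma> s) =
      (LINT r:{s<..<t}|lborel. (\<integral>p. Q lam \<phi> p \<partial>\<sigma> r)))"


section \<open>Variational solutions\<close>

text \<open>A flux \<open>j\<close> is a family of \<open>\<real>\<^sup>2\<close>-valued measures, with \<open>\<real>\<^sup>2\<close> rendered as
  \<^typ>\<open>real \<times> real\<close>, whose norm is the Euclidean one.\<close>

type_synonym flux = "(torus \<times> real) set \<Rightarrow> real \<times> real"

definition measurable_flux_family :: "real \<Rightarrow> real \<Rightarrow> (real \<Rightarrow> flux) \<Rightarrow> bool"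
  where "measurable_flux_family V T j \<longleftrightarrow>
    (\<forall>t\<in>{0<..<T}. vector_measure (borel_Omega V) (j t)) \<and>
    (\<forall>A\<in>sets (borel_Omega V). (\<lambda>t. j t A) \<in> borel_measurable (restrict_space borel {0<..<T}))"

definition grad_pairing :: "real \<Rightarrow> (torus \<times> real \<Rightarrow> real) \<Rightarrow> flux \<Rightarrow> real"
  where "grad_pairing V \<phi> j =
    signed_integral (borel_Omega V) (\<lambda>A. fst (j A)) (dx \<phi>) +
    signed_integral (borel_Omega V) (\<lambda>A. snd (j A)) (\<lambda>p. \<phi> (flip p) - \<phi> p)"

definition CE ::
  "real \<Rightarrow> real \<Rightarrow> ((real \<Rightarrow> (torus \<times> real) measure) \<times> (real \<Rightarrow> flux)) set"
  where "CE V T = {(\<sigma>, j).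
    \<sigma> \<in> narrow_curves V T \<and> measurable_flux_family V T j \<and>
    (\<integral>\<^sup>+t\<in>{0<..<T}. tv_norm (borel_Omega V) (j t) \<partial>lborel) < \<infinity> \<and>
    (\<forall>\<phi>\<in>C10 V. \<forall>s t. 0 \<le> s \<longrightarrow> s \<le> t \<longrightarrow> t \<le> T \<longrightarrow>
      (\<integral>p. \<phi> p \<partial>\<sigma> t) - (\<integral>p. \<phi> p \<partial>\<sigma> s) =
      (LINT r:{s<..<t}|lborel. grad_pairing V \<phi> (j r)))}"

definition Lfun :: "real \<Rightarrow> real \<Rightarrow> (torus \<times> real) measure \<Rightarrow> flux \<Rightarrow> ennreal"
  where "Lfun V lam \<sigma> j =
    (if \<forall>A\<in>sets (borel_Omega V). fst (j A) = (LINT p:A|\<sigma>. snd p)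
     then Ent (\<lambda>A. snd (j A)) (scale_measure (ennreal lam) \<sigma>)
     else \<infinity>)"

definition rate_functional ::
  "real \<Rightarrow> real \<Rightarrow> real \<Rightarrow> (real \<Rightarrow> (torus \<times> real) measure) \<Rightarrow> (real \<Rightarrow> flux) \<Rightarrow> ennreal"
  where "rate_functional V lam T \<sigma> j =
    (if (\<sigma>, j) \<in> CE V T
     then \<integral>\<^sup>+t\<in>{0<..<T}. Lfun V lam (\<sigma> t) (j t) \<partial>lborel
     else \<infinity>)"

definition variational_solution ::
  "real \<Rightarrow> real \<Rightarrow> real \<Rightarrow> (torus \<times> real) measure \<Rightarrow> (real \<Rightarrow> (torus \<times> real) measure) \<Rightarrow> bool"
  where "variational_solution V lam T \<sigma>\<^sub>0 \<sigma> \<longleftrightarrow>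
    \<sigma> \<in> narrow_curves V T \<and>
    (\<exists>j. measurable_flux_family V T j \<and> (\<sigma>, j) \<in> CE V T \<and>
      Ent (measure (\<sigma> 0)) \<sigma>\<^sub>0 + rate_functional V lam T \<sigma> j = 0)"

end

theory Submission
  imports Defs
begin

text \<open>
  Existence is probabilistic: the law at time \<open>t\<close> of a particle that moves along \<open>x' = v\<close> and
  flips its velocity at the times of a Poisson clock of intensity \<open>lam\<close> is a weak solution.
  For uniqueness, the difference of two solutions is tested against \<open>\<phi>(x + (t - r) v, v)\<close>: in the
  \<open>r\<close>-derivative the transport term cancels, and iterating the resulting bound by the jump term
  gives \<open>2 \<bar>\<phi>\<bar> (2 lam t)\<^sup>n / n!\<close> for every \<open>n\<close>.
  A weak solution is a variational one with flux \<open>(v \<sigma>, lam \<sigma>)\<close>. Conversely, the entropy of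
  \<open>j\<^sup>2\<close> relative to \<open>lam \<sigma>\<close> bounds the square of a bounded function of
  \<open>\<integral>\<psi> dj\<^sup>2 - lam \<integral>\<psi> d\<sigma>\<close> from above, so that vanishing of the rate functional forces
  \<open>\<integral>\<psi> dj\<^sup>2 = lam \<integral>\<psi> d\<sigma>\<close> for almost every time.
\<close>

section \<open>Signed measures\<close>

text \<open>Two features of the rate functional shape the argument. A flux is a mere countably
  additive set function, integrals against it go through suprema over subsets, and densities through
  a choice operator; so Hahn, Jordan and Radon-Nikodym are established in exactly these terms.
  Moreover \<open>Lfun V lam (\<sigma> t) (j t)\<close> is not known to be measurable in
  \<open>t\<close>, and the integral of a nonmeasurable function is a supremum over simple functions
  below it, whose vanishing does not give vanishing almost everywhere. Hence, for one test function
  at a time, the integrand is replaced by a measurable minorant whose zeros already carry the needed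
  information. In the uniqueness proof test function and measure both move with time; a Taylor
  remainder that is uniform on phase space separates them. In the existence proof the evolution
  equation is the sum of two identities, one for the motion between jumps and one for the jumps,
  which share a boundary term; the multiple integrals over jump times are never computed.\<close>

lemma vector_measure_cong_sets:
  "sets M = sets N \<Longrightarrow> vector_measure M \<mu> \<longleftrightarrow> vector_measure N \<mu>"
  by (simp add: vector_measure_def)

lemma vector_measure_empty: "vector_measure M \<mu> \<Longrightarrow> \<mu> {} = 0"
  by (simp add: vector_measure_def)

lemma vector_measure_sums:
  "vector_measure M \<mu> \<Longrightarrow> range A \<subseteq> sets M \<Longrightarrow> disjoint_family A \<Longrightarrow>
    (\<lambda>n. \<mu> (A n)) sums \<mu> (\<Union>n::nat. A n)"
  by (simp add: vector_measure_def)

lemma vector_measure_Un: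
  assumes "vector_measure M \<mu>" "A \<in> sets M" "B \<in> sets M" "A \<inter> B = {}"
  shows "\<mu> (A \<union> B) = \<mu> A + \<mu> B"
proof -
  have "(\<lambda>n. \<mu> (binaryset A B n)) sums \<mu> (\<Union>n. binaryset A B n)"
    using assms by (intro vector_measure_sums[OF assms(1)])
      (auto simp: range_binaryset_eq disjoint_family_on_def binaryset_def)
  moreover have "(\<lambda>n. \<mu> (binaryset A B n)) sums (\<mu> A + \<mu> B)"
    using vector_measure_empty[OF assms(1)] by (rule binaryset_sums)
  ultimately show ?thesis
    by (simp add: UN_binaryset_eq sums_unique2)
qed

lemma vector_measure_Diff:
  assumes "vector_measure M \<mu>" "A \<in> sets M" "B \<in> sets M" "B \<subseteq> A"
  shows "\<mu> (A - B) = \<mu> A - \<mu> B"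
proof -
  have "\<mu> ((A - B) \<union> B) = \<mu> (A - B) + \<mu> B"
    using assms by (intro vector_measure_Un) auto
  moreover have "(A - B) \<union> B = A" using assms by auto
  ultimately show ?thesis by simp
qed

lemma vector_measure_minus: "vector_measure M \<mu> \<Longrightarrow> vector_measure M (\<lambda>A. - \<mu> A)"
  by (auto simp: vector_measure_def intro: sums_minus)

lemma vector_measure_bounded_linear:
  assumes "vector_measure M \<mu>" "bounded_linear f"
  shows "vector_measure M (\<lambda>A. f (\<mu> A))"
  using assms by (auto simp: vector_measure_def linear_simps intro: bounded_linear.sums)

lemma vector_measure_density:
  fixes f :: "'a \<Rightarrow> real"
  assumes f: "integrable N f"
  shows "vector_measure N (\<lambda>A. LINT x:A|N. f x)"
  unfolding vector_measure_def
proof (intro conjI allI impI)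
  show "(LINT x:{}|N. f x) = 0" by (simp add: set_lebesgue_integral_def)
  fix A :: "nat \<Rightarrow> 'a set" assume A: "range A \<subseteq> sets N" "disjoint_family A"
  have ind: "(\<lambda>i. indicator (A i) x :: real) sums indicator (\<Union>i. A i) x" for x
    using A(2) by (intro indicator_sums) (auto simp: disjoint_family_on_def)
  have partial: "(\<Sum>i<n. indicator (A i) x :: real) \<le> 1" for n x
  proof -
    have "(\<Sum>i<n. indicator (A i) x :: real) \<le> (\<Sum>i. indicator (A i) x)"
      using ind by (intro sum_le_suminf) (auto simp: sums_iff)
    also have "\<dots> \<le> 1" using ind[of x] by (auto simp: sums_iff indicator_def)
    finally show ?thesis .
  qed
  have int: "integrable N (\<lambda>x. indicator (A i) x *\<^sub>R f x)" for i
    using A(1) by (intro integrable_mult_indicator f) auto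
  have "(\<lambda>n. \<integral>x. (\<Sum>i<n. indicator (A i) x *\<^sub>R f x) \<partial>N) \<longlonglongrightarrow> (\<integral>x. indicator (\<Union>i. A i) x *\<^sub>R f x \<partial>N)"
  proof (rule integral_dominated_convergence[where w="\<lambda>x. \<bar>f x\<bar>"])
    show "(\<lambda>x. indicator (\<Union>i. A i) x *\<^sub>R f x) \<in> borel_measurable N"
      using A(1) f by (intro borel_measurable_scaleR borel_measurable_indicator) auto
    show "(\<lambda>x. \<Sum>i<n. indicator (A i) x *\<^sub>R f x) \<in> borel_measurable N" for n
      using int by (intro borel_measurable_sum) auto
    show "AE x in N. (\<lambda>n. \<Sum>i<n. indicator (A i) x *\<^sub>R f x) \<longlonglongrightarrow> indicator (\<Union>i. A i) x *\<^sub>R f x"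
      using ind by (intro AE_I2) (auto simp: sums_def sum_distrib_right[symmetric] intro!: tendsto_mult)
    show "AE x in N. norm (\<Sum>i<n. indicator (A i) x *\<^sub>R f x) \<le> \<bar>f x\<bar>" for n
      using partial[of _ n]
      by (intro AE_I2) (auto simp: sum_distrib_right[symmetric] abs_mult sum_nonneg intro!: mult_left_le_one_le)
  qed (use f in auto)
  then show "(\<lambda>n. LINT x:A n|N. f x) sums (LINT x:(\<Union>n. A n)|N. f x)"
    unfolding sums_def set_lebesgue_integral_def Bochner_Integration.integral_sum[OF int] .
qed

lemma vector_measure_Pair:
  assumes "vector_measure M \<mu>" "vector_measure M \<nu>"
  shows "vector_measure M (\<lambda>A. (\<mu> A, \<nu> A))"
  unfolding vector_measure_def
proof (intro conjI allI impI)
  show "(\<mu> {}, \<nu> {}) = 0"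
    using assms by (simp add: vector_measure_empty zero_prod_def)
  fix A :: "nat \<Rightarrow> 'a set" assume A: "range A \<subseteq> sets M" "disjoint_family A"
  have "(\<lambda>n. (\<mu> (A n), 0) + (0, \<nu> (A n))) sums ((\<mu> (\<Union>n. A n), 0) + (0, \<nu> (\<Union>n. A n)))"
    using A assms
    by (intro sums_add vector_measure_sums
        bounded_linear.sums[OF bounded_linear_Pair[OF bounded_linear_ident bounded_linear_zero]]
        bounded_linear.sums[OF bounded_linear_Pair[OF bounded_linear_zero bounded_linear_ident]])
  then show "(\<lambda>n. (\<mu> (A n), \<nu> (A n))) sums (\<mu> (\<Union>n. A n), \<nu> (\<Union>n. A n))" by simp
qed

lemma vector_measure_sum:
  assumes "vector_measure M \<mu>" "finite I" "\<And>i. i \<in> I \<Longrightarrow> A i \<in> sets M" "disjoint_family_on A I"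
  shows "\<mu> (\<Union>i\<in>I. A i) = (\<Sum>i\<in>I. \<mu> (A i))"
  using assms(2,3,4)
proof (induction I rule: finite_induct)
  case empty
  then show ?case using vector_measure_empty[OF assms(1)] by simp
next
  case (insert i I)
  have "\<mu> (A i \<union> (\<Union>i\<in>I. A i)) = \<mu> (A i) + \<mu> (\<Union>i\<in>I. A i)"
    using insert by (intro vector_measure_Un[OF assms(1)]) (auto simp: disjoint_family_on_def)
  then show ?case
    using insert by (auto simp: disjoint_family_on_def)
qed

text \<open>Greedy exhaustion: pieces are removed one after another from what is left. The remainder
  lies in every stage, so whatever \<open>R\<close> says about a stage and its piece applies to
  subsets of the remainder, while countable additivity makes the measures of the pieces summable.
  The relation is abstract because the Hahn decomposition runs the scheme twice, once removing
  pieces of nonnegative measure and once removing negative sets.\<close>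

lemma vector_measure_exhaust:
  fixes \<mu> :: "'a set \<Rightarrow> 'b::real_normed_vector"
  assumes vm: "vector_measure M \<mu>" and D: "D \<in> sets M"
    and pick: "\<And>A. A \<in> sets M \<Longrightarrow> \<exists>B\<in>sets M. B \<subseteq> A \<and> R A B"
  obtains B :: "nat \<Rightarrow> 'a set" where "range B \<subseteq> sets M" "disjoint_family B" "\<And>n. B n \<subseteq> D"
    "\<And>n. \<exists>A\<in>sets M. D - (\<Union>n. B n) \<subseteq> A \<and> R A (B n)" "(\<lambda>n. \<mu> (B n)) sums \<mu> (\<Union>n. B n)"
proof -
  obtain p where p: "\<And>A. A \<in> sets M \<Longrightarrow> p A \<in> sets M \<and> p A \<subseteq> A \<and> R A (p A)"
    using pick by metis
  define A where "A = rec_nat D (\<lambda>_ A. A - p A)"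
  have A0: "A 0 = D" and AS: "A (Suc n) = A n - p (A n)" for n
    by (simp_all add: A_def)
  have As: "A n \<in> sets M" for n
    by (induction n) (use D p in \<open>auto simp: A0 AS\<close>)
  have anti: "A n \<subseteq> A m" if "m \<le> n" for m n
    using that by (induction rule: dec_induct) (auto simp: AS)
  define B where "B n = p (A n)" for n
  have Bs: "range B \<subseteq> sets M" and BA: "B n \<subseteq> A n" for n
    using p As by (auto simp: B_def)
  have dis: "B m \<inter> B n = {}" if "m < n" for m n
    using anti[of "Suc m" n] BA[of n] that by (auto simp: AS B_def)
  have disj: "disjoint_family B"
    unfolding disjoint_family_on_def using dis by (metis inf_commute linorder_neqE_nat)
  have "D - (\<Union>n. B n) \<subseteq> A n" for n
    by (induction n) (auto simp: A0 AS B_def)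
  then have "\<exists>A\<in>sets M. D - (\<Union>n. B n) \<subseteq> A \<and> R A (B n)" for n
    using As[of n] p[OF As[of n]] by (auto simp: B_def)
  moreover have "B n \<subseteq> D" for n
    using BA[of n] anti[of 0 n] by (auto simp: A0)
  ultimately show ?thesis
    using that[of B] Bs disj vector_measure_sums[OF vm Bs] by blast
qed

text \<open>Half of a positive supremum is exceeded by some set, and otherwise the empty set serves.
  The truncation at 1 keeps the supremum finite, boundedness of \<open>\<mu>\<close> not being
  available at this point; later only the smallness of \<open>\<mu> B\<close> is exploited, so
  nothing is lost.\<close>

lemma vector_measure_pick:
  fixes \<mu> :: "'a set \<Rightarrow> real"
  assumes vm: "vector_measure M \<mu>" and A: "A \<in> sets M"
  shows "\<exists>B\<in>sets M. B \<subseteq> A \<and> (\<forall>C\<in>sets M. C \<subseteq> A \<longrightarrow> min 1 (\<mu> C) \<le> 2 * \<mu> B)"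
proof -
  define X where "X = (\<lambda>C. min 1 (\<mu> C)) ` {C \<in> sets M. C \<subseteq> A}"
  have bdd: "bdd_above X" by (auto simp: X_def intro!: bdd_aboveI[of _ 1])
  have "0 \<in> X" using vector_measure_empty[OF vm] by (auto simp: X_def intro!: image_eqI[of _ _ "{}"])
  show ?thesis
  proof (cases "Sup X > 0")
    case True
    then have "Sup X / 2 < Sup X" by simp
    then obtain y where "y \<in> X" "Sup X / 2 < y"
      using \<open>0 \<in> X\<close> less_cSup_iff[of X "Sup X / 2"] bdd by blast
    then obtain B where B: "B \<in> sets M" "B \<subseteq> A" "Sup X / 2 < min 1 (\<mu> B)"
      unfolding X_def by blast
    have "min 1 (\<mu> C) \<le> 2 * \<mu> B" if "C \<in> sets M" "C \<subseteq> A" for C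
      using cSup_upper[OF _ bdd, of "min 1 (\<mu> C)"] that B by (auto simp: X_def)
    then show ?thesis using B by blast
  next
    case False
    have "min 1 (\<mu> C) \<le> 2 * \<mu> {}" if "C \<in> sets M" "C \<subseteq> A" for C
      using cSup_upper[OF _ bdd, of "min 1 (\<mu> C)"] that False vector_measure_empty[OF vm]
      by (auto simp: X_def)
    then show ?thesis by blast
  qed
qed

text \<open>The removed pieces have nonnegative measure, so the remainder measures no more than
  \<open>D\<close>. Being summable, their measures tend to zero, and twice each of them bounds the
  truncated measure of every subset of the remainder.\<close>

lemma negative_subset_exists:
  fixes \<mu> :: "'a set \<Rightarrow> real"
  assumes vm: "vector_measure M \<mu>" and D: "D \<in> sets M"
  shows "\<exists>A\<in>sets M. A \<subseteq> D \<and> \<mu> A \<le> \<mu> D \<and> (\<forall>C\<in>sets M. C \<subseteq> A \<longrightarrow> \<mu> C \<le> 0)"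
proof -
  obtain B :: "nat \<Rightarrow> 'a set" where B: "range B \<subseteq> sets M" "\<And>n. B n \<subseteq> D"
    "\<And>n. \<exists>A\<in>sets M. D - (\<Union>n. B n) \<subseteq> A \<and>
      (\<forall>C\<in>sets M. C \<subseteq> A \<longrightarrow> min 1 (\<mu> C) \<le> 2 * \<mu> (B n))"
    "(\<lambda>n. \<mu> (B n)) sums \<mu> (\<Union>n. B n)"
    by (rule vector_measure_exhaust[OF vm D vector_measure_pick[OF vm]]) blast+
  let ?A = "D - (\<Union>n. B n)"
  have min: "min 1 (\<mu> C) \<le> 2 * \<mu> (B n)" if "C \<in> sets M" "C \<subseteq> ?A" for C n
  proof -
    obtain A where "?A \<subseteq> A" "\<forall>C\<in>sets M. C \<subseteq> A \<longrightarrow> min 1 (\<mu> C) \<le> 2 * \<mu> (B n)"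
      using B(3)[of n] by blast
    with that show ?thesis by (meson order_trans)
  qed
  have Un: "(\<Union>n. B n) \<in> sets M" using B(1) by auto
  have lim: "(\<lambda>n. 2 * \<mu> (B n)) \<longlonglongrightarrow> 2 * 0"
    using summable_LIMSEQ_zero[OF sums_summable[OF B(4)]] by (intro tendsto_intros)
  have neg: "\<mu> C \<le> 0" if "C \<in> sets M" "C \<subseteq> ?A" for C
    using LIMSEQ_le_const[OF lim, of "min 1 (\<mu> C)"] min[OF that] by (auto simp: min_def split: if_splits)
  have "0 \<le> \<mu> (B n)" for n
    using min[of "{}" n] vector_measure_empty[OF vm] by simp
  then have "0 \<le> \<mu> (\<Union>n. B n)"
    using B(4) by (metis suminf_nonneg sums_iff)
  moreover have "\<mu> ?A = \<mu> D - \<mu> (\<Union>n. B n)"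
    using B(2) by (intro vector_measure_Diff[OF vm D Un]) auto
  ultimately show ?thesis using neg Un D by (intro bexI[of _ ?A]) auto
qed

text \<open>Negative sets that are nearly as negative as possible are removed from the whole space.
  Additivity makes their union negative, and the remainder has no subset of negative measure because
  the removed measures tend to zero.\<close>

theorem Hahn_decomposition:
  fixes \<mu> :: "'a set \<Rightarrow> real"
  assumes vm: "vector_measure M \<mu>"
  obtains P where "P \<in> sets M" "\<And>C. C \<in> sets M \<Longrightarrow> C \<subseteq> P \<Longrightarrow> 0 \<le> \<mu> C"
    "\<And>C. C \<in> sets M \<Longrightarrow> C \<inter> P = {} \<Longrightarrow> \<mu> C \<le> 0"
proof -
  have pick: "\<exists>B\<in>sets M. B \<subseteq> A \<and> ((\<forall>C\<in>sets M. C \<subseteq> A \<longrightarrow> min 1 (- \<mu> C) \<le> - 2 * \<mu> B) \<and>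
      (\<forall>C\<in>sets M. C \<subseteq> B \<longrightarrow> \<mu> C \<le> 0))" if A: "A \<in> sets M" for A
  proof -
    obtain B where B: "B \<in> sets M" "B \<subseteq> A" "\<forall>C\<in>sets M. C \<subseteq> A \<longrightarrow> min 1 (- \<mu> C) \<le> - 2 * \<mu> B"
      using vector_measure_pick[OF vector_measure_minus[OF vm] A] by auto
    \<comment> \<open>The nearly minimal \<open>B\<close> may still have subsets of positive
      measure. Passing to a negative subset only lowers the measure, so near minimality
      survives.\<close>
    obtain N where N: "N \<in> sets M" "N \<subseteq> B" "\<mu> N \<le> \<mu> B" "\<forall>C\<in>sets M. C \<subseteq> N \<longrightarrow> \<mu> C \<le> 0"
      using negative_subset_exists[OF vm B(1)] by blast
    have "min 1 (- \<mu> C) \<le> - 2 * \<mu> N" if "C\<in>sets M" "C \<subseteq> A" for C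
      using B(3) N(3) that by force
    with N B(2) show ?thesis by (intro bexI[of _ N]) auto
  qed
  obtain B :: "nat \<Rightarrow> 'a set" where B: "range B \<subseteq> sets M" "disjoint_family B"
    "\<And>n. B n \<subseteq> space M"
    "\<And>n. \<exists>A\<in>sets M. space M - (\<Union>n. B n) \<subseteq> A \<and>
      ((\<forall>C\<in>sets M. C \<subseteq> A \<longrightarrow> min 1 (- \<mu> C) \<le> - 2 * \<mu> (B n)) \<and>
        (\<forall>C\<in>sets M. C \<subseteq> B n \<longrightarrow> \<mu> C \<le> 0))"
    "(\<lambda>n. \<mu> (B n)) sums \<mu> (\<Union>n. B n)"
    by (rule vector_measure_exhaust[OF vm sets.top pick]) blast+
  let ?P = "space M - (\<Union>n. B n)"
  have lim: "(\<lambda>n. - 2 * \<mu> (B n)) \<longlonglongrightarrow> - 2 * 0"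
    using summable_LIMSEQ_zero[OF sums_summable[OF B(5)]] by (intro tendsto_intros)
  have "min 1 (- \<mu> C) \<le> - 2 * \<mu> (B n)" if "C \<in> sets M" "C \<subseteq> ?P" for C n
  proof -
    obtain A where "?P \<subseteq> A" "\<forall>C\<in>sets M. C \<subseteq> A \<longrightarrow> min 1 (- \<mu> C) \<le> - 2 * \<mu> (B n)"
      using B(4)[of n] by blast
    with that show ?thesis by (meson order_trans)
  qed
  then have pos: "0 \<le> \<mu> C" if "C \<in> sets M" "C \<subseteq> ?P" for C
    using LIMSEQ_le_const[OF lim, of "min 1 (- \<mu> C)"] that by (auto simp: min_def split: if_splits)
  have neg: "\<mu> C \<le> 0" if C: "C \<in> sets M" "C \<inter> ?P = {}" for C
  proof -
    have sums: "(\<lambda>n. \<mu> (C \<inter> B n)) sums \<mu> (\<Union>n. C \<inter> B n)"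
      using B(1,2) C by (intro vector_measure_sums[OF vm]) (auto simp: disjoint_family_on_def)
    have eq: "(\<Union>n. C \<inter> B n) = C" using C sets.sets_into_space[OF C(1)] by auto
    have le: "\<mu> (C \<inter> B n) \<le> 0" for n
    proof -
      have "C \<inter> B n \<in> sets M" using B(1) C by auto
      moreover have "\<forall>C\<in>sets M. C \<subseteq> B n \<longrightarrow> \<mu> C \<le> 0"
        using B(4)[of n] by (elim bexE conjE)
      ultimately show ?thesis by simp
    qed
    show ?thesis using sums_le[OF le sums sums_zero] unfolding eq .
  qed
  show ?thesis
    using B(1) pos neg by (intro that[of ?P]) auto
qed

section \<open>Jordan decomposition of a signed measure\<close>

lemma sets_jordan_pos [simp, measurable_cong]: "sets (jordan_pos M \<mu>) = sets M"
  and space_jordan_pos [simp]: "space (jordan_pos M \<mu>) = space M"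
  using sets.space_closed[of M] by (simp_all add: jordan_pos_def sets.sigma_sets_eq)

text \<open>The supremum in \<open>jordan_pos\<close> is attained at \<open>A \<inter> P\<close> for
  a Hahn set \<open>P\<close>, and this is why it is countably additive. Without additivity
  \<open>measure_of\<close> would return the zero measure.\<close>

lemma emeasure_jordan_pos:
  fixes \<mu> :: "'a set \<Rightarrow> real"
  assumes vm: "vector_measure M \<mu>" and P: "P \<in> sets M"
    and pos: "\<And>C. C \<in> sets M \<Longrightarrow> C \<subseteq> P \<Longrightarrow> 0 \<le> \<mu> C"
    and neg: "\<And>C. C \<in> sets M \<Longrightarrow> C \<inter> P = {} \<Longrightarrow> \<mu> C \<le> 0"
    and A: "A \<in> sets M"
  shows "emeasure (jordan_pos M \<mu>) A = ennreal (\<mu> (A \<inter> P))"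
proof -
  have sup: "(SUP B \<in> {B \<in> sets M. B \<subseteq> A}. ennreal (\<mu> B)) = ennreal (\<mu> (A \<inter> P))"
    if A: "A \<in> sets M" for A
  proof (intro antisym SUP_least)
    fix B assume B: "B \<in> {B \<in> sets M. B \<subseteq> A}"
    have "\<mu> ((B \<inter> P) \<union> (B - P)) = \<mu> (B \<inter> P) + \<mu> (B - P)"
      using B P by (intro vector_measure_Un[OF vm]) auto
    moreover have "(B \<inter> P) \<union> (B - P) = B" by auto
    moreover have "\<mu> (B - P) \<le> 0" using B P by (intro neg) auto
    moreover have "\<mu> ((A \<inter> P) - (B \<inter> P)) = \<mu> (A \<inter> P) - \<mu> (B \<inter> P)"
      using B P A by (intro vector_measure_Diff[OF vm]) auto
    moreover have "0 \<le> \<mu> ((A \<inter> P) - (B \<inter> P))" using A B P by (intro pos) auto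
    ultimately show "ennreal (\<mu> B) \<le> ennreal (\<mu> (A \<inter> P))" by (intro ennreal_leI) simp
  qed (use A P in \<open>auto intro!: SUP_upper\<close>)
  have ca: "countably_additive (sets M) (\<lambda>A. SUP B \<in> {B \<in> sets M. B \<subseteq> A}. ennreal (\<mu> B))"
  proof (rule countably_additiveI)
    fix F :: "nat \<Rightarrow> 'a set" assume F: "range F \<subseteq> sets M" "disjoint_family F" "\<Union> (range F) \<in> sets M"
    have "(\<lambda>n. \<mu> (F n \<inter> P)) sums \<mu> (\<Union>n. F n \<inter> P)"
      using F P by (intro vector_measure_sums[OF vm]) (auto simp: disjoint_family_on_def)
    moreover have "0 \<le> \<mu> (F n \<inter> P)" for n using F P by (intro pos) auto
    ultimately have "(\<Sum>n. ennreal (\<mu> (F n \<inter> P))) = ennreal (\<mu> (\<Union> (range F) \<inter> P))"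
      by (simp add: suminf_ennreal2 sums_iff Int_UN_distrib2 Int_commute)
    moreover have "F n \<in> sets M" for n using F by auto
    ultimately show "(\<Sum>i. SUP B \<in> {B \<in> sets M. B \<subseteq> F i}. ennreal (\<mu> B)) =
        (SUP B \<in> {B \<in> sets M. B \<subseteq> \<Union> (range F)}. ennreal (\<mu> B))"
      using F(3) by (simp add: sup)
  qed
  have "positive (sets M) (\<lambda>A. SUP B \<in> {B \<in> sets M. B \<subseteq> A}. ennreal (\<mu> B))"
    using vector_measure_empty[OF vm] by (simp add: positive_def sup)
  with ca have "emeasure (jordan_pos M \<mu>) A = (SUP B \<in> {B \<in> sets M. B \<subseteq> A}. ennreal (\<mu> B))"
    unfolding jordan_pos_def
    by (intro emeasure_measure_of_sigma[OF sets.sigma_algebra_axioms _ _ A])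
  with sup[OF A] show ?thesis by simp
qed

text \<open>The last claim prepares absolute continuity: because of cancellation
  \<open>\<mu> A = 0\<close> alone says nothing about the two parts, but vanishing on all measurable
  subsets of \<open>A\<close> does.\<close>

lemma jordan_decomposition:
  fixes \<mu> :: "'a set \<Rightarrow> real"
  assumes vm: "vector_measure M \<mu>"
  shows "finite_measure (jordan_pos M \<mu>)" "finite_measure (jordan_pos M (\<lambda>A. - \<mu> A))"
    and "\<And>A. A \<in> sets M \<Longrightarrow>
      \<mu> A = measure (jordan_pos M \<mu>) A - measure (jordan_pos M (\<lambda>A. - \<mu> A)) A"
    and "\<And>A. A \<in> sets M \<Longrightarrow> (\<And>B. B \<in> sets M \<Longrightarrow> B \<subseteq> A \<Longrightarrow> \<mu> B = 0) \<Longrightarrow>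
      emeasure (jordan_pos M \<mu>) A = 0 \<and> emeasure (jordan_pos M (\<lambda>A. - \<mu> A)) A = 0"
proof -
  obtain P where P: "P \<in> sets M" and pos: "\<And>C. C \<in> sets M \<Longrightarrow> C \<subseteq> P \<Longrightarrow> 0 \<le> \<mu> C"
    and neg: "\<And>C. C \<in> sets M \<Longrightarrow> C \<inter> P = {} \<Longrightarrow> \<mu> C \<le> 0"
    using Hahn_decomposition[OF vm] by blast
  have e1: "emeasure (jordan_pos M \<mu>) A = ennreal (\<mu> (A \<inter> P))" if "A \<in> sets M" for A
    using vm P pos neg that by (rule emeasure_jordan_pos)
  have e2: "emeasure (jordan_pos M (\<lambda>A. - \<mu> A)) A = ennreal (- \<mu> (A \<inter> (space M - P)))"
    if "A \<in> sets M" for A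
  proof (rule emeasure_jordan_pos[OF vector_measure_minus[OF vm] _ _ _ that])
    fix C assume "C \<in> sets M" "C \<inter> (space M - P) = {}"
    then have "C \<subseteq> P" using sets.sets_into_space by blast
    with pos \<open>C \<in> sets M\<close> show "- \<mu> C \<le> 0" by simp
  qed (use P neg in \<open>force+\<close>)
  show "finite_measure (jordan_pos M \<mu>)" "finite_measure (jordan_pos M (\<lambda>A. - \<mu> A))"
    by (rule finite_measureI; simp add: e1 e2)+
  fix A assume A: "A \<in> sets M"
  have "measure (jordan_pos M \<mu>) A = \<mu> (A \<inter> P)"
    using A P pos by (simp add: measure_def e1)
  moreover have eq: "A \<inter> (space M - P) = A - P" using sets.sets_into_space[OF A] by auto
  have "\<mu> (A - P) \<le> 0" using A P by (intro neg) auto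
  then have "measure (jordan_pos M (\<lambda>A. - \<mu> A)) A = - \<mu> (A - P)"
    using A by (simp add: measure_def e2 eq)
  moreover have "\<mu> ((A \<inter> P) \<union> (A - P)) = \<mu> (A \<inter> P) + \<mu> (A - P)"
    using A P by (intro vector_measure_Un[OF vm]) auto
  moreover have "(A \<inter> P) \<union> (A - P) = A" by auto
  ultimately show "\<mu> A = measure (jordan_pos M \<mu>) A - measure (jordan_pos M (\<lambda>A. - \<mu> A)) A"
    by simp
  assume "\<And>B. B \<in> sets M \<Longrightarrow> B \<subseteq> A \<Longrightarrow> \<mu> B = 0"
  then show "emeasure (jordan_pos M \<mu>) A = 0 \<and> emeasure (jordan_pos M (\<lambda>A. - \<mu> A)) A = 0"
    using A P by (simp add: e1 e2)
qed

section \<open>Integration against signed measures\<close>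

lemma bounded_simple_approx:
  fixes g :: "'a \<Rightarrow> real"
  assumes g: "g \<in> borel_measurable M" and K: "\<And>x. x \<in> space M \<Longrightarrow> \<bar>g x\<bar> \<le> K"
  obtains s where "\<And>n. simple_function M (s n)" "\<And>n x. x \<in> space M \<Longrightarrow> \<bar>s n x\<bar> \<le> 2 * K"
    "\<And>x. x \<in> space M \<Longrightarrow> (\<lambda>n. s n x) \<longlonglongrightarrow> g x"
proof -
  obtain F where F: "\<And>i. simple_function M (F i)"
    "\<And>x. x \<in> space M \<Longrightarrow> (\<lambda>i. F i x) \<longlonglongrightarrow> g x"
    "\<And>i x. x \<in> space M \<Longrightarrow> dist (F i x) 0 \<le> 2 * dist (g x) 0"
    using borel_measurable_implies_sequence_metric[OF g, of 0] by blast
  show ?thesis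
  proof (rule that[of F])
    fix n x assume "x \<in> space M"
    then show "\<bar>F n x\<bar> \<le> 2 * K" using F(3)[of x n] K[of x] by simp
  qed (use F in auto)
qed

lemma integral_simple_function:
  fixes s :: "'a \<Rightarrow> real"
  assumes fin: "finite_measure N" and s: "simple_function N s"
  shows "integrable N s"
    "(\<integral>x. s x \<partial>N) = (\<Sum>y\<in>s ` space N. y * measure N (s -` {y} \<inter> space N))"
proof -
  interpret finite_measure N by fact
  have b: "Bochner_Integration.simple_bochner_integrable N s"
    using s by (simp add: simple_bochner_integrable.simps)
  show "integrable N s"
    using has_bochner_integral_simple_bochner_integrable[OF b] by (auto simp: integrable.simps)
  have "s -` {y} \<inter> space N = {x \<in> space N. s x = y}" for y by auto
  then show "(\<integral>x. s x \<partial>N) = (\<Sum>y\<in>s ` space N. y * measure N (s -` {y} \<inter> space N))"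
    using simple_bochner_integrable_eq_integral[OF b] by (simp add: simple_bochner_integral_def mult.commute)
qed

lemma integral_bounded_LIMSEQ:
  fixes s :: "nat \<Rightarrow> 'a \<Rightarrow> real"
  assumes "finite_measure N" "\<And>n. s n \<in> borel_measurable N" "g \<in> borel_measurable N"
    "\<And>n x. x \<in> space N \<Longrightarrow> \<bar>s n x\<bar> \<le> C" "\<And>x. x \<in> space N \<Longrightarrow> (\<lambda>n. s n x) \<longlonglongrightarrow> g x"
  shows "(\<lambda>n. \<integral>x. s n x \<partial>N) \<longlonglongrightarrow> (\<integral>x. g x \<partial>N)"
proof -
  interpret finite_measure N by fact
  show ?thesis
    by (rule integral_dominated_convergence[where w="\<lambda>_. C"]) (use assms in auto)
qed

lemma signed_integral_simple:
  fixes \<mu> :: "'a set \<Rightarrow> real"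
  assumes vm: "vector_measure M \<mu>" and s: "simple_function M s"
  shows "signed_integral M \<mu> s = (\<Sum>y\<in>s ` space M. y * \<mu> (s -` {y} \<inter> space M))"
proof -
  note J = jordan_decomposition[OF vm]
  have s': "simple_function (jordan_pos M \<nu>) s" for \<nu>
    using s by (simp add: simple_function_def)
  have "s -` {y} \<inter> space M \<in> sets M" if "y \<in> s ` space M" for y
    using simple_functionD(2)[OF s] .
  then show ?thesis
    unfolding signed_integral_def
      integral_simple_function(2)[OF J(1) s'] integral_simple_function(2)[OF J(2) s']
    by (simp add: J(3) sum_subtractf[symmetric] right_diff_distrib)
qed

lemma signed_integral_LIMSEQ:
  fixes \<mu> :: "'a set \<Rightarrow> real"
  assumes vm: "vector_measure M \<mu>" and "\<And>n. simple_function M (s n)" "g \<in> borel_measurable M"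
    "\<And>n x. x \<in> space M \<Longrightarrow> \<bar>s n x\<bar> \<le> C" "\<And>x. x \<in> space M \<Longrightarrow> (\<lambda>n. s n x) \<longlonglongrightarrow> g x"
  shows "(\<lambda>n. signed_integral M \<mu> (s n)) \<longlonglongrightarrow> signed_integral M \<mu> g"
  unfolding signed_integral_def
  using assms(3-5) borel_measurable_simple_function[OF assms(2)] jordan_decomposition(1,2)[OF vm]
  by (intro tendsto_diff integral_bounded_LIMSEQ[where C=C]) (auto simp: measurable_cong_sets[OF sets_jordan_pos refl])

text \<open>Both sides agree on simple functions and pass to the limit, so the Jordan parts need not
  be identified with the positive and negative parts of \<open>f\<close>. In the application
  \<open>N\<close> is the law \<open>\<sigma> t\<close>, with the velocity or the constant
  \<open>lam\<close> as density.\<close>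

lemma signed_integral_density:
  fixes \<mu> :: "'a set \<Rightarrow> real"
  assumes vm: "vector_measure M \<mu>" and sN: "sets N = sets M" and f: "integrable N f"
    and \<mu>: "\<And>A. A \<in> sets M \<Longrightarrow> \<mu> A = (LINT x:A|N. f x)"
    and g: "g \<in> borel_measurable M" and K: "\<And>x. x \<in> space M \<Longrightarrow> \<bar>g x\<bar> \<le> K"
  shows "signed_integral M \<mu> g = (\<integral>x. g x * f x \<partial>N)"
proof -
  have sp: "space N = space M" using sN by (rule sets_eq_imp_space_eq)
  have [measurable]: "f \<in> borel_measurable N" using f by auto
  have [measurable]: "g \<in> borel_measurable N" using g sN by (simp cong: measurable_cong_sets)
  obtain s where s: "\<And>n. simple_function M (s n)" "\<And>n x. x \<in> space M \<Longrightarrow> \<bar>s n x\<bar> \<le> 2 * K"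
    "\<And>x. x \<in> space M \<Longrightarrow> (\<lambda>n. s n x) \<longlonglongrightarrow> g x"
    using bounded_simple_approx[OF g K] by blast
  have [measurable]: "s n \<in> borel_measurable N" for n
    using borel_measurable_simple_function[OF s(1)[of n]] sN by (simp cong: measurable_cong_sets)
  have eq: "signed_integral M \<mu> (s n) = (\<integral>x. s n x * f x \<partial>N)" for n
  proof -
    have fin: "finite (s n ` space M)" using s(1)[of n] by (simp add: simple_function_def)
    have ms: "s n -` {y} \<inter> space M \<in> sets M" if "y \<in> s n ` space M" for y
      using simple_functionD(2)[OF s(1)] .
    have "s n x * f x = (\<Sum>y\<in>s n ` space M. y * (indicator (s n -` {y} \<inter> space M) x *\<^sub>R f x))"
      if x: "x \<in> space M" for x
    proof -
      have "(\<Sum>y\<in>s n ` space M. y * (indicator (s n -` {y} \<inter> space M) x *\<^sub>R f x)) =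
          (\<Sum>y\<in>s n ` space M. if y = s n x then s n x * f x else 0)"
        using x by (intro sum.cong) (auto simp: indicator_def)
      then show ?thesis using x fin by simp
    qed
    then have "(\<integral>x. s n x * f x \<partial>N) =
        (\<integral>x. (\<Sum>y\<in>s n ` space M. y * (indicator (s n -` {y} \<inter> space M) x *\<^sub>R f x)) \<partial>N)"
      by (intro Bochner_Integration.integral_cong) (auto simp: sp)
    also have "\<dots> = (\<Sum>y\<in>s n ` space M. \<integral>x. y * (indicator (s n -` {y} \<inter> space M) x *\<^sub>R f x) \<partial>N)"
      using ms sN f by (intro Bochner_Integration.integral_sum integrable_mult_right integrable_mult_indicator) auto
    also have "\<dots> = (\<Sum>y\<in>s n ` space M. y * \<mu> (s n -` {y} \<inter> space M))"
      using ms by (intro sum.cong) (auto simp: \<mu> set_lebesgue_integral_def)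
    finally show ?thesis by (simp add: signed_integral_simple[OF vm s(1)])
  qed
  have "(\<lambda>n. \<integral>x. s n x * f x \<partial>N) \<longlonglongrightarrow> (\<integral>x. g x * f x \<partial>N)"
  proof (rule integral_dominated_convergence[where w="\<lambda>x. 2 * K * \<bar>f x\<bar>"])
    show "AE x in N. (\<lambda>i. s i x * f x) \<longlonglongrightarrow> g x * f x"
      using s(3) by (auto intro!: tendsto_intros simp: sp)
    show "AE x in N. norm (s n x * f x) \<le> 2 * K * \<bar>f x\<bar>" for n
      using s(2)[of _ n] by (auto simp: sp abs_mult intro!: mult_right_mono)
  qed (use f in auto)
  moreover have "(\<lambda>n. signed_integral M \<mu> (s n)) \<longlonglongrightarrow> signed_integral M \<mu> g"
    by (rule signed_integral_LIMSEQ[OF vm s(1) g s(2,3)])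
  ultimately show ?thesis using LIMSEQ_unique by (auto simp: eq)
qed

text \<open>The Jordan parts depend on \<open>t\<close> through a supremum over all measurable
  subsets, which hides measurability. On simple functions the two parts recombine into a finite
  combination of values \<open>\<mu> t A\<close>; the general case is a pointwise limit.\<close>

lemma measurable_signed_integral:
  fixes \<mu> :: "'t \<Rightarrow> 'a set \<Rightarrow> real"
  assumes vm: "\<And>t. t \<in> space L \<Longrightarrow> vector_measure M (\<mu> t)"
    and m: "\<And>A. A \<in> sets M \<Longrightarrow> (\<lambda>t. \<mu> t A) \<in> borel_measurable L"
    and g: "g \<in> borel_measurable M" and K: "\<And>x. x \<in> space M \<Longrightarrow> \<bar>g x\<bar> \<le> K"
  shows "(\<lambda>t. signed_integral M (\<mu> t) g) \<in> borel_measurable L"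
proof -
  obtain s where s: "\<And>n. simple_function M (s n)" "\<And>n x. x \<in> space M \<Longrightarrow> \<bar>s n x\<bar> \<le> 2 * K"
    "\<And>x. x \<in> space M \<Longrightarrow> (\<lambda>n. s n x) \<longlonglongrightarrow> g x"
    using bounded_simple_approx[OF g K] by blast
  show ?thesis
  proof (rule borel_measurable_LIMSEQ_real)
    show "(\<lambda>n. signed_integral M (\<mu> t) (s n)) \<longlonglongrightarrow> signed_integral M (\<mu> t) g"
      if "t \<in> space L" for t
      by (rule signed_integral_LIMSEQ[OF vm[OF that] s(1) g s(2,3)])
    have "s n -` {y} \<inter> space M \<in> sets M" if "y \<in> s n ` space M" for y n
      using simple_functionD(2)[OF s(1)] .
    then have "(\<lambda>t. \<Sum>y\<in>s n ` space M. y * \<mu> t (s n -` {y} \<inter> space M)) \<in> borel_measurable L" for n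
      using m by (intro borel_measurable_sum borel_measurable_times) auto
    then show "(\<lambda>t. signed_integral M (\<mu> t) (s n)) \<in> borel_measurable L" for n
      by (subst measurable_cong[OF signed_integral_simple[OF vm s(1)]]) auto
  qed
qed

text \<open>\<open>signed_RN_deriv\<close> is a choice, so existence of some density is what
  matters. Measurable subsets of a null set are null, hence both Jordan parts are absolutely
  continuous; their densities, made real by \<open>enn2real\<close>, are subtracted.\<close>

theorem signed_Radon_Nikodym:
  fixes \<mu> :: "'a set \<Rightarrow> real"
  assumes vm: "vector_measure N \<mu>" and fin: "finite_measure N" and ac: "signed_abs_cont \<mu> N"
  shows "is_density \<mu> N (signed_RN_deriv \<mu> N)"
proof -
  interpret finite_measure N by fact
  note J = jordan_decomposition[OF vm]
  have null: "\<mu> B = 0" if "A \<in> null_sets N" "B \<in> sets N" "B \<subseteq> A" for A B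
    using ac null_sets_subset[OF that] by (simp add: signed_abs_cont_def)
  have "\<exists>f. integrable N f \<and> (\<forall>A\<in>sets N. measure J A = (LINT x:A|N. f x))"
    if J: "finite_measure J" "sets J = sets N" "null_sets N \<subseteq> null_sets J" for J
  proof -
    interpret J: finite_measure J by fact
    obtain f where f [measurable]: "f \<in> borel_measurable N" and "density N f = J"
      using Radon_Nikodym_finite_measure[OF J(1,2)] J(3) by (auto simp: absolutely_continuous_def)
    then have em: "emeasure J A = (\<integral>\<^sup>+x. f x * indicator A x \<partial>N)" if "A \<in> sets N" for A
      using that by (auto simp: emeasure_density)
    have "(\<integral>\<^sup>+x. f x \<partial>N) \<noteq> \<infinity>"
      using em[of "space N"] J.emeasure_finite[of "space N"]
      by (simp cong: nn_integral_cong)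
    then have "AE x in N. f x \<noteq> \<infinity>" by (intro nn_integral_noteq_infinite) auto
    then have fe: "AE x in N. ennreal (enn2real (f x)) = f x"
      by (auto simp: less_top)
    have int: "integrable N (\<lambda>x. enn2real (f x))"
    proof (rule integrableI_nonneg)
      show "(\<integral>\<^sup>+x. ennreal (enn2real (f x)) \<partial>N) < \<infinity>"
        using \<open>(\<integral>\<^sup>+x. f x \<partial>N) \<noteq> \<infinity>\<close> nn_integral_cong_AE[OF fe] by (simp add: less_top)
    qed auto
    have "measure J A = (LINT x:A|N. enn2real (f x))" if A: "A \<in> sets N" for A
    proof -
      have "ennreal (LINT x:A|N. enn2real (f x)) = (\<integral>\<^sup>+x. ennreal (indicator A x *\<^sub>R enn2real (f x)) \<partial>N)"
        unfolding set_lebesgue_integral_def using A int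
        by (intro nn_integral_eq_integral[symmetric] integrable_mult_indicator) auto
      also have "\<dots> = (\<integral>\<^sup>+x. f x * indicator A x \<partial>N)"
        using fe by (intro nn_integral_cong_AE) (auto simp: indicator_def)
      finally have "ennreal (LINT x:A|N. enn2real (f x)) = emeasure J A" using em[OF A] by simp
      moreover have "0 \<le> (LINT x:A|N. enn2real (f x))"
        unfolding set_lebesgue_integral_def by (intro integral_nonneg_AE) auto
      ultimately show ?thesis by (metis enn2real_ennreal measure_def)
    qed
    with int show ?thesis by blast
  qed
  moreover have "null_sets N \<subseteq> null_sets (jordan_pos N \<mu>)"
    "null_sets N \<subseteq> null_sets (jordan_pos N (\<lambda>A. - \<mu> A))"
    using null by (auto intro!: null_setsI J(4)[THEN conjunct1] J(4)[THEN conjunct2])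
  ultimately obtain f g where
    f: "integrable N f" "\<And>A. A \<in> sets N \<Longrightarrow> measure (jordan_pos N \<mu>) A = (LINT x:A|N. f x)" and
    g: "integrable N g" "\<And>A. A \<in> sets N \<Longrightarrow> measure (jordan_pos N (\<lambda>A. - \<mu> A)) A = (LINT x:A|N. g x)"
    using J(1,2) sets_jordan_pos by metis
  have "is_density \<mu> N (\<lambda>x. f x - g x)"
    unfolding is_density_def
  proof (intro conjI ballI)
    fix A assume A: "A \<in> sets N"
    have "(LINT x:A|N. f x - g x) = (LINT x:A|N. f x) - (LINT x:A|N. g x)"
      using integrable_mult_indicator[OF A f(1)] integrable_mult_indicator[OF A g(1)]
      by (intro set_integral_diff) (auto simp: set_integrable_def)
    then show "\<mu> A = (LINT x:A|N. f x - g x)" using A f(2) g(2) J(3) by simp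
  qed (use f g in auto)
  then show ?thesis unfolding signed_RN_deriv_def by (rule someI[of "is_density \<mu> N"])
qed

section \<open>Relative entropy\<close>

lemma finite_measure_scale:
  assumes "finite_measure N"
  shows "finite_measure (scale_measure (ennreal c) N)"
  using finite_measure.emeasure_finite[OF assms]
  by (intro finite_measureI) (auto simp: space_scale_measure ennreal_mult_eq_top_iff)

lemma scale_measure_eq_density: "scale_measure c N = density N (\<lambda>_. c)"
  by (rule measure_eqI) (auto simp: emeasure_density nn_integral_cmult)

lemma integral_scale_measure:
  fixes g :: "'a \<Rightarrow> real"
  assumes "g \<in> borel_measurable N" "0 \<le> c"
  shows "(\<integral>x. g x \<partial>scale_measure (ennreal c) N) = c * (\<integral>x. g x \<partial>N)"
  unfolding scale_measure_eq_density using assms by (subst integral_density) auto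

section \<open>Lower bounds for the relative entropy by convex duality\<close>

lemma exp_le_quadratic:
  fixes y :: real
  assumes "\<bar>y\<bar> \<le> 1"
  shows "exp y \<le> 1 + y + y\<^sup>2"
proof (cases "0 \<le> y")
  case True
  then show ?thesis using exp_bound[of y] assms by simp
next
  case False
  \<comment> \<open>The product equals \<open>1 - y ^ 3\<close>, and \<open>y\<close> is negative
    here.\<close>
  have "1 \<le> (1 + y + y\<^sup>2) * (1 - y)"
    using False zero_le_power[of "- y" 3] by (simp add: algebra_simps power2_eq_square power3_eq_cube)
  also have "\<dots> \<le> (1 + y + y\<^sup>2) * exp (- y)"
    using exp_ge_add_one_self[of "- y"] zero_le_power2[of "y + 1/2"]
    by (intro mult_left_mono) (auto simp: power2_eq_square algebra_simps)
  finally show ?thesis by (simp add: exp_minus field_simps)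
qed

text \<open>Young's inequality: \<open>f * ln f - f + 1\<close> is convex conjugate to
  \<open>exp y - 1\<close>, and the exponential is replaced by its quadratic bound. The cost is of
  second order in \<open>y\<close>, so a small \<open>y\<close> of the right sign detects any
  deviation of \<open>f\<close> from 1.\<close>

lemma entropy_integrand_ge:
  fixes f y :: real
  assumes f: "0 \<le> f" and y: "\<bar>y\<bar> \<le> 1"
  shows "y * (f - 1) - y\<^sup>2 \<le> f * ln f - f + 1"
proof (cases "f = 0")
  case True
  then show ?thesis using zero_le_power2[of "y + 1/2"] by (simp add: power2_eq_square algebra_simps)
next
  case False
  then have "f > 0" using f by simp
  then have "y - ln f \<le> exp y / f - 1"
    using ln_le_minus_one[of "exp y / f"] by (simp add: ln_div)
  then have "f * (y - ln f) \<le> f * (exp y / f - 1)"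
    using f by (rule mult_left_mono)
  also have "\<dots> = exp y - f" using \<open>f > 0\<close> by (simp add: algebra_simps)
  finally show ?thesis using exp_le_quadratic[OF y] by (simp add: algebra_simps)
qed

text \<open>The pointwise bound with \<open>y = c * \<psi> x\<close> is integrated, the condition on
  \<open>c\<close> ensuring \<open>\<bar>y\<bar> \<le> 1\<close>. The point is that the resulting
  lower bound no longer mentions the density.\<close>

lemma Ent_ge:
  fixes \<mu> :: "'a set \<Rightarrow> real"
  assumes vm: "vector_measure M \<mu>" and sN: "sets N = sets M" and fin: "finite_measure N"
    and \<psi>: "\<psi> \<in> borel_measurable M" and K: "\<And>x. x \<in> space M \<Longrightarrow> \<bar>\<psi> x\<bar> \<le> K"
    and c: "\<bar>c\<bar> * K \<le> 1"
  shows "ennreal (c * (signed_integral M \<mu> \<psi> - (\<integral>x. \<psi> x \<partial>N)) - c\<^sup>2 * K\<^sup>2 * measure N (space N)) \<le> Ent \<mu> N"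
proof (cases "signed_abs_cont \<mu> N \<and> (AE x in N. 0 \<le> signed_RN_deriv \<mu> N x)")
  case True
  interpret finite_measure N by fact
  have sp: "space N = space M" using sN by (rule sets_eq_imp_space_eq)
  define f where "f = signed_RN_deriv \<mu> N"
  have den: "is_density \<mu> N f"
    using signed_Radon_Nikodym[OF _ fin, of \<mu>] vm True by (simp add: vector_measure_cong_sets[OF sN] f_def)
  then have f: "integrable N f" by (simp add: is_density_def)
  have [measurable]: "f \<in> borel_measurable N" using f by auto
  have [measurable]: "\<psi> \<in> borel_measurable N" using \<psi> sN by (simp cong: measurable_cong_sets)
  have \<psi>i: "integrable N \<psi>" using K by (intro integrable_const_bound[where B=K]) (auto simp: sp)
  have \<psi>f: "integrable N (\<lambda>x. \<psi> x * f x)"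
  proof (rule Bochner_Integration.integrable_bound)
    show "AE x in N. norm (\<psi> x * f x) \<le> norm (K * f x)"
    proof (rule AE_I2)
      fix x assume "x \<in> space N"
      then have "\<bar>\<psi> x\<bar> \<le> \<bar>K\<bar>" using K[of x] sp by fastforce
      then show "norm (\<psi> x * f x) \<le> norm (K * f x)" by (auto simp: abs_mult intro: mult_right_mono)
    qed
  qed (use f in auto)
  have \<psi>2: "integrable N (\<lambda>x. (\<psi> x)\<^sup>2)"
  proof (rule integrable_const_bound[where B="K\<^sup>2"])
    show "AE x in N. norm ((\<psi> x)\<^sup>2) \<le> K\<^sup>2"
      using K by (auto simp: sp power2_le_iff_abs_le abs_le_square_iff[symmetric] intro!: AE_I2 order_trans[OF K])
  qed auto
  define h where "h x = c * (\<psi> x * f x - \<psi> x) - c\<^sup>2 * (\<psi> x)\<^sup>2" for x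
  have hi: "integrable N h" unfolding h_def
    by (intro Bochner_Integration.integrable_diff integrable_mult_right \<psi>f \<psi>i \<psi>2)
  have "(\<integral>x. (\<psi> x)\<^sup>2 \<partial>N) \<le> (\<integral>x. K\<^sup>2 \<partial>N)"
    using \<psi>2 K by (intro integral_mono) (auto simp: sp intro: abs_le_square_iff[THEN iffD1] order_trans[OF _ abs_ge_self])
  then have "c * (signed_integral M \<mu> \<psi> - (\<integral>x. \<psi> x \<partial>N)) - c\<^sup>2 * K\<^sup>2 * measure N (space N) \<le>
      c * ((\<integral>x. \<psi> x * f x \<partial>N) - (\<integral>x. \<psi> x \<partial>N)) - c\<^sup>2 * (\<integral>x. (\<psi> x)\<^sup>2 \<partial>N)"
    using signed_integral_density[OF vm sN f _ \<psi> K] den sN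
    by (auto simp: is_density_def mult.assoc mult.commute[of "K\<^sup>2"] intro!: mult_left_mono)
  also have "\<dots> = (\<integral>x. h x \<partial>N)"
    unfolding h_def using \<psi>f \<psi>i \<psi>2 by simp
  \<comment> \<open>Extended nonnegative integrals see only the positive part of \<open>h\<close>.
    The entropy integrand dominates it, since it dominates \<open>h\<close> and, by the case
    \<open>y = 0\<close> of the pointwise bound, also zero.\<close>
  also have "\<dots> \<le> (\<integral>x. max 0 (h x) \<partial>N)"
    using hi by (intro integral_mono) auto
  finally have "ennreal (c * (signed_integral M \<mu> \<psi> - (\<integral>x. \<psi> x \<partial>N)) - c\<^sup>2 * K\<^sup>2 * measure N (space N)) \<le>
      ennreal (\<integral>x. max 0 (h x) \<partial>N)"
    by (rule ennreal_leI)
  also have "\<dots> = (\<integral>\<^sup>+x. ennreal (max 0 (h x)) \<partial>N)"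
    using hi by (intro nn_integral_eq_integral[symmetric]) auto
  also have "\<dots> \<le> (\<integral>\<^sup>+x. ennreal (f x * ln (f x) - f x + 1) \<partial>N)"
  proof (rule nn_integral_mono_AE)
    show "AE x in N. ennreal (max 0 (h x)) \<le> ennreal (f x * ln (f x) - f x + 1)"
      using True[THEN conjunct2] AE_space
    proof eventually_elim
      case (elim x)
      have "\<bar>c * \<psi> x\<bar> \<le> \<bar>c\<bar> * K"
        using K[of x] elim sp by (auto simp: abs_mult intro!: mult_left_mono)
      then have "\<bar>c * \<psi> x\<bar> \<le> 1" using c by simp
      from entropy_integrand_ge[OF _ this, of "f x"] entropy_integrand_ge[of "f x" 0] elim
      show ?case by (intro ennreal_leI) (auto simp: h_def f_def algebra_simps power2_eq_square)
    qed
  qed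
  also have "\<dots> = Ent \<mu> N" using True by (simp add: Ent_def f_def Let_def)
  finally show ?thesis .
next
  case False
  then have "Ent \<mu> N = \<infinity>" unfolding Ent_def Let_def by (rule if_not_P)
  then show ?thesis by simp
qed

text \<open>The choice \<open>c = d / (1 + \<bar>d\<bar>) / (1 + K + K\<^sup>2 \<nu>(\<Omega>))\<close> in the previous bound. Unlike the
  entropy itself, this lower bound obviously depends measurably on the measures.\<close>

lemma Ent_ge_square:
  fixes \<mu> :: "'a set \<Rightarrow> real"
  assumes vm: "vector_measure M \<mu>" and sN: "sets N = sets M" and fin: "finite_measure N"
    and \<psi>: "\<psi> \<in> borel_measurable M" and K: "\<And>x. x \<in> space M \<Longrightarrow> \<bar>\<psi> x\<bar> \<le> K" and K0: "0 \<le> K"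
  defines "d \<equiv> signed_integral M \<mu> \<psi> - (\<integral>x. \<psi> x \<partial>N)"
  shows "ennreal ((d / (1 + \<bar>d\<bar>) / (1 + K + K\<^sup>2 * measure N (space N)))\<^sup>2) \<le> Ent \<mu> N"
proof -
  \<comment> \<open>The multiplier is \<open>c = a * e\<close>. The bounded \<open>e\<close> has the
    sign of \<open>d\<close> and satisfies \<open>e\<^sup>2 \<le> e * d\<close>; the factor
    \<open>a\<close> secures \<open>\<bar>c\<bar> * K \<le> 1\<close> and, through
    \<open>a * m + a \<le> 1\<close>, absorbs the quadratic cost
    \<open>c\<^sup>2 * m\<close>.\<close>
  define m where "m = K\<^sup>2 * measure N (space N)"
  define a where "a = 1 / (1 + K + m)"
  define e where "e = d / (1 + \<bar>d\<bar>)"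
  have m: "0 \<le> m" by (simp add: m_def)
  have a: "0 < a" "a * K \<le> 1" "a * m + a \<le> 1" using K0 m by (auto simp: a_def field_simps)
  have "\<bar>e\<bar> \<le> 1" by (simp add: e_def field_simps)
  then have "\<bar>a * e\<bar> * K \<le> a * K * 1"
    using a K0 mult_right_mono[OF \<open>\<bar>e\<bar> \<le> 1\<close> K0]
    by (simp add: abs_mult mult.assoc)
  then have c: "\<bar>a * e\<bar> * K \<le> 1" using a by simp
  have "d = e * (1 + \<bar>d\<bar>)" by (simp add: e_def)
  then have "e * d = e * (e * (1 + \<bar>d\<bar>))" by (rule arg_cong)
  also have "\<dots> = e\<^sup>2 + e\<^sup>2 * \<bar>d\<bar>" by (simp add: algebra_simps power2_eq_square)
  finally have "e\<^sup>2 \<le> e * d" by simp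
  have "(e * a)\<^sup>2 \<le> a * e * d - (a * e)\<^sup>2 * m"
  proof -
    have "(e * a)\<^sup>2 + (a * e)\<^sup>2 * m = a * (e\<^sup>2 * (a * m + a))"
      by (simp add: algebra_simps power2_eq_square)
    also have "\<dots> \<le> a * (e\<^sup>2 * 1)"
      using a by (intro mult_left_mono) auto
    also have "\<dots> \<le> a * (e * d)" using \<open>e\<^sup>2 \<le> e * d\<close> a by (intro mult_left_mono) auto
    finally show ?thesis by (simp add: algebra_simps)
  qed
  then have "ennreal ((e * a)\<^sup>2) \<le> ennreal (a * e * d - (a * e)\<^sup>2 * K\<^sup>2 * measure N (space N))"
    by (intro ennreal_leI) (simp add: m_def mult.assoc)
  also have "\<dots> \<le> Ent \<mu> N"
    using Ent_ge[OF vm sN fin \<psi> K c] by (simp add: d_def)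
  finally show ?thesis by (simp add: e_def a_def m_def)
qed

lemma set_integral_one: "A \<in> sets N \<Longrightarrow> (LINT x:A|N. 1) = measure N A"
  using sets.sets_into_space[of A N] by (simp add: set_lebesgue_integral_def Int_absorb2)

text \<open>The constant 1 is a density, and densities are unique almost everywhere, so the chosen
  one is 1 up to a null set.\<close>

lemma Ent_eq_0:
  assumes fin: "finite_measure N" and \<mu>: "\<And>A. A \<in> sets N \<Longrightarrow> \<mu> A = measure N A"
  shows "Ent \<mu> N = 0"
proof -
  interpret finite_measure N by fact
  have "is_density \<mu> N (\<lambda>_. 1)"
    using \<mu> by (simp add: is_density_def set_integral_one)
  then have den: "is_density \<mu> N (signed_RN_deriv \<mu> N)"
    unfolding signed_RN_deriv_def by (rule someI[of "is_density \<mu> N"])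
  then have "AE x in N. signed_RN_deriv \<mu> N x = 1"
    using \<mu> by (intro density_unique_banach) (auto simp: is_density_def set_integral_one)
  moreover from this have "(\<integral>\<^sup>+x. ennreal (signed_RN_deriv \<mu> N x * ln (signed_RN_deriv \<mu> N x) -
      signed_RN_deriv \<mu> N x + 1) \<partial>N) = (\<integral>\<^sup>+x. 0 \<partial>N)"
    by (intro nn_integral_cong_AE) auto
  moreover have "signed_abs_cont \<mu> N"
    using \<mu> by (auto simp: signed_abs_cont_def measure_def null_setsD1 null_setsD2)
  ultimately show ?thesis by (auto simp: Ent_def Let_def)
qed

lemma vector_measure_measure:
  assumes "finite_measure N"
  shows "vector_measure N (measure N)"
  using finite_measure.finite_measure_UNION[OF assms] by (simp add: vector_measure_def)

lemma signed_integral_measure: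
  fixes g :: "'a \<Rightarrow> real"
  assumes N: "finite_measure N" "sets N = sets M" and g: "g \<in> borel_measurable M"
    and K: "\<And>x. x \<in> space M \<Longrightarrow> \<bar>g x\<bar> \<le> K"
  shows "signed_integral M (measure N) g = (\<integral>x. g x \<partial>N)"
proof -
  have "vector_measure M (measure N)"
    using vector_measure_measure[OF N(1)] by (simp add: vector_measure_cong_sets[OF N(2)])
  then show ?thesis
    using signed_integral_density[of M "measure N" N "\<lambda>_. 1" g K] N g K
    by (simp add: set_integral_one finite_measure.integrable_const)
qed

text \<open>Indicator functions are admissible in \<open>Ent_ge_square\<close>, so zero entropy
  forces equality on every measurable set. This converts the entropy of the initial law into the
  initial condition.\<close>

lemma Ent_measure_eq_0_D:
  assumes fin: "finite_measure M" "finite_measure N" and s: "sets M = sets N"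
    and 0: "Ent (measure M) N = 0"
  shows "M = N"
proof (rule measure_eqI[OF s])
  fix A assume A: "A \<in> sets M"
  have sp: "space M = space N" using s by (rule sets_eq_imp_space_eq)
  have vm: "vector_measure N (measure M)"
    using vector_measure_measure[OF fin(1)] by (simp add: vector_measure_cong_sets[OF s])
  define d where "d = signed_integral N (measure M) (indicator A) - (\<integral>x. indicator A x \<partial>N)"
  have m: "indicator A \<in> borel_measurable N" using A s by auto
  have "signed_integral N (measure M) (indicator A) = (\<integral>x. indicator A x \<partial>M)"
    using fin(1) s m by (rule signed_integral_measure[where K=1]) auto
  also have "\<dots> = measure M A"
    using A sets.sets_into_space[OF A] by (simp add: Int_absorb2)
  finally have d: "d = measure M A - measure N A"
    using A s sets.sets_into_space[OF A] sp by (simp add: d_def Int_absorb2)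
  have "ennreal ((d / (1 + \<bar>d\<bar>) / (1 + 1 + 1\<^sup>2 * measure N (space N)))\<^sup>2) \<le> 0"
    unfolding d_def 0[symmetric] by (rule Ent_ge_square[OF vm refl fin(2) m]) auto
  moreover have "0 < 1 + 1 + 1\<^sup>2 * measure N (space N)" "0 < 1 + \<bar>d\<bar>"
    by (auto intro: add_pos_nonneg)
  ultimately have "d = 0" by (auto simp: ennreal_eq_0_iff)
  then show "emeasure M A = emeasure N A"
    using d fin by (simp add: finite_measure.emeasure_eq_measure)
qed

section \<open>Test functions on the phase space\<close>

lemma open_vimage_to_torus: "open U \<Longrightarrow> open (to_torus -` U)"
  by (simp add: open_torus_def)

lemma continuous_on_to_torus:
  "continuous_on S f \<Longrightarrow> continuous_on S (\<lambda>x. to_torus (f x))"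
  by (rule continuous_on_compose2[of UNIV to_torus])
    (auto intro: continuous_on_open_vimage[THEN iffD2] simp: open_vimage_to_torus)

lemma to_torus_add_of_int [simp]: "to_torus (s + of_int k) = to_torus s"
  by (simp add: to_torus_eq_iff)

lemma to_torus_frac [simp]: "to_torus (frac s) = to_torus s"
  by (simp add: to_torus_eq_iff frac_def)

lemma to_torus_rep [simp]: "to_torus (rep_torus x) = x"
  by (metis Quotient3_abs_rep Quotient3_torus)

lemma open_image_to_torus:
  assumes "open S"
  shows "open (to_torus ` S)"
proof -
  have "to_torus -` (to_torus ` S) = (\<Union>k::int. (\<lambda>s. s + of_int k) ` S)"
  proof (intro set_eqI iffI)
    fix x assume "x \<in> to_torus -` (to_torus ` S)"
    then obtain s where "s \<in> S" "x - s \<in> \<int>" by (auto simp: to_torus_eq_iff)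
    then show "x \<in> (\<Union>k::int. (\<lambda>s. s + of_int k) ` S)"
      by (auto elim!: Ints_cases simp: algebra_simps intro!: image_eqI[of _ _ s])
  qed auto
  then show ?thesis
    unfolding open_torus_def using assms by (auto intro: open_translation_subtract open_UN simp: add.commute[of _ "of_int _"] open_translation)
qed

text \<open>\<open>rep_torus\<close> is an arbitrary choice about whose measurability nothing is
  known; its fractional part does not depend on the choice.\<close>

definition section_torus :: "torus \<Rightarrow> real"
  where "section_torus x = frac (rep_torus x)"

lemma to_torus_section [simp]: "to_torus (section_torus x) = x"
  by (simp add: section_torus_def)

lemma section_to_torus: "section_torus (to_torus s) = frac s"
proof -
  have "rep_torus (to_torus s) - s \<in> \<int>"
    by (simp flip: to_torus_eq_iff)
  then obtain k where "rep_torus (to_torus s) = s + of_int k"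
    by (auto elim!: Ints_cases simp: algebra_simps)
  then show ?thesis by (simp add: section_torus_def frac_def)
qed

lemma section_torus_bounds: "0 \<le> section_torus x" "section_torus x < 1"
  by (simp_all add: section_torus_def frac_lt_1)

text \<open>Only the class of 0 is a point of discontinuity: the preimage of an open set is the open
  image of a subset of the open unit interval, with at most that one closed point added.\<close>

lemma measurable_section_torus [measurable]: "section_torus \<in> borel_measurable borel"
proof (rule borel_measurableI)
  fix S :: "real set" assume "open S"
  have "closed {to_torus 0}"
  proof -
    have "to_torus -` (- {to_torus 0}) = - \<int>" by (auto simp: to_torus_eq_iff)
    then show ?thesis unfolding closed_def open_torus_def by (simp add: open_Compl)
  qed
  have "section_torus -` S = to_torus ` (S \<inter> {0<..<1}) \<union> (if 0 \<in> S then {to_torus 0} else {})"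
  proof (intro set_eqI iffI)
    fix x assume "x \<in> section_torus -` S"
    then show "x \<in> to_torus ` (S \<inter> {0<..<1}) \<union> (if 0 \<in> S then {to_torus 0} else {})"
      using section_torus_bounds[of x] to_torus_section[of x]
      by (cases "section_torus x = 0") (auto intro!: image_eqI[of _ _ "section_torus x"])
  next
    fix x assume "x \<in> to_torus ` (S \<inter> {0<..<1}) \<union> (if 0 \<in> S then {to_torus 0} else {})"
    then show "x \<in> section_torus -` S"
      by (auto simp: section_to_torus split: if_splits)
  qed
  moreover have "open (to_torus ` (S \<inter> {0<..<1}))"
    using \<open>open S\<close> by (intro open_image_to_torus) auto
  ultimately show "section_torus -` S \<inter> space borel \<in> sets borel"
    using \<open>closed {to_torus 0}\<close> by auto
qed

section \<open>Continuous functions on the torus and on the phase space\<close>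

lemma continuous_on_torus_iff:
  fixes g :: "torus \<Rightarrow> 'b::topological_space"
  shows "continuous_on UNIV g \<longleftrightarrow> continuous_on UNIV (\<lambda>s. g (to_torus s))"
proof
  assume "continuous_on UNIV g"
  then show "continuous_on UNIV (\<lambda>s. g (to_torus s))"
    by (rule continuous_on_compose2[of UNIV g UNIV to_torus])
      (simp_all add: continuous_on_to_torus[OF continuous_on_id])
next
  assume *: "continuous_on UNIV (\<lambda>s. g (to_torus s))"
  show "continuous_on UNIV g"
  proof (subst continuous_on_open_vimage[OF open_UNIV], intro allI impI)
    fix B :: "'b set" assume "open B"
    then have "open ((\<lambda>s. g (to_torus s)) -` B)" using * by (simp add: continuous_on_open_vimage[OF open_UNIV])
    moreover have "(\<lambda>s. g (to_torus s)) -` B = to_torus -` (g -` B)" by auto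
    ultimately show "open (g -` B \<inter> UNIV)" by (simp add: open_torus_def)
  qed
qed

lemma continuous_on_Omega_iff:
  fixes \<phi> :: "torus \<times> real \<Rightarrow> 'b::topological_space"
  shows "continuous_on (Omega V) \<phi> \<longleftrightarrow> (\<forall>v\<in>{- V, V}. continuous_on UNIV (\<lambda>s. \<phi> (to_torus s, v)))"
proof
  assume "continuous_on (Omega V) \<phi>"
  moreover have "continuous_on UNIV (\<lambda>s. (to_torus s, v))" for v :: real
    by (intro continuous_on_Pair continuous_on_const continuous_on_to_torus continuous_on_id)
  ultimately show "\<forall>v\<in>{- V, V}. continuous_on UNIV (\<lambda>s. \<phi> (to_torus s, v))"
    by (intro ballI continuous_on_compose2[of "Omega V" \<phi> UNIV]) (auto simp: Omega_def)
next
  assume *: "\<forall>v\<in>{- V, V}. continuous_on UNIV (\<lambda>s. \<phi> (to_torus s, v))"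
  have slice: "continuous_on (UNIV \<times> {v}) \<phi>" if "v \<in> {- V, V}" for v
  proof -
    have "continuous_on UNIV (\<lambda>x. \<phi> (x, v))"
      using * that by (subst continuous_on_torus_iff) auto
    then have "continuous_on (UNIV \<times> {v}) (\<lambda>p. \<phi> (fst p, v))"
      by (rule continuous_on_compose2) (auto intro: continuous_on_fst continuous_on_id)
    then show ?thesis by (rule continuous_on_eq) auto
  qed
  have "continuous_on (UNIV \<times> {- V} \<union> UNIV \<times> {V}) \<phi>"
    by (intro continuous_on_closed_Un closed_Times slice) auto
  then show "continuous_on (Omega V) \<phi>"
    by (rule continuous_on_subset) (auto simp: Omega_def)
qed

lemma torus_continuous_bounded:
  fixes g :: "torus \<Rightarrow> real"
  assumes "continuous_on UNIV (\<lambda>s. g (to_torus s))"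
  shows "\<exists>K\<ge>0. \<forall>s. \<bar>g (to_torus s)\<bar> \<le> K"
proof -
  have "compact ((\<lambda>s. g (to_torus s)) ` {0..1})"
    using assms by (intro compact_continuous_image) (auto intro: continuous_on_subset)
  then obtain K where "\<forall>s\<in>{0..1}. \<bar>g (to_torus s)\<bar> \<le> K"
    using compact_imp_bounded[of "(\<lambda>s. g (to_torus s)) ` {0..1}"] by (auto simp: bounded_iff)
  from bspec[OF this, of "frac s" for s] have "\<bar>g (to_torus s)\<bar> \<le> K" for s
    by (simp add: less_imp_le[OF frac_lt_1])
  moreover from this[of 0] have "0 \<le> K" by linarith
  ultimately show ?thesis by blast
qed

lemma torus_uniformly_continuous:
  fixes g :: "torus \<Rightarrow> real"
  assumes g: "continuous_on UNIV (\<lambda>s. g (to_torus s))" and "e > 0"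
  shows "\<exists>d>0. \<forall>s t. \<bar>s - t\<bar> < d \<longrightarrow> \<bar>g (to_torus s) - g (to_torus t)\<bar> < e"
proof -
  \<comment> \<open>One period with a margin of length 1 on both sides: subtracting the floor of
    \<open>s\<close> from both points moves \<open>s\<close> into [0,1) and keeps \<open>t\<close>,
    at distance less than 1, inside.\<close>
  have "uniformly_continuous_on {-1..2} (\<lambda>s. g (to_torus s))"
    using g by (intro compact_uniformly_continuous) (auto intro: continuous_on_subset)
  then obtain d where d: "d > 0" "\<And>s t. s \<in> {-1..2} \<Longrightarrow> t \<in> {-1..2} \<Longrightarrow> \<bar>s - t\<bar> < d \<Longrightarrow>
      \<bar>g (to_torus s) - g (to_torus t)\<bar> < e"
    using \<open>e > 0\<close> unfolding uniformly_continuous_on_def dist_real_def by metis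
  have "\<bar>g (to_torus s) - g (to_torus t)\<bar> < e" if st: "\<bar>s - t\<bar> < min d 1" for s t
  proof -
    have "s - \<lfloor>s\<rfloor> \<in> {-1..2}" "t - \<lfloor>s\<rfloor> \<in> {-1..2}"
      using st floor_correct[of s] by (auto simp: abs_less_iff) linarith+
    moreover have "\<bar>(s - \<lfloor>s\<rfloor>) - (t - \<lfloor>s\<rfloor>)\<bar> < d" using st by simp
    ultimately have "\<bar>g (to_torus (s - \<lfloor>s\<rfloor>)) - g (to_torus (t - \<lfloor>s\<rfloor>))\<bar> < e" by (rule d)
    then show ?thesis
      using to_torus_add_of_int[of s "- \<lfloor>s\<rfloor>"] to_torus_add_of_int[of t "- \<lfloor>s\<rfloor>"] by simp
  qed
  with \<open>d > 0\<close> show ?thesis by (intro exI[of _ "min d 1"]) auto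
qed

lemma Omega_cases:
  assumes "p \<in> Omega V"
  obtains s v where "p = (to_torus s, v)" "v \<in> {- V, V}"
  using assms to_torus_section[of "fst p"] by (metis Omega_def SigmaE fst_conv)

lemma Omega_continuous_bounded:
  fixes \<phi> :: "torus \<times> real \<Rightarrow> real"
  assumes "continuous_on (Omega V) \<phi>"
  shows "\<exists>K\<ge>0. \<forall>p\<in>Omega V. \<bar>\<phi> p\<bar> \<le> K"
proof -
  have "\<exists>K\<ge>0. \<forall>s. \<bar>\<phi> (to_torus s, v)\<bar> \<le> K" if "v \<in> {- V, V}" for v
    using assms that torus_continuous_bounded[of "\<lambda>x. \<phi> (x, v)"] by (auto simp: continuous_on_Omega_iff)
  then obtain K K' where "K \<ge> 0" "\<And>s. \<bar>\<phi> (to_torus s, V)\<bar> \<le> K" "K' \<ge> 0" "\<And>s. \<bar>\<phi> (to_torus s, - V)\<bar> \<le> K'"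
    by (metis insertCI)
  then show ?thesis
    by (intro exI[of _ "max K K'"]) (auto elim!: Omega_cases simp: le_max_iff_disj)
qed

lemma closed_Omega: "closed (Omega V)"
  by (auto simp: Omega_def intro!: closed_Times)

lemma space_borel_Omega [simp]: "space (borel_Omega V) = Omega V"
  by (simp add: borel_Omega_def space_restrict_space)

lemma measurable_continuous_Omega:
  fixes \<phi> :: "torus \<times> real \<Rightarrow> real"
  shows "continuous_on (Omega V) \<phi> \<Longrightarrow> \<phi> \<in> borel_measurable (borel_Omega V)"
  unfolding borel_Omega_def by (rule borel_measurable_continuous_on_restrict)

lemma prob_OmegaD:
  assumes "\<mu> \<in> prob_Omega V"
  shows "prob_space \<mu>" "finite_measure \<mu>" "sets \<mu> = sets (borel_Omega V)" "space \<mu> = Omega V"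
  using assms sets_eq_imp_space_eq[of \<mu> "borel_Omega V"]
  by (auto simp: prob_Omega_def prob_space_def)

lemma integrable_bounded_Omega:
  fixes \<phi> :: "torus \<times> real \<Rightarrow> real"
  assumes "\<mu> \<in> prob_Omega V" "\<phi> \<in> borel_measurable (borel_Omega V)" "\<And>p. p \<in> Omega V \<Longrightarrow> \<bar>\<phi> p\<bar> \<le> K"
  shows "integrable \<mu> \<phi>"
proof -
  interpret finite_measure \<mu> using prob_OmegaD[OF assms(1)] by simp
  show ?thesis
    using assms(2,3) prob_OmegaD[OF assms(1)]
    by (intro integrable_const_bound[of _ K]) (auto cong: measurable_cong_sets)
qed

lemma integrable_continuous_Omega:
  fixes \<phi> :: "torus \<times> real \<Rightarrow> real"
  assumes "\<mu> \<in> prob_Omega V" "continuous_on (Omega V) \<phi>"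
  shows "integrable \<mu> \<phi>"
  using Omega_continuous_bounded[OF assms(2)] integrable_bounded_Omega[OF assms(1) measurable_continuous_Omega[OF assms(2)]]
  by blast

lemma abs_integral_Omega_le:
  fixes \<phi> :: "torus \<times> real \<Rightarrow> real"
  assumes \<mu>: "\<mu> \<in> prob_Omega V" and K: "\<And>p. p \<in> Omega V \<Longrightarrow> \<bar>\<phi> p\<bar> \<le> K" and K0: "0 \<le> K"
  shows "\<bar>\<integral>p. \<phi> p \<partial>\<mu>\<bar> \<le> K"
proof (cases "integrable \<mu> \<phi>")
  case True
  interpret prob_space \<mu> using prob_OmegaD[OF \<mu>] by simp
  have "\<bar>\<integral>p. \<phi> p \<partial>\<mu>\<bar> \<le> (\<integral>p. \<bar>\<phi> p\<bar> \<partial>\<mu>)" by (rule integral_abs_bound)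
  also have "\<dots> \<le> (\<integral>p. K \<partial>\<mu>)"
    using True K prob_OmegaD(4)[OF \<mu>] by (intro integral_mono) auto
  finally show ?thesis by (simp add: prob_space)
qed (simp add: not_integrable_integral_eq K0)

lemma continuous_on_flip:
  fixes \<phi> :: "torus \<times> real \<Rightarrow> 'b::topological_space"
  shows "continuous_on (Omega V) \<phi> \<Longrightarrow> continuous_on (Omega V) (\<lambda>p. \<phi> (flip p))"
  by (auto simp: continuous_on_Omega_iff flip_def)

lemma flip_in_Omega [simp]: "flip p \<in> Omega V \<longleftrightarrow> p \<in> Omega V"
  by (cases p) (auto simp: flip_def Omega_def minus_equation_iff)

section \<open>Test functions that are continuously differentiable in position\<close>

lemma C10_has_derivative:
  assumes "\<phi> \<in> C10 V" "v \<in> {- V, V}"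
  shows "((\<lambda>s. \<phi> (to_torus s, v)) has_real_derivative dx \<phi> (to_torus s, v)) (at s)"
proof -
  have "(\<lambda>s. \<phi> (to_torus s, v)) differentiable (at s)"
    using assms by (auto simp: C10_def C1_differentiable_on_eq)
  then show ?thesis
    by (simp add: dx_def torus_deriv_to_torus DERIV_deriv_iff_real_differentiable)
qed

lemma C10_I:
  assumes "\<And>v s. v \<in> {- V, V} \<Longrightarrow> ((\<lambda>s. \<phi> (to_torus s, v)) has_real_derivative D v s) (at s)"
    and "\<And>v. v \<in> {- V, V} \<Longrightarrow> continuous_on UNIV (D v)"
  shows "\<phi> \<in> C10 V"
  unfolding C10_def C1_differentiable_on_def
  using assms by (auto simp: has_real_derivative_iff_has_vector_derivative)

lemma dx_eqI:
  assumes "((\<lambda>s. \<phi> (to_torus s, v)) has_real_derivative D) (at s)"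
  shows "dx \<phi> (to_torus s, v) = D"
  using DERIV_imp_deriv[OF assms] by (simp add: dx_def torus_deriv_to_torus)

lemma C10_continuous: "\<phi> \<in> C10 V \<Longrightarrow> continuous_on (Omega V) \<phi>"
  unfolding continuous_on_Omega_iff
  by (auto intro!: continuous_at_imp_continuous_on DERIV_isCont C10_has_derivative)

lemma C10_dx_continuous:
  assumes "\<phi> \<in> C10 V"
  shows "continuous_on (Omega V) (dx \<phi>)"
  unfolding continuous_on_Omega_iff
proof
  fix v assume v: "v \<in> {- V, V}"
  have "vector_derivative (\<lambda>s. \<phi> (to_torus s, v)) (at s) = dx \<phi> (to_torus s, v)" for s
    using C10_has_derivative[OF assms v]
    by (intro vector_derivative_at) (simp add: has_real_derivative_iff_has_vector_derivative)
  moreover have "continuous_on UNIV (\<lambda>s. vector_derivative (\<lambda>s. \<phi> (to_torus s, v)) (at s))"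
    using assms v by (auto simp: C10_def C1_differentiable_on_eq)
  ultimately show "continuous_on UNIV (\<lambda>s. dx \<phi> (to_torus s, v))" by simp
qed

lemma continuous_on_snd_mult:
  fixes \<phi> :: "torus \<times> real \<Rightarrow> real"
  shows "continuous_on (Omega V) \<phi> \<Longrightarrow> continuous_on (Omega V) (\<lambda>p. snd p * \<phi> p)"
  by (auto intro!: continuous_intros)

lemma Q_continuous: "\<phi> \<in> C10 V \<Longrightarrow> continuous_on (Omega V) (Q lam \<phi>)"
  unfolding Q_def
  by (intro continuous_intros continuous_on_flip C10_continuous C10_dx_continuous)

text \<open>Steklov averages: the mean of \<open>\<phi>\<close> over \<open>[s, s + d]\<close> is
  continuously differentiable in \<open>s\<close>, with a difference quotient of
  \<open>\<phi>\<close> as derivative. Written with an antiderivative \<open>G\<close>, each mean is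
  by the mean value theorem a value of \<open>\<phi>\<close> at distance less than \<open>d\<close>,
  and uniform continuity bounds the error.\<close>

lemma C10_dense:
  assumes \<phi>: "continuous_on (Omega V) \<phi>" and "e > 0"
  shows "\<exists>\<psi>\<in>C10 V. \<forall>p\<in>Omega V. \<bar>\<psi> p - \<phi> p\<bar> \<le> e"
proof -
  have lift: "continuous_on UNIV (\<lambda>s. \<phi> (to_torus s, v))" if "v \<in> {- V, V}" for v
    using \<phi> that by (auto simp: continuous_on_Omega_iff)
  have "\<exists>d>0. \<forall>s t. \<bar>s - t\<bar> < d \<longrightarrow> \<bar>\<phi> (to_torus s, v) - \<phi> (to_torus t, v)\<bar> < e" if "v \<in> {- V, V}" for v
    using torus_uniformly_continuous[OF lift[OF that] \<open>e > 0\<close>] .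
  then obtain d1 d2 where d12: "d1 > 0" "d2 > 0"
    "\<And>s t. \<bar>s - t\<bar> < d1 \<Longrightarrow> \<bar>\<phi> (to_torus s, V) - \<phi> (to_torus t, V)\<bar> < e"
    "\<And>s t. \<bar>s - t\<bar> < d2 \<Longrightarrow> \<bar>\<phi> (to_torus s, - V) - \<phi> (to_torus t, - V)\<bar> < e"
    by (metis insertCI)
  define d where "d = min d1 d2"
  have d: "d > 0" "\<bar>\<phi> (to_torus s, v) - \<phi> (to_torus t, v)\<bar> < e" if "v \<in> {- V, V}" "\<bar>s - t\<bar> < d" for s t v
    using d12 that by (auto simp: d_def)
  have d0: "d > 0" using d12 by (simp add: d_def)
  have "\<exists>G. \<forall>s. (G has_real_derivative \<phi> (to_torus s, v)) (at s)" if "v \<in> {- V, V}" for v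
    using einterval_antiderivative[of "-\<infinity>" "\<infinity>" "\<lambda>s. \<phi> (to_torus s, v)"] lift[OF that]
    by (auto simp: has_real_derivative_iff_has_vector_derivative continuous_on_eq_continuous_at)
  then obtain G where G: "\<And>v s. v \<in> {- V, V} \<Longrightarrow> (G v has_real_derivative \<phi> (to_torus s, v)) (at s)"
    by metis
  define H where "H v s = (G v (s + d) - G v s) / d" for v s
  \<comment> \<open>An antiderivative of a periodic function need not be periodic, but its increment
    over an integer shift is constant, so the difference quotient \<open>H\<close> is periodic and
    descends to the torus.\<close>
  have per: "H v (s + of_int k) = H v s" if v: "v \<in> {- V, V}" for v s k
  proof -
    have "((\<lambda>s. G v (s + of_int k) - G v s) has_real_derivative
        \<phi> (to_torus (s + of_int k), v) - \<phi> (to_torus s, v)) (at s)" for s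
      by (intro DERIV_diff G v) (use G[OF v, of "s + of_int k"] in \<open>simp add: DERIV_shift\<close>)
    then have "\<forall>s. ((\<lambda>s. G v (s + of_int k) - G v s) has_real_derivative 0) (at s)" by simp
    from DERIV_isconst_all[OF this, of "s + d" s] show ?thesis
      by (simp add: H_def algebra_simps)
  qed
  define \<psi> where "\<psi> p = H (snd p) (section_torus (fst p))" for p
  have \<psi>: "\<psi> (to_torus s, v) = H v s" if "v \<in> {- V, V}" for v s
    using per[OF that, of s "- \<lfloor>s\<rfloor>"] by (simp add: \<psi>_def section_to_torus frac_def)
  have "((\<lambda>s. H v s) has_real_derivative (\<phi> (to_torus (s + d), v) - \<phi> (to_torus s, v)) / d) (at s)"
    if v: "v \<in> {- V, V}" for v s
    unfolding H_def
    by (intro DERIV_cdivide DERIV_diff G v) (use G[OF v, of "s + d"] in \<open>simp add: DERIV_shift\<close>)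
  then have "\<psi> \<in> C10 V"
    by (intro C10_I[where D="\<lambda>v s. (\<phi> (to_torus (s + d), v) - \<phi> (to_torus s, v)) / d"])
      (auto simp: \<psi> intro!: continuous_intros continuous_on_compose2[OF lift] d0[THEN less_imp_neq, symmetric])
  moreover have "\<bar>\<psi> p - \<phi> p\<bar> \<le> e" if p: "p \<in> Omega V" for p
  proof -
    obtain s v where sv: "p = (to_torus s, v)" "v \<in> {- V, V}" using p by (rule Omega_cases)
    obtain z where z: "s < z" "z < s + d" "G v (s + d) - G v s = (s + d - s) * \<phi> (to_torus z, v)"
      using MVT2[of s "s + d" "G v" "\<lambda>z. \<phi> (to_torus z, v)"] G[OF sv(2)] d0 by auto
    then have "H v s = \<phi> (to_torus z, v)" using d0 by (simp add: H_def)
    then show ?thesis using d(2)[OF sv(2), of z s] z by (simp add: sv(1) \<psi>[OF sv(2)])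
  qed
  ultimately show ?thesis by blast
qed

section \<open>Probability measures determined by test functions\<close>

lemma infdist_translation_invariant:
  fixes A :: "real set"
  assumes "(\<lambda>a. a + k) ` A = A"
  shows "infdist (x + k) A = infdist x A"
proof -
  have "(INF a\<in>A. dist (x + k) a) = (INF a\<in>(\<lambda>a. a + k) ` A. dist (x + k) a)" by (simp only: assms)
  also have "\<dots> = (INF a\<in>A. dist x a)" by (simp add: image_image)
  finally show ?thesis by (simp add: infdist_def)
qed

text \<open>The torus is given as a topological space without a metric, so the usual functions,
  \<open>n\<close> times the distance to the complement cut off at 1, are built on the periodic lift
  of each fibre and pushed down.\<close>

lemma open_Omega_approx:
  fixes U :: "(torus \<times> real) set"
  assumes U: "open U"
  obtains f :: "nat \<Rightarrow> torus \<times> real \<Rightarrow> real" where "\<And>n. continuous_on (Omega V) (f n)"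
    "\<And>n p. \<bar>f n p\<bar> \<le> 1" "\<And>p. p \<in> Omega V \<Longrightarrow> (\<lambda>n. f n p) \<longlonglongrightarrow> indicator U p"
proof -
  define W where "W v = {s. (to_torus s, v) \<in> U}" for v
  have oW: "open (W v)" for v
  proof -
    have "open ((\<lambda>s. (to_torus s, v)) -` U)"
      using U by (intro open_vimage continuous_on_Pair continuous_on_const continuous_on_to_torus continuous_on_id)
    then show ?thesis by (simp add: W_def vimage_def)
  qed
  \<comment> \<open>\<open>infdist\<close> to the empty set is 0, which would give 0 instead of 1 on
    a fibre contained in \<open>U\<close>; hence the case distinction.\<close>
  define g where "g n v s = (if W v = UNIV then 1 else min 1 (real n * infdist s (- W v)))" for n v s
  have per: "g n v (s + of_int k) = g n v s" for n v s k
  proof -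
    have "(\<lambda>s. s + of_int k) ` (- W v) = - W v"
    proof (intro set_eqI iffI)
      fix s assume "s \<in> - W v"
      then show "s \<in> (\<lambda>s. s + of_int k) ` (- W v)"
        using to_torus_add_of_int[of s "- k"] by (intro image_eqI[of _ _ "s + of_int (- k)"]) (auto simp: W_def)
    qed (auto simp: W_def)
    from infdist_translation_invariant[OF this] show ?thesis by (simp add: g_def)
  qed
  define f where "f n p = g n (snd p) (section_torus (fst p))" for n p
  have f: "f n (to_torus s, v) = g n v s" for n s v
    using per[of n v s "- \<lfloor>s\<rfloor>"] by (simp add: f_def section_to_torus frac_def)
  show ?thesis
  proof (rule that[of f])
    show "continuous_on (Omega V) (f n)" for n
      unfolding continuous_on_Omega_iff f
      by (cases "W V = UNIV"; cases "W (- V) = UNIV") (auto simp: g_def intro!: continuous_intros)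
    have "0 \<le> real n * infdist s A" for n s and A :: "real set" by (simp add: infdist_nonneg)
    then show "\<bar>f n p\<bar> \<le> 1" for n p by (simp add: f_def g_def)
    fix p assume "p \<in> Omega V"
    then obtain s v where p: "p = (to_torus s, v)" by (rule Omega_cases)
    show "(\<lambda>n. f n p) \<longlonglongrightarrow> indicator U p"
    proof (cases "s \<in> W v")
      case True
      then have ind: "indicator U p = (1::real)" by (simp add: p W_def)
      show ?thesis
      proof (cases "W v = UNIV")
        case False
        then have "infdist s (- W v) > 0"
          using True oW[of v] in_closed_iff_infdist_zero[of "- W v" s] infdist_nonneg[of s "- W v"]
          by (auto simp: closed_Compl less_le)
        then obtain N where N: "1 < real N * infdist s (- W v)"
          using reals_Archimedean3 by blast
        have "f n p = 1" if "n \<ge> N" for n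
        proof -
          have "real N * infdist s (- W v) \<le> real n * infdist s (- W v)"
            using that by (intro mult_right_mono infdist_nonneg) auto
          then show ?thesis using N False by (simp add: p f g_def)
        qed
        then show ?thesis unfolding ind
          by (intro tendsto_eventually eventually_sequentiallyI)
      qed (simp add: p f g_def ind[unfolded p])
    next
      case False
      then have "infdist s (- W v) = 0" "W v \<noteq> UNIV" by auto
      then have "f n p = 0" for n by (simp add: p f g_def)
      then show ?thesis using False by (simp add: p W_def)
    qed
  qed
qed

lemma sets_borel_Omega:
  "sets (borel_Omega V) = sigma_sets (Omega V) ((\<inter>) (Omega V) ` {S. open S})"
proof -
  have "Omega V \<in> sigma_sets UNIV {S. open S}"
    using closed_Omega[of V] by (metis borel_closed sets_borel)
  then show ?thesis
    unfolding borel_Omega_def sets_restrict_space sets_borel by (intro sigma_sets_Int) auto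
qed

lemma open_Omega_Pow: "(\<inter>) (Omega V) ` {S. open S} \<subseteq> Pow (Omega V)"
  by auto

lemma Int_stable_open_Omega: "Int_stable ((\<inter>) (Omega V) ` {S. open S})"
proof (rule Int_stableI, safe)
  fix S S' :: "(torus \<times> real) set" assume "open S" "open S'"
  moreover have "Omega V \<inter> S \<inter> (Omega V \<inter> S') = Omega V \<inter> (S \<inter> S')" by auto
  ultimately show "Omega V \<inter> S \<inter> (Omega V \<inter> S') \<in> (\<inter>) (Omega V) ` {S. open S}" by blast
qed

lemma measure_open_Omega_LIMSEQ:
  assumes U: "open U"
  obtains f :: "nat \<Rightarrow> torus \<times> real \<Rightarrow> real" where "\<And>n. continuous_on (Omega V) (f n)"
    "\<And>\<mu>. \<mu> \<in> prob_Omega V \<Longrightarrow> (\<lambda>n. \<integral>p. f n p \<partial>\<mu>) \<longlonglongrightarrow> measure \<mu> (Omega V \<inter> U)"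
proof -
  obtain f :: "nat \<Rightarrow> torus \<times> real \<Rightarrow> real" where f: "\<And>n. continuous_on (Omega V) (f n)"
    "\<And>n p. \<bar>f n p\<bar> \<le> 1" "\<And>p. p \<in> Omega V \<Longrightarrow> (\<lambda>n. f n p) \<longlonglongrightarrow> indicator U p"
    using open_Omega_approx[OF U] by blast
  show ?thesis
  proof (rule that[OF f(1)])
    fix \<mu> assume \<mu>: "\<mu> \<in> prob_Omega V"
    note P = prob_OmegaD[OF \<mu>]
    have m: "(indicator U :: _ \<Rightarrow> real) \<in> borel_measurable \<mu>"
    proof -
      have "(indicator U :: _ \<Rightarrow> real) \<in> borel_measurable borel" using U by simp
      then have "(indicator U :: _ \<Rightarrow> real) \<in> borel_measurable (borel_Omega V)"
        unfolding borel_Omega_def by (rule measurable_restrict_space1)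
      then show ?thesis using P(3) by (simp cong: measurable_cong_sets)
    qed
    have "(\<lambda>n. \<integral>p. f n p \<partial>\<mu>) \<longlonglongrightarrow> (\<integral>p. indicator U p \<partial>\<mu>)"
      using f P(4) m borel_measurable_integrable[OF integrable_continuous_Omega[OF \<mu> f(1)]]
      by (intro integral_bounded_LIMSEQ[OF P(2), where C=1]) auto
    then show "(\<lambda>n. \<integral>p. f n p \<partial>\<mu>) \<longlonglongrightarrow> measure \<mu> (Omega V \<inter> U)"
      by (simp add: P(4) Int_commute)
  qed
qed

text \<open>Test functions are uniformly dense in the continuous functions, these converge boundedly
  to indicators of open sets, and the open sets form an intersection-stable generator.\<close>

lemma prob_Omega_eqI:
  assumes \<mu>: "\<mu> \<in> prob_Omega V" and \<nu>: "\<nu> \<in> prob_Omega V"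
    and eq: "\<And>\<phi>. \<phi> \<in> C10 V \<Longrightarrow> (\<integral>p. \<phi> p \<partial>\<mu>) = (\<integral>p. \<phi> p \<partial>\<nu>)"
  shows "\<mu> = \<nu>"
proof -
  have cont: "(\<integral>p. \<phi> p \<partial>\<mu>) = (\<integral>p. \<phi> p \<partial>\<nu>)" if \<phi>: "continuous_on (Omega V) \<phi>"
    for \<phi> :: "torus \<times> real \<Rightarrow> real"
  proof -
    have "\<bar>(\<integral>p. \<phi> p \<partial>\<mu>) - (\<integral>p. \<phi> p \<partial>\<nu>)\<bar> \<le> 0 + e" if "e > 0" for e
    proof -
      obtain \<psi> where \<psi>: "\<psi> \<in> C10 V" "\<And>p. p \<in> Omega V \<Longrightarrow> \<bar>\<psi> p - \<phi> p\<bar> \<le> e / 2"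
        using C10_dense[OF \<phi>, of "e / 2"] \<open>e > 0\<close> by auto
      have "\<bar>(\<integral>p. \<psi> p \<partial>\<kappa>) - (\<integral>p. \<phi> p \<partial>\<kappa>)\<bar> \<le> e / 2" if "\<kappa> \<in> prob_Omega V" for \<kappa>
        using abs_integral_Omega_le[OF that, of "\<lambda>p. \<psi> p - \<phi> p" "e / 2"] \<psi>(2) \<open>e > 0\<close>
          integrable_continuous_Omega[OF that \<phi>] integrable_continuous_Omega[OF that C10_continuous[OF \<psi>(1)]]
        by simp
      from this[OF \<mu>] this[OF \<nu>] eq[OF \<psi>(1)] show ?thesis by (simp add: abs_if split: if_splits)
    qed
    from field_le_epsilon[OF this] show ?thesis by simp
  qed
  interpret \<mu>: prob_space \<mu> using prob_OmegaD[OF \<mu>] by simp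
  interpret \<nu>: prob_space \<nu> using prob_OmegaD[OF \<nu>] by simp
  show ?thesis
  proof (rule measure_eqI_generator_eq[where A="\<lambda>_. Omega V" and \<Omega>="Omega V" and E="(\<inter>) (Omega V) ` {S. open S}"])
    show "Int_stable ((\<inter>) (Omega V) ` {S. open S})" by (rule Int_stable_open_Omega)
    fix X assume "X \<in> (\<inter>) (Omega V) ` {S. open S}"
    then obtain U where U: "open U" and X: "X = Omega V \<inter> U" by auto
    obtain f :: "nat \<Rightarrow> torus \<times> real \<Rightarrow> real" where f: "\<And>n. continuous_on (Omega V) (f n)"
      "\<And>\<mu>. \<mu> \<in> prob_Omega V \<Longrightarrow> (\<lambda>n. \<integral>p. f n p \<partial>\<mu>) \<longlonglongrightarrow> measure \<mu> (Omega V \<inter> U)"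
      using measure_open_Omega_LIMSEQ[OF U] by blast
    have "measure \<mu> X = measure \<nu> X"
      using LIMSEQ_unique[OF f(2)[OF \<mu>]] f(2)[OF \<nu>] by (simp add: cont[OF f(1)] X)
    then show "emeasure \<mu> X = emeasure \<nu> X"
      by (simp add: \<mu>.emeasure_eq_measure \<nu>.emeasure_eq_measure)
  qed (use prob_OmegaD[OF \<mu>] prob_OmegaD[OF \<nu>] in \<open>auto simp: sets_borel_Omega\<close>)
qed

text \<open>Only integrals of continuous functions are controlled at the outset. Open sets are
  reached as limits of these, all other Borel sets by a Dynkin argument.\<close>

lemma measurable_measure_Omega:
  assumes \<sigma>: "\<And>t. t \<in> space L \<Longrightarrow> \<sigma> t \<in> prob_Omega V"
    and m: "\<And>\<phi>. continuous_on (Omega V) \<phi> \<Longrightarrow> (\<lambda>t. \<integral>p. (\<phi> p :: real) \<partial>\<sigma> t) \<in> borel_measurable L"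
    and A: "A \<in> sets (borel_Omega V)"
  shows "(\<lambda>t. measure (\<sigma> t) A) \<in> borel_measurable L"
  using A unfolding sets_borel_Omega
proof (induction rule: sigma_sets_induct_disjoint[OF Int_stable_open_Omega open_Omega_Pow, consumes 1,
      case_names basic empty compl union])
  case (basic X)
  then obtain U where U: "open U" and X: "X = Omega V \<inter> U" by auto
  obtain f :: "nat \<Rightarrow> torus \<times> real \<Rightarrow> real" where f: "\<And>n. continuous_on (Omega V) (f n)"
    "\<And>\<mu>. \<mu> \<in> prob_Omega V \<Longrightarrow> (\<lambda>n. \<integral>p. f n p \<partial>\<mu>) \<longlonglongrightarrow> measure \<mu> (Omega V \<inter> U)"
    using measure_open_Omega_LIMSEQ[OF U] by blast
  show ?case
    by (rule borel_measurable_LIMSEQ_real[of _ "\<lambda>n t. \<integral>p. f n p \<partial>\<sigma> t"]) (auto simp: X f \<sigma> m)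
next
  case (compl A)
  have "measure (\<sigma> t) (Omega V - A) = 1 - measure (\<sigma> t) A" if "t \<in> space L" for t
    using prob_space.prob_compl[OF prob_OmegaD(1)[OF \<sigma>[OF that]], of A] compl(1) prob_OmegaD[OF \<sigma>[OF that]]
    by (simp add: sets_borel_Omega)
  then show ?case using compl(2) by (simp cong: measurable_cong)
next
  case (union F)
  have "(\<lambda>n. measure (\<sigma> t) (F n)) sums measure (\<sigma> t) (\<Union>n. F n)" if "t \<in> space L" for t
    using union prob_OmegaD[OF \<sigma>[OF that]]
    by (intro finite_measure.finite_measure_UNION) (auto simp: sets_borel_Omega)
  then have "measure (\<sigma> t) (\<Union>n. F n) = (\<Sum>n. measure (\<sigma> t) (F n))" if "t \<in> space L" for t
    using that by (simp add: sums_iff)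
  then show ?case using union(3) by (simp cong: measurable_cong)
qed simp

section \<open>Narrowly continuous curves\<close>

lemma narrow_curvesD:
  assumes "\<sigma> \<in> narrow_curves V T"
  shows "t \<in> {0..T} \<Longrightarrow> \<sigma> t \<in> prob_Omega V"
    and "continuous_on (Omega V) \<phi> \<Longrightarrow> continuous_on {0..T} (\<lambda>t. \<integral>p. (\<phi> p :: real) \<partial>\<sigma> t)"
proof -
  show "t \<in> {0..T} \<Longrightarrow> \<sigma> t \<in> prob_Omega V"
    using assms by (auto simp: narrow_curves_def)
  assume \<phi>: "continuous_on (Omega V) \<phi>"
  then have "bounded (\<phi> ` Omega V)"
    using Omega_continuous_bounded[OF \<phi>] by (auto simp: bounded_iff)
  then show "continuous_on {0..T} (\<lambda>t. \<integral>p. \<phi> p \<partial>\<sigma> t)"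
    using assms \<phi> by (auto simp: narrow_curves_def)
qed

text \<open>Replacing a continuous function by a nearby test function changes its integrals by an
  amount uniform in \<open>t\<close>, as every \<open>\<sigma> t\<close> has mass 1; a uniform limit
  of continuous functions is continuous.\<close>

lemma narrow_curvesI:
  assumes \<sigma>: "\<And>t. t \<in> {0..T} \<Longrightarrow> \<sigma> t \<in> prob_Omega V" "\<And>t. t \<notin> {0..T} \<Longrightarrow> \<sigma> t = undefined"
    and C10: "\<And>\<phi>. \<phi> \<in> C10 V \<Longrightarrow> continuous_on {0..T} (\<lambda>t. \<integral>p. \<phi> p \<partial>\<sigma> t)"
  shows "\<sigma> \<in> narrow_curves V T"
proof -
  have "continuous_on {0..T} (\<lambda>t. \<integral>p. \<phi> p \<partial>\<sigma> t)" if \<phi>: "continuous_on (Omega V) \<phi>"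
    for \<phi> :: "torus \<times> real \<Rightarrow> real"
  proof -
    have "\<exists>\<psi>\<in>C10 V. \<forall>p\<in>Omega V. \<bar>\<psi> p - \<phi> p\<bar> \<le> 1 / real (Suc n)" for n
      by (rule C10_dense[OF \<phi>]) simp
    then obtain \<psi> where \<psi>: "\<And>n. \<psi> n \<in> C10 V" "\<And>n p. p \<in> Omega V \<Longrightarrow> \<bar>\<psi> n p - \<phi> p\<bar> \<le> 1 / real (Suc n)"
      by metis
    have bound: "dist (\<integral>p. \<psi> n p \<partial>\<sigma> t) (\<integral>p. \<phi> p \<partial>\<sigma> t) \<le> 1 / real (Suc n)" if t: "t \<in> {0..T}" for t n
    proof -
      have "\<bar>\<integral>p. \<psi> n p - \<phi> p \<partial>\<sigma> t\<bar> \<le> 1 / real (Suc n)"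
        using \<psi>(2) by (intro abs_integral_Omega_le[OF \<sigma>(1)[OF t]]) auto
      then show ?thesis
        using integrable_continuous_Omega[OF \<sigma>(1)[OF t] \<phi>]
          integrable_continuous_Omega[OF \<sigma>(1)[OF t] C10_continuous[OF \<psi>(1)]]
        by (simp add: dist_real_def)
    qed
    have "uniform_limit {0..T} (\<lambda>n t. \<integral>p. \<psi> n p \<partial>\<sigma> t) (\<lambda>t. \<integral>p. \<phi> p \<partial>\<sigma> t) sequentially"
    proof (rule uniform_limitI)
      fix e :: real assume "e > 0"
      then have "\<forall>\<^sub>F n in sequentially. 1 / real (Suc n) < e"
        using order_tendstoD(2)[OF lim_1_over_n[THEN LIMSEQ_Suc]] by simp
      then show "\<forall>\<^sub>F n in sequentially. \<forall>t\<in>{0..T}. dist (\<integral>p. \<psi> n p \<partial>\<sigma> t) (\<integral>p. \<phi> p \<partial>\<sigma> t) < e"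
        by eventually_elim (meson bound le_less_trans)
    qed
    then show ?thesis
      by (rule uniform_limit_theorem[rotated]) (auto intro!: always_eventually C10 \<psi>)
  qed
  then show ?thesis using \<sigma> by (auto simp: narrow_curves_def)
qed

lemma narrow_curves_measurable_integral:
  assumes \<sigma>: "\<sigma> \<in> narrow_curves V T" and g: "g \<in> borel_measurable (borel_Omega V)"
    and K: "\<And>p. p \<in> Omega V \<Longrightarrow> \<bar>g p\<bar> \<le> K"
  shows "(\<lambda>t. \<integral>p. (g p :: real) \<partial>\<sigma> t) \<in> borel_measurable (restrict_space borel {0<..<T})"
proof -
  have P: "\<sigma> t \<in> prob_Omega V" if "t \<in> {0<..<T}" for t
    using narrow_curvesD(1)[OF \<sigma>, of t] that by auto
  have m: "(\<lambda>t. \<integral>p. (\<phi> p :: real) \<partial>\<sigma> t) \<in> borel_measurable (restrict_space borel {0<..<T})"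
    if "continuous_on (Omega V) \<phi>" for \<phi>
    using narrow_curvesD(2)[OF \<sigma> that]
    by (intro borel_measurable_continuous_on_restrict) (auto intro: continuous_on_subset)
  have "(\<lambda>t. signed_integral (borel_Omega V) (measure (\<sigma> t)) g) \<in> borel_measurable (restrict_space borel {0<..<T})"
  proof (rule measurable_signed_integral[OF _ _ g])
    show "vector_measure (borel_Omega V) (measure (\<sigma> t))" if "t \<in> space (restrict_space borel {0<..<T})" for t
      using that P vector_measure_measure[of "\<sigma> t"] prob_OmegaD[OF P]
      by (simp add: space_restrict_space vector_measure_cong_sets[of "borel_Omega V" "\<sigma> t"])
    show "(\<lambda>t. measure (\<sigma> t) A) \<in> borel_measurable (restrict_space borel {0<..<T})"
      if "A \<in> sets (borel_Omega V)" for A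
      by (rule measurable_measure_Omega[OF _ m that]) (auto simp: space_restrict_space P)
  qed (use K in auto)
  then show ?thesis
    by (subst measurable_cong[of _ _ "\<lambda>t. signed_integral (borel_Omega V) (measure (\<sigma> t)) g"])
      (use prob_OmegaD[OF P] g K in \<open>auto simp: space_restrict_space intro!: signed_integral_measure[symmetric]\<close>)
qed

section \<open>Uniqueness\<close>

text \<open>Free motion for time \<open>a\<close>. The shift acts on the representative in [0,1),
  which depends measurably on the point; by \<open>flow_to_torus\<close> every representative leads
  to the same result.\<close>

definition flow :: "real \<Rightarrow> torus \<times> real \<Rightarrow> torus \<times> real"
  where "flow a p = (to_torus (section_torus (fst p) + a * snd p), snd p)"

definition transport :: "real \<Rightarrow> (torus \<times> real \<Rightarrow> real) \<Rightarrow> torus \<times> real \<Rightarrow> real"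
  where "transport a \<phi> p = \<phi> (flow a p)"

lemma to_torus_frac_add: "to_torus (frac s + a) = to_torus (s + a)"
  using to_torus_add_of_int[of "s + a" "- \<lfloor>s\<rfloor>"] by (simp add: frac_def algebra_simps)

lemma transport_to_torus: "transport a \<phi> (to_torus s, v) = \<phi> (to_torus (s + a * v), v)"
  by (simp add: transport_def flow_def section_to_torus to_torus_frac_add)

lemma transport_0 [simp]: "transport 0 \<phi> = \<phi>"
  by (simp add: transport_def fun_eq_iff flow_def)

lemma flow_in_Omega [simp]: "flow a p \<in> Omega V \<longleftrightarrow> p \<in> Omega V"
  by (cases p) (auto simp: Omega_def flow_def)

lemma flow_0 [simp]: "flow 0 p = p"
  by (simp add: flow_def)

lemma transport_bounded: "(\<And>p. p \<in> Omega V \<Longrightarrow> \<bar>\<phi> p\<bar> \<le> K) \<Longrightarrow> p \<in> Omega V \<Longrightarrow> \<bar>transport a \<phi> p\<bar> \<le> K"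
  by (simp add: transport_def)

lemma transport_has_derivative:
  assumes "\<phi> \<in> C10 V" "v \<in> {- V, V}"
  shows "((\<lambda>s. transport a \<phi> (to_torus s, v)) has_real_derivative transport a (dx \<phi>) (to_torus s, v)) (at s)"
  using C10_has_derivative[OF assms, of "s + a * v"] by (simp add: transport_to_torus DERIV_shift)

lemma continuous_on_transport:
  assumes "continuous_on (Omega V) \<phi>"
  shows "continuous_on (Omega V) (transport a \<phi>)"
  unfolding continuous_on_Omega_iff transport_to_torus
proof
  fix v assume "v \<in> {- V, V}"
  then have "continuous_on UNIV (\<lambda>s. \<phi> (to_torus s, v))"
    using assms by (auto simp: continuous_on_Omega_iff)
  then show "continuous_on UNIV (\<lambda>s. \<phi> (to_torus (s + a * v), v))"
    by (rule continuous_on_compose2) (auto intro!: continuous_intros)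
qed

lemma transport_C10: "\<phi> \<in> C10 V \<Longrightarrow> transport a \<phi> \<in> C10 V"
  by (rule C10_I[where D="\<lambda>v s. transport a (dx \<phi>) (to_torus s, v)"])
    (use continuous_on_transport[OF C10_dx_continuous] in \<open>auto simp: continuous_on_Omega_iff intro!: transport_has_derivative\<close>)

lemma dx_transport: "\<phi> \<in> C10 V \<Longrightarrow> p \<in> Omega V \<Longrightarrow> dx (transport a \<phi>) p = transport a (dx \<phi>) p"
  by (erule Omega_cases) (auto intro!: dx_eqI transport_has_derivative)

lemma flip_diff_C10:
  assumes "\<phi> \<in> C10 V"
  shows "(\<lambda>p. \<phi> (flip p) - \<phi> p) \<in> C10 V"
proof (rule C10_I[where D="\<lambda>v s. dx \<phi> (to_torus s, - v) - dx \<phi> (to_torus s, v)"])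
  fix v assume v: "v \<in> {- V, V}"
  then have mv: "- v \<in> {- V, V}" by auto
  show "((\<lambda>s. \<phi> (flip (to_torus s, v)) - \<phi> (to_torus s, v)) has_real_derivative
      dx \<phi> (to_torus s, - v) - dx \<phi> (to_torus s, v)) (at s)" for s
    unfolding flip_def fst_conv snd_conv
    by (intro DERIV_diff C10_has_derivative[OF assms] v mv)
  show "continuous_on UNIV (\<lambda>s. dx \<phi> (to_torus s, - v) - dx \<phi> (to_torus s, v))"
    using C10_dx_continuous[OF assms] v mv unfolding continuous_on_Omega_iff
    by (intro continuous_on_diff) auto
qed

lemma C10_flow_derivative:
  assumes "\<phi> \<in> C10 V" "v \<in> {- V, V}"
  shows "((\<lambda>c. \<phi> (to_torus (s + c * v), v)) has_real_derivative v * dx \<phi> (to_torus (s + c * v), v)) (at c)"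
proof -
  have "((\<lambda>c. s + c * v) has_real_derivative v) (at c)" by (auto intro!: derivative_eq_intros)
  from DERIV_chain2[OF C10_has_derivative[OF assms] this] show ?thesis by (simp add: mult.commute)
qed

lemma flow_to_torus: "flow a (to_torus s, v) = (to_torus (s + a * v), v)"
  by (simp add: flow_def section_to_torus to_torus_frac_add)

text \<open>The expansion in time will be integrated against measures that themselves vary with
  time, so the remainder has to be uniform over phase space. It comes from the mean value theorem
  along characteristics and the uniform continuity of \<open>dx \<phi>\<close>.\<close>

lemma transport_remainder:
  assumes \<phi>: "\<phi> \<in> C10 V" and e: "e > 0"
  shows "\<exists>d>0. \<forall>a b p. \<bar>b - a\<bar> < d \<longrightarrow> p \<in> Omega V \<longrightarrow>
    \<bar>transport b \<phi> p - transport a \<phi> p - (b - a) * (snd p * transport a (dx \<phi>) p)\<bar> \<le> e * \<bar>b - a\<bar>"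
proof -
  \<comment> \<open>\<open>W\<close> is a positive bound for the speed: a time step below
    \<open>d / W\<close> gives a displacement below \<open>d\<close>, and the tolerance
    \<open>e / W\<close> for \<open>dx \<phi>\<close> becomes \<open>e\<close> after multiplication
    by the velocity.\<close>
  define W where "W = \<bar>V\<bar> + 1"
  have W: "W > 0" "\<bar>V\<bar> \<le> W" by (auto simp: W_def)
  have "\<exists>d>0. \<forall>s t. \<bar>s - t\<bar> < d \<longrightarrow> \<bar>dx \<phi> (to_torus s, v) - dx \<phi> (to_torus t, v)\<bar> < e / W"
    if "v \<in> {- V, V}" for v
    using C10_dx_continuous[OF \<phi>] that e W
    by (intro torus_uniformly_continuous) (auto simp: continuous_on_Omega_iff)
  then obtain d1 d2 where d12: "d1 > 0" "d2 > 0"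
    "\<And>s t. \<bar>s - t\<bar> < d1 \<Longrightarrow> \<bar>dx \<phi> (to_torus s, V) - dx \<phi> (to_torus t, V)\<bar> < e / W"
    "\<And>s t. \<bar>s - t\<bar> < d2 \<Longrightarrow> \<bar>dx \<phi> (to_torus s, - V) - dx \<phi> (to_torus t, - V)\<bar> < e / W"
    by (metis insertCI)
  define d where "d = min d1 d2"
  have d: "\<bar>dx \<phi> (to_torus s, v) - dx \<phi> (to_torus t, v)\<bar> < e / W" if "v \<in> {- V, V}" "\<bar>s - t\<bar> < d" for s t v
    using d12 that by (auto simp: d_def)
  have d0: "d > 0" using d12 by (simp add: d_def)
  have main: "\<bar>transport b \<phi> p - transport a \<phi> p - (b - a) * (snd p * transport a (dx \<phi>) p)\<bar> \<le> e * \<bar>b - a\<bar>"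
    if ab: "\<bar>b - a\<bar> < d / W" and p: "p \<in> Omega V" for a b p
  proof -
    obtain s v where sv: "p = (to_torus s, v)" "v \<in> {- V, V}" using p by (rule Omega_cases)
    note der = C10_flow_derivative[OF \<phi> sv(2), of s]
    have "\<exists>z. \<bar>z - a\<bar> \<le> \<bar>b - a\<bar> \<and> \<phi> (to_torus (s + b * v), v) - \<phi> (to_torus (s + a * v), v) =
        (b - a) * (v * dx \<phi> (to_torus (s + z * v), v))"
    proof (cases a b rule: linorder_cases)
      case less
      from MVT2[OF this, of "\<lambda>c. \<phi> (to_torus (s + c * v), v)"] der show ?thesis by force
    next
      case greater
      from MVT2[OF this, of "\<lambda>c. \<phi> (to_torus (s + c * v), v)" "\<lambda>c. v * dx \<phi> (to_torus (s + c * v), v)"] der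
      obtain z where "b < z" "z < a" "\<phi> (to_torus (s + a * v), v) - \<phi> (to_torus (s + b * v), v) =
        (a - b) * (v * dx \<phi> (to_torus (s + z * v), v))" by auto
      then show ?thesis by (intro exI[of _ z]) (auto simp: algebra_simps)
    qed auto
    then obtain z where z: "\<bar>z - a\<bar> \<le> \<bar>b - a\<bar>"
      "\<phi> (to_torus (s + b * v), v) - \<phi> (to_torus (s + a * v), v) =
        (b - a) * (v * dx \<phi> (to_torus (s + z * v), v))" by blast
    have v: "\<bar>v\<bar> \<le> W" using sv(2) W by auto
    have "\<bar>(s + z * v) - (s + a * v)\<bar> = \<bar>z - a\<bar> * \<bar>v\<bar>" by (simp add: abs_mult[symmetric] algebra_simps)
    also have "\<dots> \<le> \<bar>b - a\<bar> * W" using z v by (intro mult_mono) auto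
    also have "\<dots> < d" using ab W by (simp add: field_simps)
    finally have "\<bar>dx \<phi> (to_torus (s + z * v), v) - dx \<phi> (to_torus (s + a * v), v)\<bar> < e / W"
      by (rule d[OF sv(2)])
    then have "\<bar>b - a\<bar> * (\<bar>v\<bar> * \<bar>dx \<phi> (to_torus (s + z * v), v) - dx \<phi> (to_torus (s + a * v), v)\<bar>) \<le>
        \<bar>b - a\<bar> * (W * (e / W))"
      using v W by (intro mult_left_mono mult_mono) auto
    moreover have "transport b \<phi> p - transport a \<phi> p - (b - a) * (snd p * transport a (dx \<phi>) p) =
        (b - a) * (v * (dx \<phi> (to_torus (s + z * v), v) - dx \<phi> (to_torus (s + a * v), v)))"
      unfolding sv(1) transport_to_torus z(2) snd_conv by (simp add: algebra_simps)
    ultimately show ?thesis using W by (simp add: abs_mult mult.commute)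
  qed
  show ?thesis
    using main d0 W by (intro exI[of _ "d / W"]) auto
qed

section \<open>Time derivatives along weak solutions\<close>

lemma weak_solutionD:
  assumes "weak_solution V lam T \<sigma>\<^sub>0 \<sigma>"
  shows "\<sigma> \<in> narrow_curves V T" "\<sigma> 0 = \<sigma>\<^sub>0"
    "\<And>\<phi> s t. \<phi> \<in> C10 V \<Longrightarrow> 0 \<le> s \<Longrightarrow> s \<le> t \<Longrightarrow> t \<le> T \<Longrightarrow>
      (\<integral>p. \<phi> p \<partial>\<sigma> t) - (\<integral>p. \<phi> p \<partial>\<sigma> s) = (LINT r:{s<..<t}|lborel. (\<integral>p. Q lam \<phi> p \<partial>\<sigma> r))"
  using assms by (auto simp: weak_solution_def)

text \<open>Narrow continuity and continuity of \<open>Q lam \<psi>\<close> make the time integrand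
  continuous, so the fundamental theorem of calculus applies up to the end points of
  \<open>[0,T]\<close>.\<close>

lemma weak_solution_has_derivative:
  assumes w: "weak_solution V lam T \<sigma>\<^sub>0 \<sigma>" and \<psi>: "\<psi> \<in> C10 V" and s: "s \<in> {0..T}"
  shows "((\<lambda>t. \<integral>p. \<psi> p \<partial>\<sigma> t) has_real_derivative (\<integral>p. Q lam \<psi> p \<partial>\<sigma> s)) (at s within {0..T})"
proof -
  define q where "q r = (\<integral>p. Q lam \<psi> p \<partial>\<sigma> r)" for r
  have cq: "continuous_on {0..T} q"
    unfolding q_def by (rule narrow_curvesD(2)[OF weak_solutionD(1)[OF w] Q_continuous[OF \<psi>]])
  have eq: "(\<integral>p. \<psi> p \<partial>\<sigma> t) = (\<integral>p. \<psi> p \<partial>\<sigma> 0) + integral {0..t} q" if t: "t \<in> {0..T}" for t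
  proof -
    have "set_integrable lborel {0..t} q"
      using cq t by (intro borel_integrable_atLeastAtMost') (auto intro: continuous_on_subset)
    then have "set_integrable lborel {0<..<t} q"
      by (rule set_integrable_subset) auto
    then have "(LINT r:{0<..<t}|lborel. q r) = integral {0..t} q"
      by (simp add: set_borel_integral_eq_integral(2) integral_open_interval_real)
    then show ?thesis
      using weak_solutionD(3)[OF w \<psi>, of 0 t] t by (simp add: q_def)
  qed
  have deriv: "((\<lambda>t. (\<integral>p. \<psi> p \<partial>\<sigma> 0) + integral {0..t} q) has_real_derivative q s) (at s within {0..T})"
    using integral_has_real_derivative[OF cq s] by (auto intro!: derivative_eq_intros)
  have "((\<lambda>t. \<integral>p. \<psi> p \<partial>\<sigma> t) has_real_derivative q s) (at s within {0..T})"
    by (rule has_field_derivative_transform_within[OF deriv zero_less_one s]) (rule eq[symmetric])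
  then show ?thesis by (simp add: q_def)
qed

text \<open>Along the characteristics the transport term cancels, only the jump term remains.\<close>

lemma weak_solution_transport_derivative:
  assumes w: "weak_solution V lam T \<sigma>\<^sub>0 \<sigma>" and \<phi>: "\<phi> \<in> C10 V" and s: "s \<in> {0..T}"
  shows "((\<lambda>r. \<integral>p. transport (t - r) \<phi> p \<partial>\<sigma> r) has_real_derivative
    lam * (\<integral>p. transport (t - s) \<phi> (flip p) - transport (t - s) \<phi> p \<partial>\<sigma> s)) (at s within {0..T})"
proof -
  note N = narrow_curvesD[OF weak_solutionD(1)[OF w]]
  define \<psi> where "\<psi> = transport (t - s) \<phi>"
  define D where "D p = snd p * transport (t - s) (dx \<phi>) p" for p
  define R where "R r = (\<integral>p. transport (t - r) \<phi> p - \<psi> p - (s - r) * D p \<partial>\<sigma> r)" for r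
  have \<psi>: "\<psi> \<in> C10 V" unfolding \<psi>_def by (rule transport_C10[OF \<phi>])
  have cD: "continuous_on (Omega V) D"
    unfolding D_def by (intro continuous_on_snd_mult continuous_on_transport C10_dx_continuous \<phi>)
  note int = integrable_continuous_Omega[OF N(1)]
  \<comment> \<open>Expansion at \<open>s\<close> separates the moving function from the moving
    measure: a remainder of order o(r - s), a linear term with the explicit factor
    \<open>s - r\<close>, and a fixed test function.\<close>
  have split: "(\<integral>p. transport (t - r) \<phi> p \<partial>\<sigma> r) = R r + (s - r) * (\<integral>p. D p \<partial>\<sigma> r) + (\<integral>p. \<psi> p \<partial>\<sigma> r)"
    if r: "r \<in> {0..T}" for r
    unfolding R_def
    using int[OF r cD] int[OF r C10_continuous[OF \<psi>]] int[OF r C10_continuous[OF transport_C10[OF \<phi>]]]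
    by simp
  have dR: "(R has_real_derivative 0) (at s within {0..T})"
    unfolding has_field_derivative_iff
  proof (rule tendstoI)
    fix e :: real assume e: "e > 0"
    then obtain d where d: "d > 0" "\<And>a b p. \<bar>b - a\<bar> < d \<Longrightarrow> p \<in> Omega V \<Longrightarrow>
      \<bar>transport b \<phi> p - transport a \<phi> p - (b - a) * (snd p * transport a (dx \<phi>) p)\<bar> \<le> e / 2 * \<bar>b - a\<bar>"
      using transport_remainder[OF \<phi>, of "e / 2"] by auto
    have R0: "R s = 0" by (simp add: R_def \<psi>_def)
    have "dist ((R r - R s) / (r - s)) 0 < e" if r: "r \<in> {0..T}" "r \<noteq> s" "\<bar>r - s\<bar> < d" for r
    proof -
      have "\<bar>R r\<bar> \<le> e / 2 * \<bar>r - s\<bar>"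
        unfolding R_def using r e d(2)[of "t - r" "t - s"]
        by (intro abs_integral_Omega_le[OF N(1)]) (auto simp: \<psi>_def D_def abs_minus_commute)
      also have "\<dots> < e * \<bar>r - s\<bar>" using r e by simp
      finally show ?thesis using r by (simp add: R0 abs_divide field_simps)
    qed
    then show "\<forall>\<^sub>F r in at s within {0..T}. dist ((R r - R s) / (r - s)) 0 < e"
      using d(1) unfolding eventually_at by (intro exI[of _ d]) (auto simp: dist_real_def)
  qed
  \<comment> \<open>\<open>D\<close> is merely continuous, so its integral against the moving law is
    only known to be continuous in \<open>r\<close>, and the product rule is not applicable. Since
    the factor \<open>s - r\<close> vanishes at \<open>s\<close>, the difference quotient is minus
    that integral and continuity suffices.\<close>
  have dB: "((\<lambda>r. (s - r) * (\<integral>p. D p \<partial>\<sigma> r)) has_real_derivative - (\<integral>p. D p \<partial>\<sigma> s)) (at s within {0..T})"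
    unfolding has_field_derivative_iff
  proof (rule Lim_transform_eventually)
    show "((\<lambda>r. - (\<integral>p. D p \<partial>\<sigma> r)) \<longlongrightarrow> - (\<integral>p. D p \<partial>\<sigma> s)) (at s within {0..T})"
      using N(2)[OF cD] s by (intro tendsto_minus) (simp add: continuous_on_def)
    show "\<forall>\<^sub>F r in at s within {0..T}. - (\<integral>p. D p \<partial>\<sigma> r) =
        ((s - r) * (\<integral>p. D p \<partial>\<sigma> r) - (s - s) * (\<integral>p. D p \<partial>\<sigma> s)) / (r - s)"
      by (auto simp: eventually_at_filter field_simps)
  qed
  have "((\<lambda>r. R r + (s - r) * (\<integral>p. D p \<partial>\<sigma> r) + (\<integral>p. \<psi> p \<partial>\<sigma> r)) has_real_derivative
      0 + - (\<integral>p. D p \<partial>\<sigma> s) + (\<integral>p. Q lam \<psi> p \<partial>\<sigma> s)) (at s within {0..T})"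
    by (intro DERIV_add dR dB weak_solution_has_derivative[OF w \<psi> s])
  moreover have "(\<integral>p. Q lam \<psi> p \<partial>\<sigma> s) = (\<integral>p. D p + lam * (\<psi> (flip p) - \<psi> p) \<partial>\<sigma> s)"
    using prob_OmegaD(4)[OF N(1)[OF s]]
    by (intro Bochner_Integration.integral_cong) (auto simp: Q_def D_def \<psi>_def dx_transport[OF \<phi>])
  moreover have "\<dots> = (\<integral>p. D p \<partial>\<sigma> s) + lam * (\<integral>p. \<psi> (flip p) - \<psi> p \<partial>\<sigma> s)"
    using int[OF s cD] int[OF s C10_continuous[OF flip_diff_C10[OF \<psi>]]] by simp
  ultimately have "((\<lambda>r. R r + (s - r) * (\<integral>p. D p \<partial>\<sigma> r) + (\<integral>p. \<psi> p \<partial>\<sigma> r)) has_real_derivative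
      lam * (\<integral>p. \<psi> (flip p) - \<psi> p \<partial>\<sigma> s)) (at s within {0..T})" by simp
  then have "((\<lambda>r. \<integral>p. transport (t - r) \<phi> p \<partial>\<sigma> r) has_real_derivative
      lam * (\<integral>p. \<psi> (flip p) - \<psi> p \<partial>\<sigma> s)) (at s within {0..T})"
    by (rule has_field_derivative_transform_within[OF _ zero_less_one s]) (simp add: split)
  then show ?thesis by (simp add: \<psi>_def)
qed

text \<open>The induction step replaces \<open>\<phi>\<close> by the jump difference of its
  transport, whose sup norm is at most \<open>2 * K\<close>; with the factor \<open>lam\<close> this
  yields one power of \<open>2 * lam\<close>, and the time variable supplies the factorial. The base
  case is the trivial bound for two probability measures. \<open>\<phi>\<close>, \<open>K\<close>
  and \<open>t\<close> are generalized because the step changes all three.\<close>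

lemma weak_solution_difference_bound:
  assumes w: "weak_solution V lam T \<sigma>\<^sub>0 \<sigma>" "weak_solution V lam T \<sigma>\<^sub>0 \<tau>" and lam: "lam > 0"
  shows "\<phi> \<in> C10 V \<Longrightarrow> (\<And>p. p \<in> Omega V \<Longrightarrow> \<bar>\<phi> p\<bar> \<le> K) \<Longrightarrow> 0 \<le> K \<Longrightarrow> t \<in> {0..T} \<Longrightarrow>
    \<bar>(\<integral>p. \<phi> p \<partial>\<sigma> t) - (\<integral>p. \<phi> p \<partial>\<tau> t)\<bar> \<le> 2 * K * ((2 * lam * t) ^ n / fact n)"
proof (induction n arbitrary: \<phi> K t)
  case 0
  note N = narrow_curvesD(1)[OF weak_solutionD(1)[OF w(1)] \<open>t \<in> {0..T}\<close>]
    narrow_curvesD(1)[OF weak_solutionD(1)[OF w(2)] \<open>t \<in> {0..T}\<close>]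
  show ?case
    using abs_integral_Omega_le[of "\<sigma> t" V \<phi> K, OF N(1) 0(2,3)]
      abs_integral_Omega_le[of "\<tau> t" V \<phi> K, OF N(2) 0(2,3)] by simp
next
  case (Suc n)
  note N = narrow_curvesD[OF weak_solutionD(1)[OF w(1)]] narrow_curvesD[OF weak_solutionD(1)[OF w(2)]]
  define G where "G r = (\<integral>p. transport (t - r) \<phi> p \<partial>\<sigma> r) - (\<integral>p. transport (t - r) \<phi> p \<partial>\<tau> r)" for r
  define g where "g r = lam * (\<integral>p. transport (t - r) \<phi> (flip p) - transport (t - r) \<phi> p \<partial>\<sigma> r) -
    lam * (\<integral>p. transport (t - r) \<phi> (flip p) - transport (t - r) \<phi> p \<partial>\<tau> r)" for r
  \<comment> \<open>Majorant whose derivative at \<open>r\<close> is \<open>lam\<close> times the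
    inductive bound for a function of size \<open>2 * K\<close>; the mean value inequality then
    replaces an integration in time.\<close>
  define b where "b r = 2 * K * ((2 * lam * r) ^ Suc n / fact (Suc n))" for r
  have dG: "(G has_real_derivative g r) (at r within {0..T})" if "r \<in> {0..T}" for r
    unfolding G_def g_def
    by (intro DERIV_diff weak_solution_transport_derivative[OF w(1)] weak_solution_transport_derivative[OF w(2)] Suc that)
  have G0: "G 0 = 0" using weak_solutionD(2)[OF w(1)] weak_solutionD(2)[OF w(2)] by (simp add: G_def)
  show ?case
  proof (cases "t = 0")
    case True
    then show ?thesis using G0 by (simp add: G_def)
  next
    case False
    then have t: "0 < t" "t \<le> T" using Suc by auto
    have "norm (G t - G 0) \<le> b t - b 0"
    proof (rule differentiable_bound_general[OF t(1)])
      have "continuous_on {0..T} G"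
        using dG by (meson DERIV_continuous continuous_on_eq_continuous_within)
      then show "continuous_on {0..t} G" by (rule continuous_on_subset) (use t in auto)
      show "continuous_on {0..t} b" unfolding b_def by (intro continuous_intros) auto
      fix r assume r: "0 < r" "r < t"
      have "at r within {0..T} = at r" using r t by (intro at_within_interior) auto
      then show "(G has_vector_derivative g r) (at r)"
        using dG[of r] r t by (auto simp: has_real_derivative_iff_has_vector_derivative)
      have "(b has_real_derivative 2 * K * (of_nat (Suc n) * (2 * lam) * (2 * lam * r) ^ n / fact (Suc n))) (at r)"
        unfolding b_def by (auto intro!: derivative_eq_intros simp del: power_Suc fact_Suc)
      moreover have "of_nat (Suc n) * (2 * lam) * (2 * lam * r) ^ n / fact (Suc n) =
          2 * lam * ((2 * lam * r) ^ n / fact n)" by (simp add: mult.assoc del: of_nat_Suc)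
      ultimately show "(b has_vector_derivative 2 * K * (2 * lam * ((2 * lam * r) ^ n / fact n))) (at r)"
        by (simp only: has_real_derivative_iff_has_vector_derivative)
      have "\<bar>(\<integral>p. transport (t - r) \<phi> (flip p) - transport (t - r) \<phi> p \<partial>\<sigma> r) -
        (\<integral>p. transport (t - r) \<phi> (flip p) - transport (t - r) \<phi> p \<partial>\<tau> r)\<bar> \<le> 2 * (2 * K) * ((2 * lam * r) ^ n / fact n)"
      proof (rule Suc.IH[OF flip_diff_C10[OF transport_C10[OF Suc.prems(1)]]])
        have bound: "\<bar>transport (t - r) \<phi> p\<bar> \<le> K" if "p \<in> Omega V" for p
          using Suc.prems(2) that by (rule transport_bounded)
        fix p assume "p \<in> Omega V"
        then show "\<bar>transport (t - r) \<phi> (flip p) - transport (t - r) \<phi> p\<bar> \<le> 2 * K"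
          using bound[of p] bound[of "flip p"] by (simp add: abs_if split: if_splits)
      qed (use Suc r t in auto)
      then have "lam * \<bar>(\<integral>p. transport (t - r) \<phi> (flip p) - transport (t - r) \<phi> p \<partial>\<sigma> r) -
        (\<integral>p. transport (t - r) \<phi> (flip p) - transport (t - r) \<phi> p \<partial>\<tau> r)\<bar> \<le>
        lam * (2 * (2 * K) * ((2 * lam * r) ^ n / fact n))"
        using lam by (intro mult_left_mono) auto
      moreover have "\<bar>g r\<bar> = lam * \<bar>(\<integral>p. transport (t - r) \<phi> (flip p) - transport (t - r) \<phi> p \<partial>\<sigma> r) -
        (\<integral>p. transport (t - r) \<phi> (flip p) - transport (t - r) \<phi> p \<partial>\<tau> r)\<bar>"
        using lam unfolding g_def right_diff_distrib[symmetric] by (simp add: abs_mult)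
      ultimately show "norm (g r) \<le> 2 * K * (2 * lam * ((2 * lam * r) ^ n / fact n))"
        by (simp add: mult_ac)
    qed
    moreover have "G t = (\<integral>p. \<phi> p \<partial>\<sigma> t) - (\<integral>p. \<phi> p \<partial>\<tau> t)" by (simp add: G_def)
    ultimately show ?thesis by (simp add: G0 b_def del: power_Suc fact_Suc)
  qed
qed

theorem weak_solution_unique:
  assumes w: "weak_solution V lam T \<sigma>\<^sub>0 \<sigma>" "weak_solution V lam T \<sigma>\<^sub>0 \<tau>" and lam: "lam > 0"
  shows "\<sigma> = \<tau>"
proof -
  note N = weak_solutionD(1)[OF w(1)] weak_solutionD(1)[OF w(2)]
  have "\<sigma> t = \<tau> t" if t: "t \<in> {0..T}" for t
  proof (rule prob_Omega_eqI[OF narrow_curvesD(1)[OF N(1) t] narrow_curvesD(1)[OF N(2) t]])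
    fix \<phi> assume \<phi>: "\<phi> \<in> C10 V"
    obtain K where K: "K \<ge> 0" "\<And>p. p \<in> Omega V \<Longrightarrow> \<bar>\<phi> p\<bar> \<le> K"
      using Omega_continuous_bounded[OF C10_continuous[OF \<phi>]] by blast
    have "(\<lambda>n. 2 * K * (inverse (fact n) * (2 * lam * t) ^ n)) \<longlonglongrightarrow> 2 * K * 0"
      by (intro tendsto_intros summable_LIMSEQ_zero summable_exp)
    then have "(\<lambda>n. 2 * K * ((2 * lam * t) ^ n / fact n)) \<longlonglongrightarrow> 0"
      by (simp add: divide_inverse mult.commute)
    then have "\<bar>(\<integral>p. \<phi> p \<partial>\<sigma> t) - (\<integral>p. \<phi> p \<partial>\<tau> t)\<bar> \<le> 0"
      by (rule LIMSEQ_le_const) (use weak_solution_difference_bound[OF w lam \<phi> K(2,1) t] in auto)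
    then show "(\<integral>p. \<phi> p \<partial>\<sigma> t) = (\<integral>p. \<phi> p \<partial>\<tau> t)" by simp
  qed
  with N show ?thesis
    unfolding narrow_curves_def by (intro PiE_ext[of \<sigma> "{0..T}" "\<lambda>_. prob_Omega V"]) auto
qed

section \<open>Existence\<close>

text \<open>Shifting the weights by one index halves them: the count is 0 with probability one half,
  and otherwise it is one more than a count of the same law.\<close>

lemma expectation_geometric_half:
  fixes f :: "nat \<Rightarrow> real"
  assumes K: "\<And>n. \<bar>f n\<bar> \<le> K"
  shows "measure_pmf.expectation (geometric_pmf (1/2)) f =
    f 0 / 2 + measure_pmf.expectation (geometric_pmf (1/2)) (\<lambda>n. f (Suc n)) / 2"
proof -
  define c where "c n = (1/2::real) ^ Suc n" for n
  have c: "pmf (geometric_pmf (1/2)) n = c n" for n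
    by (simp add: c_def)
  have [simp]: "0 \<le> c n" for n by (simp add: c_def)
  have exp: "measure_pmf.expectation (geometric_pmf (1/2)) g = (\<Sum>n. c n * g n) \<and> summable (\<lambda>n. c n * g n)"
    if g: "\<And>n. \<bar>g n\<bar> \<le> K" for g :: "nat \<Rightarrow> real"
  proof -
    have int: "integrable (measure_pmf (geometric_pmf (1/2))) g"
      by (rule measure_pmf.integrable_const_bound[where B=K]) (use g in auto)
    then have int': "integrable (count_space UNIV) (\<lambda>n. c n * g n)"
      unfolding measure_pmf_eq_density by (subst (asm) integrable_density) (auto simp: c)
    have "measure_pmf.expectation (geometric_pmf (1/2)) g = (\<integral>n. c n * g n \<partial>count_space UNIV)"
      unfolding measure_pmf_eq_density by (subst integral_density) (auto simp: c)
    also have "\<dots> = (\<Sum>n. c n * g n)" by (rule integral_count_space_nat[OF int'])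
    finally show ?thesis
      using int' by (auto simp: integrable_count_space_nat_iff intro: summable_norm_cancel)
  qed
  have "(\<Sum>n. c n * f n) = (\<Sum>n. c (Suc n) * f (Suc n)) + c 0 * f 0"
    using suminf_split_head[OF conjunct2[OF exp[OF K], of "\<lambda>n. n"]] by simp
  also have "(\<Sum>n. c (Suc n) * f (Suc n)) = (\<Sum>n. (c n * f (Suc n)) / 2)"
    by (simp add: c_def mult_ac)
  also have "\<dots> = (\<Sum>n. c n * f (Suc n)) / 2"
    by (rule suminf_divide[OF conjunct2[OF exp[OF K]]])
  finally show ?thesis
    using exp[OF K] by (simp add: c_def)
qed

text \<open>A process that follows the deterministic motion \<open>\<Phi>\<close> and applies \<open>F\<close> at the times of
  a Poisson clock of intensity \<open>lam\<close>, started from the distribution \<open>M\<close>.\<close>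

locale jump_flow = prob_space M for M :: "'a measure" +
  fixes \<Phi> :: "real \<Rightarrow> 'a \<Rightarrow> 'a" and F :: "'a \<Rightarrow> 'a" and lam :: real
  assumes flow_measurable: "(\<lambda>z. \<Phi> (fst z) (snd z)) \<in> borel \<Otimes>\<^sub>M M \<rightarrow>\<^sub>M M"
    and F_measurable [measurable]: "F \<in> M \<rightarrow>\<^sub>M M"
    and lam: "lam > 0"
    and flow_0: "p \<in> space M \<Longrightarrow> \<Phi> 0 p = p"
begin

lemma flow_measurable_compose [measurable (raw)]:
  assumes "f \<in> N \<rightarrow>\<^sub>M borel" "g \<in> N \<rightarrow>\<^sub>M M"
  shows "(\<lambda>x. \<Phi> (f x) (g x)) \<in> N \<rightarrow>\<^sub>M M"
  using measurable_compose[OF measurable_Pair[OF assms] flow_measurable] by simp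

section \<open>The chain of jumps and its renewal equation\<close>

definition expo :: "real measure"
  where "expo = density lborel (\<lambda>h. ennreal (exponential_density (2 * lam) h))"

lemma sets_expo [simp, measurable_cong]: "sets expo = sets borel"
  and space_expo [simp]: "space expo = UNIV"
  by (simp_all add: expo_def)

lemma prob_space_expo: "prob_space expo"
  unfolding expo_def using lam by (intro prob_space_exponential_density) simp

abbreviation S where "S \<equiv> borel \<Otimes>\<^sub>M M"

text \<open>The joint law of the \<open>n\<close>-th jump time and of the state after that jump, for a clock of
  intensity \<open>2 lam\<close>. Averaging over \<open>n\<close> with the geometric weights \<open>2\<^sup>-\<^sup>n\<^sup>-\<^sup>1\<close> gives,
  up to the factor \<open>2 exp (2 lam s)\<close>, the sum over \<open>n\<close> of the measures
  \<open>lam\<^sup>n ds\<^sub>1 \<dots> ds\<^sub>n\<close> on the simplices, so that no infinite measure is ever needed.\<close>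

fun jumps :: "nat \<Rightarrow> (real \<times> 'a) measure" where
  "jumps 0 = distr M S (\<lambda>p. (0, p))"
| "jumps (Suc n) = distr (jumps n \<Otimes>\<^sub>M expo) S (\<lambda>z. (fst (fst z) + snd z, F (\<Phi> (snd z) (snd (fst z)))))"

lemma sets_jumps [simp, measurable_cong]: "sets (jumps n) = sets S"
  by (cases n) auto

lemma prob_space_jumps: "prob_space (jumps n)"
proof (induction n)
  case 0
  show ?case unfolding jumps.simps by (rule prob_space_distr) measurable
next
  case (Suc n)
  interpret J: prob_space "jumps n" by fact
  interpret expo: prob_space expo by (rule prob_space_expo)
  interpret pair_prob_space "jumps n" expo ..
  show ?case unfolding jumps.simps by (rule prob_space_distr) measurable
qed

definition R :: "(real \<times> 'a) measure"
  where "R = measure_pmf (geometric_pmf (1/2)) \<bind> jumps"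

lemma jumps_measurable: "jumps \<in> measure_pmf (geometric_pmf (1/2)) \<rightarrow>\<^sub>M subprob_algebra S"
  using prob_space_jumps by (auto simp: space_subprob_algebra prob_space_imp_subprob_space)

lemma sets_R [simp, measurable_cong]: "sets R = sets S"
  unfolding R_def by (rule sets_bind[OF sets_kernel[OF jumps_measurable]]) auto

lemma space_R [simp]: "space R = UNIV \<times> space M"
  using sets_eq_imp_space_eq[OF sets_R] by (simp add: space_pair_measure)

lemma prob_space_R: "prob_space R"
  unfolding R_def
  using prob_space_jumps jumps_measurable
  by (intro measure_pmf.prob_space_bind[where S=S]) auto

lemma integral_jumps_Suc:
  fixes g :: "real \<times> 'a \<Rightarrow> real"
  assumes [measurable]: "g \<in> borel_measurable S" and K: "\<And>z. z \<in> space S \<Longrightarrow> \<bar>g z\<bar> \<le> K"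
  shows "(\<integral>z. g z \<partial>jumps (Suc n)) = (\<integral>z. (\<integral>h. g (fst z + h, F (\<Phi> h (snd z))) \<partial>expo) \<partial>jumps n)"
proof -
  interpret J: prob_space "jumps n" by (rule prob_space_jumps)
  interpret expo: prob_space expo by (rule prob_space_expo)
  interpret PP: pair_prob_space "jumps n" expo ..
  have sp: "space (jumps n) = space S" by (rule sets_eq_imp_space_eq) simp
  have m: "(\<lambda>z. (fst (fst z) + snd z, F (\<Phi> (snd z) (snd (fst z))))) \<in> jumps n \<Otimes>\<^sub>M expo \<rightarrow>\<^sub>M S"
    by measurable
  have "integrable (jumps n \<Otimes>\<^sub>M expo) (\<lambda>z. g (fst (fst z) + snd z, F (\<Phi> (snd z) (snd (fst z)))))"
    by (rule PP.P.integrable_const_bound[where B=K]) (use measurable_space[OF m] K in auto)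
  from PP.integral_fst'[OF this] show ?thesis
    unfolding jumps.simps by (subst integral_distr[OF m]) auto
qed

lemma expo_average_measurable [measurable]:
  fixes g :: "real \<times> 'a \<Rightarrow> real"
  assumes [measurable]: "g \<in> borel_measurable S"
  shows "(\<lambda>z. \<integral>h. g (fst z + h, F (\<Phi> h (snd z))) \<partial>expo) \<in> borel_measurable S"
proof -
  interpret expo: prob_space expo by (rule prob_space_expo)
  show ?thesis by measurable
qed

lemma abs_expo_average_le:
  fixes g :: "real \<times> 'a \<Rightarrow> real"
  assumes [measurable]: "g \<in> borel_measurable S" and K: "\<And>z. z \<in> space S \<Longrightarrow> \<bar>g z\<bar> \<le> K" and z: "z \<in> space S"
  shows "\<bar>\<integral>h. g (fst z + h, F (\<Phi> h (snd z))) \<partial>expo\<bar> \<le> K"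
proof -
  interpret expo: prob_space expo by (rule prob_space_expo)
  have z2: "snd z \<in> space M" using z by (auto simp: space_pair_measure)
  have m: "(\<lambda>h. (fst z + h, F (\<Phi> h (snd z)))) \<in> expo \<rightarrow>\<^sub>M S"
    using z2 by measurable
  have b: "\<bar>g (fst z + h, F (\<Phi> h (snd z)))\<bar> \<le> K" for h
    using measurable_space[OF m, of h] K by auto
  have int: "integrable expo (\<lambda>h. g (fst z + h, F (\<Phi> h (snd z))))"
    by (rule expo.integrable_const_bound[where B=K]) (use b measurable_compose[OF m assms(1)] in auto)
  have "\<bar>\<integral>h. g (fst z + h, F (\<Phi> h (snd z))) \<partial>expo\<bar> \<le> (\<integral>h. \<bar>g (fst z + h, F (\<Phi> h (snd z)))\<bar> \<partial>expo)"
    by (rule integral_abs_bound)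
  also have "\<dots> \<le> (\<integral>h. K \<partial>expo)"
    using int b by (intro integral_mono) auto
  finally show ?thesis using expo.prob_space by simp
qed

text \<open>Renewal equation: with probability one half there is no jump and the state is the
  initial one at time 0; otherwise one more jump, after an exponential waiting time, follows a
  configuration distributed like \<open>R\<close>. As in the recursion for \<open>jumps\<close>, the
  new jump comes last.\<close>

lemma integral_R:
  fixes g :: "real \<times> 'a \<Rightarrow> real"
  assumes [measurable]: "g \<in> borel_measurable S" and K: "\<And>z. z \<in> space S \<Longrightarrow> \<bar>g z\<bar> \<le> K"
  shows "(\<integral>z. g z \<partial>R) = (\<integral>p. g (0, p) \<partial>M) / 2 +
    (\<integral>z. (\<integral>h. g (fst z + h, F (\<Phi> h (snd z))) \<partial>expo) \<partial>R) / 2"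
proof -
  have bind: "(\<integral>z. f z \<partial>R) = measure_pmf.expectation (geometric_pmf (1/2)) (\<lambda>n. \<integral>z. f z \<partial>jumps n)"
    if "f \<in> borel_measurable S" "\<And>z. z \<in> space S \<Longrightarrow> \<bar>f z\<bar> \<le> K" for f
    unfolding R_def
  proof (rule integral_bind[where K=S and B'=1, OF that jumps_measurable])
    show "finite_measure (measure_pmf (geometric_pmf (1/2)))" by (rule measure_pmf.finite_measure)
    show "AE n in measure_pmf (geometric_pmf (1/2)). emeasure (jumps n) (space (jumps n)) \<le> ennreal 1"
      using prob_space_jumps by (simp add: prob_space.emeasure_space_1)
  qed
  have b: "\<bar>\<integral>z. g z \<partial>jumps n\<bar> \<le> K" for n
  proof -
    interpret J: prob_space "jumps n" by (rule prob_space_jumps)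
    have sp: "space (jumps n) = space S" by (rule sets_eq_imp_space_eq) simp
    have int: "integrable (jumps n) g"
      by (rule J.integrable_const_bound[where B=K]) (use K sp in auto)
    have "\<bar>\<integral>z. g z \<partial>jumps n\<bar> \<le> (\<integral>z. \<bar>g z\<bar> \<partial>jumps n)" by (rule integral_abs_bound)
    also have "\<dots> \<le> (\<integral>z. K \<partial>jumps n)" using int K sp by (intro integral_mono) auto
    finally show ?thesis using J.prob_space by simp
  qed
  have "(\<integral>z. g z \<partial>jumps 0) = (\<integral>p. g (0, p) \<partial>M)"
    unfolding jumps.simps by (subst integral_distr) auto
  then show ?thesis
    using expectation_geometric_half[OF b] bind[of g] K
      bind[OF expo_average_measurable[OF assms(1)] abs_expo_average_le[OF assms]]
    by (simp add: integral_jumps_Suc[OF assms] del: jumps.simps)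
qed

text \<open>Let m be the mass of the negative times. The initial time is 0 and waiting times are
  almost surely nonnegative, so the renewal equation gives m \<le> m / 2.\<close>

lemma AE_R_nonneg: "AE z in R. 0 \<le> fst z"
proof -
  interpret R: prob_space R by (rule prob_space_R)
  interpret expo: prob_space expo by (rule prob_space_expo)
  define g where "g z = (indicator {..<0} (fst z) :: real)" for z :: "real \<times> 'a"
  have [measurable]: "g \<in> borel_measurable S" unfolding g_def by measurable
  have "(\<integral>z. g z \<partial>R) = (\<integral>z. (\<integral>h. g (fst z + h, F (\<Phi> h (snd z))) \<partial>expo) \<partial>R) / 2"
    by (subst integral_R[where K=1]) (auto simp: g_def)
  also have "(\<integral>z. (\<integral>h. g (fst z + h, F (\<Phi> h (snd z))) \<partial>expo) \<partial>R) \<le> (\<integral>z. g z \<partial>R)"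
  proof (rule integral_mono)
    show "integrable R g" by (rule R.integrable_const_bound[where B=1]) (auto simp: g_def)
    show "integrable R (\<lambda>z. \<integral>h. g (fst z + h, F (\<Phi> h (snd z))) \<partial>expo)"
    proof (rule R.integrable_const_bound[where B=1])
      show "AE z in R. norm (\<integral>h. g (fst z + h, F (\<Phi> h (snd z))) \<partial>expo) \<le> 1"
        using abs_expo_average_le[of g 1] by (intro AE_I2) (auto simp: g_def space_pair_measure)
    qed measurable
    fix z assume z: "z \<in> space R"
    show "(\<integral>h. g (fst z + h, F (\<Phi> h (snd z))) \<partial>expo) \<le> g z"
    proof (cases "fst z < 0")
      case True
      then show ?thesis
        using abs_expo_average_le[of g 1 z] z by (auto simp: g_def space_pair_measure)
    next
      case False
      have "AE h in expo. 0 \<le> h"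
        unfolding expo_def by (subst AE_density) (auto simp: exponential_density_def)
      then have "AE h in expo. g (fst z + h, F (\<Phi> h (snd z))) = 0"
        by eventually_elim (use False in \<open>auto simp: g_def\<close>)
      then show ?thesis
        using integral_eq_zero_AE[of "\<lambda>h. g (fst z + h, F (\<Phi> h (snd z)))" expo] False by (simp add: g_def)
    qed
  qed
  finally have "(\<integral>z. g z \<partial>R) \<le> 0" by simp
  moreover have "0 \<le> (\<integral>z. g z \<partial>R)" by (intro integral_nonneg_AE) (auto simp: g_def)
  ultimately have "(\<integral>z. g z \<partial>R) = 0" by simp
  then have "AE z in R. g z = 0"
    by (subst (asm) integral_nonneg_eq_0_iff_AE) (auto intro!: R.integrable_const_bound[where B=1] simp: g_def)
  then show ?thesis by eventually_elim (auto simp: g_def indicator_def split: if_splits)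
qed

text \<open>Under \<open>R\<close>, a history of \<open>n\<close> jumps with the last at time
  \<open>s\<close> has density \<open>2^(-n-1) (2 lam)^n exp(-2 lam s)\<close>. A clock of intensity
  \<open>lam\<close> produces exactly these jumps up to time \<open>t\<close> with density
  \<open>lam^n exp(-lam t)\<close>, which includes silence from \<open>s\<close> to
  \<open>t\<close>. The weight is the quotient, in which \<open>n\<close> has dropped out.\<close>

definition weight :: "real \<Rightarrow> real \<Rightarrow> real"
  where "weight t s = 2 * indicator {0..t} s * exp (2 * lam * s - lam * t)"

lemma weight_nonneg: "0 \<le> weight t s"
  by (simp add: weight_def)

lemma weight_le: "r \<le> t \<Longrightarrow> 0 \<le> r \<Longrightarrow> weight r s \<le> 2 * exp (lam * t)"
proof -
  assume r: "r \<le> t" "0 \<le> r"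
  have "2 * lam * s - lam * r \<le> lam * t" if "s \<le> r"
  proof -
    have "lam * s \<le> lam * r" "lam * r \<le> lam * t" using that r lam by simp_all
    then show ?thesis by linarith
  qed
  then show ?thesis by (simp add: weight_def indicator_def)
qed

lemma weight_measurable [measurable (raw)]:
  assumes [measurable]: "f \<in> borel_measurable N" "g \<in> borel_measurable N"
  shows "(\<lambda>x. weight (f x) (g x)) \<in> borel_measurable N"
proof -
  have "(\<lambda>x. weight (f x) (g x)) = (\<lambda>x. 2 * (if 0 \<le> g x \<and> g x \<le> f x then 1 else 0) * exp (2 * lam * g x - lam * f x))"
    by (auto simp: weight_def fun_eq_iff)
  then show ?thesis by simp
qed

text \<open>After reweighting, the pair under \<open>R\<close> is the last jump up to time
  \<open>t\<close>; from there only the deterministic motion acts, for the remaining time.\<close>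

definition law :: "real \<Rightarrow> 'a measure"
  where "law t = distr (density R (\<lambda>z. ennreal (weight t (fst z)))) M (\<lambda>z. \<Phi> (t - fst z) (snd z))"

lemma sets_law [simp, measurable_cong]: "sets (law t) = sets M"
  by (simp add: law_def)

section \<open>Evolution of the law\<close>

lemma integral_law:
  fixes g :: "'a \<Rightarrow> real"
  assumes [measurable]: "g \<in> borel_measurable M"
  shows "(\<integral>p. g p \<partial>law t) = (\<integral>z. weight t (fst z) * g (\<Phi> (t - fst z) (snd z)) \<partial>R)"
  unfolding law_def
  by (subst integral_distr, measurable, subst integral_density) (auto simp: weight_nonneg)

lemma flow_in_space: "p \<in> space M \<Longrightarrow> \<Phi> h p \<in> space M"
  using measurable_space[OF flow_measurable, of "(h, p)"] by (simp add: space_pair_measure)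

lemma integrable_R_weight:
  fixes g :: "'a \<Rightarrow> real"
  assumes [measurable]: "g \<in> borel_measurable M" and K: "\<And>p. p \<in> space M \<Longrightarrow> \<bar>g p\<bar> \<le> K"
    and r: "0 \<le> r"
  shows "integrable R (\<lambda>z. weight r (fst z) * g (\<Phi> (r - fst z) (snd z)))"
proof -
  interpret R: prob_space R by (rule prob_space_R)
  show ?thesis
  proof (rule R.integrable_const_bound[where B="2 * exp (lam * r) * K"])
    show "AE z in R. norm (weight r (fst z) * g (\<Phi> (r - fst z) (snd z))) \<le> 2 * exp (lam * r) * K"
      using r by (auto intro!: AE_I2 mult_mono weight_le K flow_in_space simp: abs_mult weight_nonneg)
  qed measurable
qed

lemma integrable_weight_flow:
  fixes g :: "'a \<Rightarrow> real"
  assumes [measurable]: "g \<in> borel_measurable M" and K: "\<And>p. p \<in> space M \<Longrightarrow> \<bar>g p\<bar> \<le> K"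
  shows "integrable (R \<Otimes>\<^sub>M lborel)
    (\<lambda>(z, r). indicator {0..t} r * (weight r (fst z) * g (\<Phi> (r - fst z) (snd z))))"
proof (rule integrableI_bounded_set[where A="space R \<times> {0..t}" and B="2 * exp (lam * t) * K"])
  interpret R: prob_space R by (rule prob_space_R)
  show "space R \<times> {0..t} \<in> sets (R \<Otimes>\<^sub>M lborel)" by measurable
  show "(\<lambda>(z, r). indicator {0..t} r * (weight r (fst z) * g (\<Phi> (r - fst z) (snd z))))
      \<in> borel_measurable (R \<Otimes>\<^sub>M lborel)" by measurable
  show "emeasure (R \<Otimes>\<^sub>M lborel) (space R \<times> {0..t}) < \<infinity>"
    by (subst lborel.emeasure_pair_measure_Times)
      (use sets.top[of R] in \<open>auto simp: R.emeasure_space_1 emeasure_lborel_Icc_eq simp del: space_R\<close>)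
  show "AE x in R \<Otimes>\<^sub>M lborel. x \<in> space R \<times> {0..t} \<longrightarrow>
      norm (case x of (z, r) \<Rightarrow> indicator {0..t} r * (weight r (fst z) * g (\<Phi> (r - fst z) (snd z))))
        \<le> 2 * exp (lam * t) * K"
    by (rule AE_I2) (auto intro!: mult_mono weight_le K flow_in_space simp: abs_mult weight_nonneg)
  show "AE x in R \<Otimes>\<^sub>M lborel. x \<notin> space R \<times> {0..t} \<longrightarrow>
      (case x of (z, r) \<Rightarrow> indicator {0..t} r * (weight r (fst z) * g (\<Phi> (r - fst z) (snd z)))) = 0"
    by (rule AE_I2) (auto simp: space_pair_measure indicator_def)
qed

text \<open>Fubini: a time integral of the law becomes, for each fixed last jump, an integral over
  the time after it. There the substitution in \<open>jump_identity\<close> and the fundamental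
  theorem in \<open>flow_identity\<close> can act.\<close>

lemma swap_law:
  fixes g :: "'a \<Rightarrow> real"
  assumes [measurable]: "g \<in> borel_measurable M" and K: "\<And>p. p \<in> space M \<Longrightarrow> \<bar>g p\<bar> \<le> K"
  shows "(\<integral>z. (\<integral>r. indicator {0..t} r * (weight r (fst z) * g (\<Phi> (r - fst z) (snd z))) \<partial>lborel) \<partial>R) =
      (LINT r:{0..t}|lborel. (\<integral>p. g p \<partial>law r))" (is "?L = ?R")
    and "set_integrable lborel {0..t} (\<lambda>r. \<integral>p. g p \<partial>law r)"
    and "integrable R (\<lambda>z. \<integral>r. indicator {0..t} r * (weight r (fst z) * g (\<Phi> (r - fst z) (snd z))) \<partial>lborel)"
proof -
  interpret R: prob_space R by (rule prob_space_R)
  interpret P: pair_sigma_finite R lborel ..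
  note int = integrable_weight_flow[OF assms, of t]
  show "integrable R (\<lambda>z. \<integral>r. indicator {0..t} r * (weight r (fst z) * g (\<Phi> (r - fst z) (snd z))) \<partial>lborel)"
    using P.integrable_fst[OF int] .
  have "?L = (\<integral>r. (\<integral>z. indicator {0..t} r * (weight r (fst z) * g (\<Phi> (r - fst z) (snd z))) \<partial>R) \<partial>lborel)"
    by (rule P.Fubini_integral[symmetric, OF int])
  then show "?L = ?R" by (simp add: set_lebesgue_integral_def integral_law)
  show "set_integrable lborel {0..t} (\<lambda>r. \<integral>p. g p \<partial>law r)"
    using P.integrable_snd[OF int] by (simp add: set_integrable_def integral_law)
qed

text \<open>Renewal equation for \<open>2 exp(lam s) g\<close> on times up to \<open>t\<close>. In
  its second term the substitution \<open>r = s + h\<close> turns the waiting time density into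
  \<open>lam\<close> times \<open>weight r s\<close>, up to a factor 2 that cancels: states just
  before a jump follow \<open>law r\<close> and jump at rate \<open>lam\<close>. The factor
  \<open>2 exp(lam s)\<close> is \<open>weight s s\<close>, the weight at the moment of a
  jump.\<close>

lemma jump_identity:
  fixes g :: "'a \<Rightarrow> real"
  assumes [measurable]: "g \<in> borel_measurable M" and K: "\<And>p. p \<in> space M \<Longrightarrow> \<bar>g p\<bar> \<le> K"
    and t: "0 \<le> t"
  shows "(\<integral>z. 2 * indicator {0..t} (fst z) * exp (lam * fst z) * g (snd z) \<partial>R) =
    (\<integral>p. g p \<partial>M) + (LINT r:{0..t}|lborel. (\<integral>p. lam * g (F p) \<partial>law r))"
proof -
  interpret R: prob_space R by (rule prob_space_R)
  define G where "G z = 2 * indicator {0..t} (fst z) * exp (lam * fst z) * g (snd z)" for z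
  have [measurable]: "G \<in> borel_measurable S" unfolding G_def by measurable
  have GK: "\<bar>G z\<bar> \<le> 2 * exp (lam * t) * K" if "z \<in> space S" for z
    using that lam order_trans[OF abs_ge_zero K, of "snd z"]
    by (auto simp: G_def space_pair_measure abs_mult indicator_def intro!: mult_mono K)
  have [measurable]: "(\<lambda>p. lam * g (F p)) \<in> borel_measurable M" by measurable
  have lK: "\<bar>lam * g (F p)\<bar> \<le> lam * K" if "p \<in> space M" for p
    using lam K[OF measurable_space[OF F_measurable that]] by (simp add: abs_mult)
  have "(\<integral>z. (\<integral>h. G (fst z + h, F (\<Phi> h (snd z))) \<partial>expo) \<partial>R) / 2 =
     (\<integral>z. (\<integral>r. indicator {0..t} r * (weight r (fst z) * (lam * g (F (\<Phi> (r - fst z) (snd z))))) \<partial>lborel) \<partial>R)"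
  proof (subst Bochner_Integration.integral_divide_zero[symmetric], rule integral_cong_AE)
    \<comment> \<open>This fails for negative jump times, where \<open>weight\<close> vanishes but
      the left-hand side need not; such times form a null set.\<close>
    show "AE z in R. (\<integral>h. G (fst z + h, F (\<Phi> h (snd z))) \<partial>expo) / 2 =
        (\<integral>r. indicator {0..t} r * (weight r (fst z) * (lam * g (F (\<Phi> (r - fst z) (snd z))))) \<partial>lborel)"
      using AE_R_nonneg AE_space
    proof eventually_elim
      case (elim z)
      then have [measurable]: "snd z \<in> space M" by auto
      have "(\<integral>h. G (fst z + h, F (\<Phi> h (snd z))) \<partial>expo) =
          (\<integral>h. exponential_density (2 * lam) h * G (fst z + h, F (\<Phi> h (snd z))) \<partial>lborel)"
        unfolding expo_def using lam
        by (subst integral_density) (auto simp: exponential_density_def)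
      also have "\<dots> = (\<integral>r. exponential_density (2 * lam) (r - fst z) * G (r, F (\<Phi> (r - fst z) (snd z))) \<partial>lborel)"
        by (subst lborel_integral_real_affine[where c=1 and t="- fst z"]) (auto simp: algebra_simps)
      also have "\<dots> = (\<integral>r. 2 * (indicator {0..t} r * (weight r (fst z) * (lam * g (F (\<Phi> (r - fst z) (snd z)))))) \<partial>lborel)"
      proof (intro Bochner_Integration.integral_cong refl)
        fix r
        have "exp (- (r - fst z) * (2 * lam)) * exp (lam * r) = exp (2 * lam * fst z - lam * r)"
          by (simp add: exp_add[symmetric] algebra_simps)
        then show "exponential_density (2 * lam) (r - fst z) * G (r, F (\<Phi> (r - fst z) (snd z))) =
          2 * (indicator {0..t} r * (weight r (fst z) * (lam * g (F (\<Phi> (r - fst z) (snd z))))))"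
          using elim(1) by (auto simp: exponential_density_def G_def weight_def indicator_def mult_ac)
      qed
      finally show ?case by simp
    qed
  qed measurable
  also have "\<dots> = (LINT r:{0..t}|lborel. (\<integral>p. lam * g (F p) \<partial>law r))"
    by (rule swap_law(1)[where g="\<lambda>p. lam * g (F p)" and K="lam * K"]) (use lK in auto)
  finally show ?thesis
    using integral_R[OF _ GK] t by (simp add: G_def[abs_def] mult.assoc)
qed

text \<open>For a fixed last jump at time \<open>s\<close> the weighted observable is followed from
  \<open>s\<close> to \<open>t\<close>. It starts at \<open>2 exp(lam s)\<close> times the value of
  \<open>\<psi>\<close> after the jump, and its derivative is the weight times
  \<open>D - lam * \<psi>\<close>, the loss term stemming from \<open>exp (- lam * r)\<close>.
  Averaged over \<open>R\<close>, the starting values become the left-hand side of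
  \<open>jump_identity\<close>.\<close>

lemma flow_identity:
  fixes \<psi> D :: "'a \<Rightarrow> real"
  assumes [measurable]: "\<psi> \<in> borel_measurable M" "D \<in> borel_measurable M"
    and K: "\<And>p. p \<in> space M \<Longrightarrow> \<bar>\<psi> p\<bar> \<le> K" "\<And>p. p \<in> space M \<Longrightarrow> \<bar>D p\<bar> \<le> K"
    and der: "\<And>p h. p \<in> space M \<Longrightarrow> ((\<lambda>h. \<psi> (\<Phi> h p)) has_real_derivative D (\<Phi> h p)) (at h)"
    and cont: "\<And>p h. p \<in> space M \<Longrightarrow> isCont (\<lambda>h. D (\<Phi> h p)) h"
    and t: "0 \<le> t"
  shows "(\<integral>p. \<psi> p \<partial>law t) = (\<integral>z. 2 * indicator {0..t} (fst z) * exp (lam * fst z) * \<psi> (snd z) \<partial>R) +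
    (LINT r:{0..t}|lborel. (\<integral>p. D p - lam * \<psi> p \<partial>law r))"
proof -
  interpret R: prob_space R by (rule prob_space_R)
  define k where "k p = D p - lam * \<psi> p" for p
  have [measurable]: "k \<in> borel_measurable M" unfolding k_def by measurable
  have kK: "\<bar>k p\<bar> \<le> K + lam * K" if "p \<in> space M" for p
  proof -
    have "\<bar>lam * \<psi> p\<bar> \<le> lam * K" using K(1)[OF that] lam by (simp add: abs_mult)
    then show ?thesis using abs_triangle_ineq4[of "D p" "lam * \<psi> p"] K(2)[OF that] unfolding k_def by linarith
  qed
  have eq: "weight t (fst z) * \<psi> (\<Phi> (t - fst z) (snd z)) =
      2 * indicator {0..t} (fst z) * exp (lam * fst z) * \<psi> (snd z) +
      (\<integral>r. indicator {0..t} r * (weight r (fst z) * k (\<Phi> (r - fst z) (snd z))) \<partial>lborel)"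
    if z: "z \<in> space R" for z
  proof (cases "fst z \<in> {0..t}")
    case True
    define s where "s = fst z"
    define p where "p = snd z"
    have p: "p \<in> space M" using z by (auto simp: p_def)
    have s: "0 \<le> s" "s \<le> t" using True by (auto simp: s_def)
    define f where "f r = 2 * exp (2 * lam * s - lam * r) * k (\<Phi> (r - s) p)" for r
    define f0 where "f0 r = 2 * exp (2 * lam * s - lam * r) * \<psi> (\<Phi> (r - s) p)" for r
    have shift: "((\<lambda>r. \<psi> (\<Phi> (r - s) p)) has_real_derivative D (\<Phi> (r - s) p)) (at r)" for r
      using der[OF p, of "r - s"] DERIV_shift[of "\<lambda>h. \<psi> (\<Phi> h p)" _ r "- s"] by simp
    have "(\<integral>r. f r * indicator {s..t} r \<partial>lborel) = f0 t - f0 s"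
    proof (rule integral_FTC_Icc_real[OF s(2)])
      show "(f0 has_real_derivative f r) (at r)" for r
        unfolding f_def f0_def k_def
        by (rule derivative_eq_intros shift refl | simp add: algebra_simps)+
      have "isCont (\<lambda>r. D (\<Phi> (r - s) p)) r" for r
        by (rule isCont_o2[where f="\<lambda>r. r - s" and g="\<lambda>h. D (\<Phi> h p)"]) (simp_all add: cont[OF p])
      moreover have "isCont (\<lambda>r. \<psi> (\<Phi> (r - s) p)) r" for r by (rule DERIV_isCont[OF shift])
      ultimately show "isCont f r" for r
        unfolding f_def k_def by (intro continuous_intros)
    qed
    moreover have "indicator {0..t} r * (weight r s * k (\<Phi> (r - s) p)) = f r * indicator {s..t} r" for r
      using s by (auto simp: weight_def f_def indicator_def)
    moreover have "2 * lam * s - lam * s = lam * s" by simp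
    ultimately show ?thesis
      using s p unfolding s_def[symmetric] p_def[symmetric]
      by (simp add: f0_def flow_0 weight_def)
  next
    case False
    then have "indicator {0..t} r * (weight r (fst z) * k (\<Phi> (r - fst z) (snd z))) = 0" for r
      by (auto simp: weight_def indicator_def)
    then have "(\<integral>r. indicator {0..t} r * (weight r (fst z) * k (\<Phi> (r - fst z) (snd z))) \<partial>lborel) = 0"
      by (simp only: Bochner_Integration.integral_zero)
    with False show ?thesis by (simp add: weight_def[of t])
  qed
  have "integrable R (\<lambda>z. 2 * indicator {0..t} (fst z) * exp (lam * fst z) * \<psi> (snd z))"
  proof (rule R.integrable_const_bound[where B="2 * exp (lam * t) * K"])
    show "AE z in R. norm (2 * indicator {0..t} (fst z) * exp (lam * fst z) * \<psi> (snd z)) \<le> 2 * exp (lam * t) * K"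
    proof (rule AE_I2)
      fix z assume "z \<in> space R"
      then have "snd z \<in> space M" by auto
      then show "norm (2 * indicator {0..t} (fst z) * exp (lam * fst z) * \<psi> (snd z)) \<le> 2 * exp (lam * t) * K"
        using lam order_trans[OF abs_ge_zero K(1), of "snd z"]
        by (auto simp: abs_mult indicator_def intro!: mult_mono K)
    qed
  qed measurable
  moreover have "(\<integral>p. \<psi> p \<partial>law t) = (\<integral>z. 2 * indicator {0..t} (fst z) * exp (lam * fst z) * \<psi> (snd z) +
      (\<integral>r. indicator {0..t} r * (weight r (fst z) * k (\<Phi> (r - fst z) (snd z))) \<partial>lborel) \<partial>R)"
    by (simp add: integral_law) (rule Bochner_Integration.integral_cong[OF refl eq])
  ultimately show ?thesis
    using swap_law[of k "K + lam * K" t] kK by (simp add: k_def)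
qed

text \<open>Mass conservation is the case \<open>\<psi> = 1\<close>, \<open>D = 0\<close> of the two
  identities: the gain and the loss by jumps cancel.\<close>

lemma prob_space_law:
  assumes t: "0 \<le> t"
  shows "prob_space (law t)"
proof (rule prob_spaceI)
  have int: "integrable R (\<lambda>z. weight t (fst z))"
    using integrable_R_weight[of "\<lambda>_. 1" 1 t] t by simp
  have 1: "(\<integral>p. (1::real) \<partial>law t) = (\<integral>z. weight t (fst z) \<partial>R)"
    by (subst integral_law) auto
  have "(\<integral>p. (1::real) \<partial>law t) = 1 + (LINT r:{0..t}|lborel. (\<integral>p. lam \<partial>law r)) + (LINT r:{0..t}|lborel. (\<integral>p. 0 - lam * 1 \<partial>law r))"
    using flow_identity[of "\<lambda>_. 1" "\<lambda>_. 0" 1 t] jump_identity[of "\<lambda>_. 1" 1 t] t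
    by (simp add: prob_space)
  also have "\<dots> = 1"
    by (simp add: set_lebesgue_integral_def mult.assoc[symmetric])
  finally have w: "(\<integral>z. weight t (fst z) \<partial>R) = 1" using 1 by simp
  have sp: "space (law t) = space M" by (rule sets_eq_imp_space_eq) simp
  have "emeasure (law t) (space (law t)) = emeasure (density R (\<lambda>z. ennreal (weight t (fst z)))) (space R)"
    unfolding sp unfolding law_def
    by (subst emeasure_distr) (auto simp: vimage_def flow_in_space intro!: arg_cong[where f="emeasure _"])
  also have "\<dots> = (\<integral>\<^sup>+z. ennreal (weight t (fst z)) \<partial>R)"
    by (subst emeasure_density) (auto intro!: nn_integral_cong)
  also have "\<dots> = 1"
    using nn_integral_eq_integral[OF int] w by (simp add: weight_nonneg)
  finally show "emeasure (law t) (space (law t)) = 1" .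
qed

text \<open>The states at the jump times enter \<open>flow_identity\<close> as starting values and
  are evaluated by \<open>jump_identity\<close>; eliminating them leaves the initial value, the
  motion, and the gain and loss by jumps.\<close>

theorem law_evolution:
  fixes \<psi> D :: "'a \<Rightarrow> real"
  assumes m [measurable]: "\<psi> \<in> borel_measurable M" "D \<in> borel_measurable M"
    and K: "\<And>p. p \<in> space M \<Longrightarrow> \<bar>\<psi> p\<bar> \<le> K" "\<And>p. p \<in> space M \<Longrightarrow> \<bar>D p\<bar> \<le> K"
    and der: "\<And>p h. p \<in> space M \<Longrightarrow> ((\<lambda>h. \<psi> (\<Phi> h p)) has_real_derivative D (\<Phi> h p)) (at h)"
    and cont: "\<And>p h. p \<in> space M \<Longrightarrow> isCont (\<lambda>h. D (\<Phi> h p)) h"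
    and t: "0 \<le> t"
  shows "set_integrable lborel {0..t} (\<lambda>r. \<integral>p. D p + lam * (\<psi> (F p) - \<psi> p) \<partial>law r)"
    and "(\<integral>p. \<psi> p \<partial>law t) = (\<integral>p. \<psi> p \<partial>M) +
      (LINT r:{0..t}|lborel. (\<integral>p. D p + lam * (\<psi> (F p) - \<psi> p) \<partial>law r))"
proof -
  define k1 where "k1 p = D p - lam * \<psi> p" for p
  define k2 where "k2 p = lam * \<psi> (F p)" for p
  have [measurable]: "k1 \<in> borel_measurable M" "k2 \<in> borel_measurable M"
    unfolding k1_def k2_def by measurable
  have k1K: "\<bar>k1 p\<bar> \<le> K + lam * K" if "p \<in> space M" for p
  proof -
    have "\<bar>lam * \<psi> p\<bar> \<le> lam * K" using K(1)[OF that] lam by (simp add: abs_mult)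
    then show ?thesis using abs_triangle_ineq4[of "D p" "lam * \<psi> p"] K(2)[OF that] unfolding k1_def by linarith
  qed
  have k2K: "\<bar>k2 p\<bar> \<le> lam * K" if "p \<in> space M" for p
    using lam K(1)[OF measurable_space[OF F_measurable that]] by (simp add: k2_def abs_mult)
  have int: "integrable (law r) g" if "g \<in> borel_measurable M" "\<And>p. p \<in> space M \<Longrightarrow> \<bar>g p\<bar> \<le> C" "0 \<le> r"
    for g :: "'a \<Rightarrow> real" and C r
  proof -
    interpret L: prob_space "law r" by (rule prob_space_law[OF that(3)])
    have sp: "space (law r) = space M" by (rule sets_eq_imp_space_eq) simp
    show ?thesis using that by (intro L.integrable_const_bound[where B=C]) (auto simp: sp)
  qed
  have eq: "(\<integral>p. D p + lam * (\<psi> (F p) - \<psi> p) \<partial>law r) = (\<integral>p. k1 p \<partial>law r) + (\<integral>p. k2 p \<partial>law r)"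
    if "0 \<le> r" for r
  proof -
    have "(\<integral>p. D p + lam * (\<psi> (F p) - \<psi> p) \<partial>law r) = (\<integral>p. k1 p + k2 p \<partial>law r)"
      by (simp add: k1_def k2_def algebra_simps)
    also have "\<dots> = (\<integral>p. k1 p \<partial>law r) + (\<integral>p. k2 p \<partial>law r)"
      by (intro Bochner_Integration.integral_add int[OF _ k1K that] int[OF _ k2K that]) auto
    finally show ?thesis .
  qed
  note s1 = swap_law(2)[OF _ k1K, where t=t] and s2 = swap_law(2)[OF _ k2K, where t=t]
  have cong: "set_integrable lborel {0..t} (\<lambda>r. \<integral>p. D p + lam * (\<psi> (F p) - \<psi> p) \<partial>law r) \<longleftrightarrow>
      set_integrable lborel {0..t} (\<lambda>r. (\<integral>p. k1 p \<partial>law r) + (\<integral>p. k2 p \<partial>law r))"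
    by (rule set_integrable_cong) (auto simp: eq)
  show "set_integrable lborel {0..t} (\<lambda>r. \<integral>p. D p + lam * (\<psi> (F p) - \<psi> p) \<partial>law r)"
    unfolding cong by (intro set_integral_add s1 s2) auto
  have "(LINT r:{0..t}|lborel. (\<integral>p. D p + lam * (\<psi> (F p) - \<psi> p) \<partial>law r)) =
      (LINT r:{0..t}|lborel. (\<integral>p. k1 p \<partial>law r) + (\<integral>p. k2 p \<partial>law r))"
    by (rule set_lebesgue_integral_cong) (auto simp: eq)
  also have "\<dots> = (LINT r:{0..t}|lborel. (\<integral>p. k1 p \<partial>law r)) + (LINT r:{0..t}|lborel. (\<integral>p. k2 p \<partial>law r))"
    by (intro set_integral_add s1 s2) auto
  finally show "(\<integral>p. \<psi> p \<partial>law t) = (\<integral>p. \<psi> p \<partial>M) +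
      (LINT r:{0..t}|lborel. (\<integral>p. D p + lam * (\<psi> (F p) - \<psi> p) \<partial>law r))"
    using flow_identity[OF m K der cont t] jump_identity[OF m(1) K(1) t]
    by (simp add: k1_def k2_def)
qed

end

section \<open>The Kac process as a jump flow\<close>

lemma measurable_fst_torus: "fst \<in> (borel :: (torus \<times> real) measure) \<rightarrow>\<^sub>M borel"
  and measurable_snd_torus: "snd \<in> (borel :: (torus \<times> real) measure) \<rightarrow>\<^sub>M borel"
  by (auto intro!: borel_measurable_continuous_onI continuous_on_fst continuous_on_snd continuous_on_id)

lemma snd_measurable_Omega: "snd \<in> borel_measurable (borel_Omega V)"
  unfolding borel_Omega_def by (rule measurable_restrict_space1[OF measurable_snd_torus])

lemma abs_snd_Omega: "p \<in> Omega V \<Longrightarrow> \<bar>snd p\<bar> \<le> \<bar>V\<bar>"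
  by (auto simp: Omega_def)

text \<open>The target carries the Borel sets of a product topology, so measurability is not argued
  coordinatewise: position and velocity are computed in \<open>real \<times> real\<close> and
  carried over by a continuous map.\<close>

lemma measurable_flow:
  "(\<lambda>z. flow (fst z) (snd z)) \<in> borel \<Otimes>\<^sub>M borel_Omega V \<rightarrow>\<^sub>M borel_Omega V"
proof -
  define g where "g z = (to_torus (fst z), snd z)" for z :: "real \<times> real"
  have "continuous_on UNIV g"
    unfolding g_def by (intro continuous_on_Pair continuous_on_to_torus continuous_intros)
  then have g: "g \<in> borel_measurable borel" by (rule borel_measurable_continuous_onI)
  have f: "fst \<in> borel_Omega V \<rightarrow>\<^sub>M borel"
    unfolding borel_Omega_def by (rule measurable_restrict_space1[OF measurable_fst_torus])
  note [measurable] = measurable_compose[OF f measurable_section_torus] snd_measurable_Omega[of V]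
  have "(\<lambda>z. (section_torus (fst (snd z)) + fst z * snd (snd z), snd (snd z)))
      \<in> borel_measurable (borel \<Otimes>\<^sub>M borel_Omega V)"
    by measurable
  from measurable_compose[OF this g]
  have "(\<lambda>z. flow (fst z) (snd z)) \<in> borel \<Otimes>\<^sub>M borel_Omega V \<rightarrow>\<^sub>M borel"
    by (simp add: g_def flow_def)
  then show ?thesis
    unfolding borel_Omega_def[of V]
    by (intro measurable_restrict_space2) (auto simp: space_pair_measure simp flip: borel_Omega_def)
qed

lemma measurable_flip: "flip \<in> borel_Omega V \<rightarrow>\<^sub>M borel_Omega V"
proof -
  have "continuous_on UNIV flip"
    unfolding flip_def by (intro continuous_on_Pair continuous_on_fst continuous_on_minus continuous_on_snd continuous_on_id)
  then have "flip \<in> borel_Omega V \<rightarrow>\<^sub>M borel"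
    unfolding borel_Omega_def by (intro measurable_restrict_space1 borel_measurable_continuous_onI)
  then show ?thesis
    unfolding borel_Omega_def[of V]
    by (intro measurable_restrict_space2) (auto simp flip: borel_Omega_def)
qed

theorem weak_solution_exists:
  assumes lam: "lam > 0" and T: "T > 0" and \<sigma>\<^sub>0: "\<sigma>\<^sub>0 \<in> prob_Omega V"
  shows "\<exists>\<sigma>. weak_solution V lam T \<sigma>\<^sub>0 \<sigma>"
proof -
  note P = prob_OmegaD[OF \<sigma>\<^sub>0]
  interpret jump_flow \<sigma>\<^sub>0 flow flip lam
  proof (intro jump_flow.intro jump_flow_axioms.intro)
    show "(\<lambda>z. flow (fst z) (snd z)) \<in> borel \<Otimes>\<^sub>M \<sigma>\<^sub>0 \<rightarrow>\<^sub>M \<sigma>\<^sub>0"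
      using measurable_flow[of V] P(3) by (simp cong: measurable_cong_sets sets_pair_measure_cong)
    show "flip \<in> \<sigma>\<^sub>0 \<rightarrow>\<^sub>M \<sigma>\<^sub>0"
      using measurable_flip[of V] P(3) by (simp cong: measurable_cong_sets)
  qed (use lam P(1) in auto)
  have law: "law t \<in> prob_Omega V" if "0 \<le> t" for t
    using prob_space_law[OF that] P(3) by (simp add: prob_Omega_def)
  define q where "q \<phi> r = (\<integral>p. Q lam \<phi> p \<partial>law r)" for \<phi> r
  have evolution: "set_integrable lborel {0..t} (q \<phi>) \<and>
      (\<integral>p. \<phi> p \<partial>law t) = (\<integral>p. \<phi> p \<partial>\<sigma>\<^sub>0) + (LINT r:{0..t}|lborel. q \<phi> r)"
    if \<phi>: "\<phi> \<in> C10 V" and t: "0 \<le> t" for \<phi> t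
  proof -
    have c: "continuous_on (Omega V) \<phi>" "continuous_on (Omega V) (\<lambda>p. snd p * dx \<phi> p)"
      by (intro C10_continuous continuous_on_snd_mult C10_dx_continuous \<phi>)+
    obtain K1 K2 where K12: "\<And>p. p \<in> Omega V \<Longrightarrow> \<bar>\<phi> p\<bar> \<le> K1" "\<And>p. p \<in> Omega V \<Longrightarrow> \<bar>snd p * dx \<phi> p\<bar> \<le> K2"
      using Omega_continuous_bounded[OF c(1)] Omega_continuous_bounded[OF c(2)] by blast
    have m: "\<phi> \<in> borel_measurable \<sigma>\<^sub>0" "(\<lambda>p. snd p * dx \<phi> p) \<in> borel_measurable \<sigma>\<^sub>0"
      using measurable_continuous_Omega[OF c(1)] measurable_continuous_Omega[OF c(2)] P(3)
      by (simp_all cong: measurable_cong_sets)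
    have der: "((\<lambda>h. \<phi> (flow h p)) has_real_derivative snd (flow h p) * dx \<phi> (flow h p)) (at h)"
      and cont: "isCont (\<lambda>h. snd (flow h p) * dx \<phi> (flow h p)) h" if "p \<in> space \<sigma>\<^sub>0" for p h
    proof -
      have "p \<in> Omega V" using that P(4) by simp
      then obtain s v where sv: "p = (to_torus s, v)" "v \<in> {- V, V}" by (rule Omega_cases)
      show "((\<lambda>h. \<phi> (flow h p)) has_real_derivative snd (flow h p) * dx \<phi> (flow h p)) (at h)"
        using C10_flow_derivative[OF \<phi> sv(2)] by (simp add: sv(1) flow_to_torus)
      have "isCont (\<lambda>s. dx \<phi> (to_torus s, v)) x" for x
        using C10_dx_continuous[OF \<phi>] sv(2)
        by (auto simp: continuous_on_Omega_iff continuous_on_eq_continuous_at)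
      then have "isCont (\<lambda>h. dx \<phi> (to_torus (s + h * v), v)) h"
        by (intro isCont_o2[where f="\<lambda>h. s + h * v" and g="\<lambda>s. dx \<phi> (to_torus s, v)"]) auto
      then show "isCont (\<lambda>h. snd (flow h p) * dx \<phi> (flow h p)) h"
        by (simp add: sv(1) flow_to_torus)
    qed
    have K: "\<bar>\<phi> p\<bar> \<le> max K1 K2" "\<bar>snd p * dx \<phi> p\<bar> \<le> max K1 K2" if "p \<in> space \<sigma>\<^sub>0" for p
      using K12[of p] that P(4) by (auto simp: le_max_iff_disj)
    show ?thesis
      using law_evolution[OF m K der cont t] by (simp add: q_def[abs_def] Q_def[abs_def])
  qed
  have hk: "(\<integral>p. \<phi> p \<partial>law t) = (\<integral>p. \<phi> p \<partial>\<sigma>\<^sub>0) + integral {0..t} (q \<phi>)" "q \<phi> integrable_on {0..t}"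
    if "\<phi> \<in> C10 V" "0 \<le> t" for \<phi> t
    using evolution[OF that] set_borel_integral_eq_integral[of "{0..t}" "q \<phi>"] by auto
  define \<sigma> where "\<sigma> t = (if t \<in> {0..T} then law t else undefined)" for t
  have "\<sigma> \<in> narrow_curves V T"
  proof (rule narrow_curvesI)
    fix \<phi> assume \<phi>: "\<phi> \<in> C10 V"
    have "continuous_on {0..T} (\<lambda>t. (\<integral>p. \<phi> p \<partial>\<sigma>\<^sub>0) + integral {0..t} (q \<phi>))"
      using hk(2)[OF \<phi>] T by (intro continuous_on_add continuous_on_const indefinite_integral_continuous_1) auto
    then show "continuous_on {0..T} (\<lambda>t. \<integral>p. \<phi> p \<partial>\<sigma> t)"
      by (rule continuous_on_eq) (auto simp: \<sigma>_def hk(1)[OF \<phi>])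
  qed (auto simp: \<sigma>_def law)
  \<comment> \<open>\<open>law 0\<close> is a reweighted image of \<open>R\<close>, not literally
    the initial measure. At time 0 the time integral runs over a single point, so both agree on all
    test functions.\<close>
  moreover have "\<sigma> 0 = \<sigma>\<^sub>0"
    using T law[of 0] \<sigma>\<^sub>0 by (intro prob_Omega_eqI[of _ V]) (auto simp: \<sigma>_def hk(1))
  moreover have "(\<integral>p. \<phi> p \<partial>\<sigma> t) - (\<integral>p. \<phi> p \<partial>\<sigma> s) = (LINT r:{s<..<t}|lborel. (\<integral>p. Q lam \<phi> p \<partial>\<sigma> r))"
    if \<phi>: "\<phi> \<in> C10 V" and st: "0 \<le> s" "s \<le> t" "t \<le> T" for \<phi> s t
  proof -
    have "set_integrable lborel {s<..<t} (q \<phi>)"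
      using evolution[OF \<phi>, of t] st by (auto intro: set_integrable_subset)
    then have "(LINT r:{s<..<t}|lborel. q \<phi> r) = integral {s..t} (q \<phi>)"
      by (simp add: set_borel_integral_eq_integral(2) integral_open_interval_real)
    also have "\<dots> = integral {0..t} (q \<phi>) - integral {0..s} (q \<phi>)"
      using Henstock_Kurzweil_Integration.integral_combine[OF st(1,2) hk(2)[OF \<phi>]] st by simp
    also have "\<dots> = (\<integral>p. \<phi> p \<partial>\<sigma> t) - (\<integral>p. \<phi> p \<partial>\<sigma> s)"
      using st by (simp add: \<sigma>_def hk(1)[OF \<phi>])
    finally have "(\<integral>p. \<phi> p \<partial>\<sigma> t) - (\<integral>p. \<phi> p \<partial>\<sigma> s) = (LINT r:{s<..<t}|lborel. q \<phi> r)" by simp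
    also have "\<dots> = (LINT r:{s<..<t}|lborel. (\<integral>p. Q lam \<phi> p \<partial>\<sigma> r))"
      using st by (intro set_lebesgue_integral_cong) (auto simp: \<sigma>_def q_def)
    finally show ?thesis .
  qed
  ultimately show ?thesis unfolding weak_solution_def by blast
qed

section \<open>Weak and variational solutions\<close>

lemma weak_imp_variational:
  assumes V: "V > 0" and lam: "lam > 0" and T: "T > 0" and \<sigma>\<^sub>0: "\<sigma>\<^sub>0 \<in> prob_Omega V"
    and w: "weak_solution V lam T \<sigma>\<^sub>0 \<sigma>"
  shows "variational_solution V lam T \<sigma>\<^sub>0 \<sigma>"
proof -
  note N = weak_solutionD(1)[OF w]
  define j :: "real \<Rightarrow> flux" where "j t A = (LINT p:A|\<sigma> t. snd p, lam * measure (\<sigma> t) A)" for t A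
  have \<sigma>: "\<sigma> t \<in> prob_Omega V" if "t \<in> {0<..<T}" for t
    using narrow_curvesD(1)[OF N, of t] that by auto
  have int_snd: "integrable (\<sigma> t) snd" if "t \<in> {0<..<T}" for t
    using \<sigma>[OF that] snd_measurable_Omega abs_snd_Omega by (rule integrable_bounded_Omega)
  have vm1: "vector_measure (borel_Omega V) (\<lambda>A. LINT p:A|\<sigma> t. snd p)" if "t \<in> {0<..<T}" for t
    using vector_measure_density[OF int_snd[OF that]]
      vector_measure_cong_sets[OF prob_OmegaD(3)[OF \<sigma>[OF that]]] by blast
  have vm0: "vector_measure (borel_Omega V) (measure (\<sigma> t))" if "t \<in> {0<..<T}" for t
    using vector_measure_measure[OF prob_OmegaD(2)[OF \<sigma>[OF that]]]
      vector_measure_cong_sets[OF prob_OmegaD(3)[OF \<sigma>[OF that]]] by blast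
  have vm2: "vector_measure (borel_Omega V) (\<lambda>A. lam * measure (\<sigma> t) A)" if "t \<in> {0<..<T}" for t
    by (rule vector_measure_bounded_linear[OF vm0[OF that] bounded_linear_mult_right])
  have flux: "measurable_flux_family V T j"
    unfolding measurable_flux_family_def
  proof (intro conjI ballI)
    show "vector_measure (borel_Omega V) (j t)" if "t \<in> {0<..<T}" for t
      unfolding j_def[abs_def] by (intro vector_measure_Pair vm1 vm2 that)
    fix A assume A: "A \<in> sets (borel_Omega V)"
    \<comment> \<open>Indicators are in general discontinuous, so narrow continuity does not apply
      directly; measurability for bounded Borel integrands is invoked.\<close>
    have "(\<lambda>t. \<integral>p. indicator A p * snd p \<partial>\<sigma> t) \<in> borel_measurable (restrict_space borel {0<..<T})"
      using A snd_measurable_Omega abs_snd_Omega[of _ V]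
      by (intro narrow_curves_measurable_integral[OF N, where K="\<bar>V\<bar>"] borel_measurable_times
          borel_measurable_indicator) (auto simp: indicator_def)
    moreover have "(\<lambda>t. measure (\<sigma> t) A) \<in> borel_measurable (restrict_space borel {0<..<T})"
    proof -
      have "(\<lambda>t. \<integral>p. (indicator A p :: real) \<partial>\<sigma> t) \<in> borel_measurable (restrict_space borel {0<..<T})"
        using A by (intro narrow_curves_measurable_integral[OF N, where K=1]) auto
      moreover
      have "(\<integral>p. (indicator A p :: real) \<partial>\<sigma> t) = measure (\<sigma> t) A" if "t \<in> {0<..<T}" for t
        using sets.sets_into_space[OF A] prob_OmegaD(4)[OF \<sigma>[OF that]] by (simp add: Int_absorb2)
      then have "(\<lambda>t. \<integral>p. (indicator A p :: real) \<partial>\<sigma> t) \<in> borel_measurable (restrict_space borel {0<..<T}) \<longleftrightarrow>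
          (\<lambda>t. measure (\<sigma> t) A) \<in> borel_measurable (restrict_space borel {0<..<T})"
        by (intro measurable_cong) (simp add: space_restrict_space)
      ultimately show ?thesis by blast
    qed
    ultimately show "(\<lambda>t. j t A) \<in> borel_measurable (restrict_space borel {0<..<T})"
      unfolding j_def set_lebesgue_integral_def real_scaleR_def by measurable
  qed
  \<comment> \<open>The flux is dominated by the law: its norm on \<open>A\<close> is at most
    \<open>(V + lam) * measure (\<sigma> t) A\<close>, and these bounds add up to at most
    \<open>V + lam\<close> over any partition.\<close>
  have tv: "tv_norm (borel_Omega V) (j t) \<le> ennreal (V + lam)" if t: "t \<in> {0<..<T}" for t
    unfolding tv_norm_def
  proof (rule SUP_least, safe)
    fix P assume P: "finite P" "P \<subseteq> sets (borel_Omega V)" "partition_on (space (borel_Omega V)) P"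
    interpret prob_space "\<sigma> t" using prob_OmegaD[OF \<sigma>[OF t]] by simp
    have "norm (j t A) \<le> (V + lam) * measure (\<sigma> t) A" if A: "A \<in> P" for A
    proof -
      have As: "A \<in> sets (\<sigma> t)" using A P prob_OmegaD(3)[OF \<sigma>[OF t]] by auto
      have "\<bar>LINT p:A|\<sigma> t. snd p\<bar> \<le> (\<integral>p. \<bar>indicator A p *\<^sub>R snd p\<bar> \<partial>\<sigma> t)"
        unfolding set_lebesgue_integral_def by (rule integral_abs_bound)
      also have "\<dots> \<le> (\<integral>p. V * indicator A p \<partial>\<sigma> t)"
      proof (rule integral_mono)
        show "integrable (\<sigma> t) (\<lambda>p. \<bar>indicator A p *\<^sub>R snd p\<bar>)"
          by (intro integrable_abs integrable_mult_indicator As int_snd t)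
        show "integrable (\<sigma> t) (\<lambda>p. V * indicator A p)"
          by (intro integrable_mult_right integrable_real_indicator As) (simp add: less_top[symmetric])
        show "\<bar>indicator A p *\<^sub>R snd p\<bar> \<le> V * indicator A p" if "p \<in> space (\<sigma> t)" for p
          using that V abs_snd_Omega[of p V] prob_OmegaD(4)[OF \<sigma>[OF t]] by (auto simp: indicator_def)
      qed
      also have "\<dots> = V * measure (\<sigma> t) A" using sets.sets_into_space[OF As] by (simp add: Int_absorb2)
      finally show ?thesis
        using norm_Pair_le[of "LINT p:A|\<sigma> t. snd p" "lam * measure (\<sigma> t) A"] lam
        by (simp add: j_def algebra_simps abs_mult)
    qed
    then have "(\<Sum>A\<in>P. norm (j t A)) \<le> (\<Sum>A\<in>P. (V + lam) * measure (\<sigma> t) A)"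
      by (rule sum_mono)
    also have "\<dots> = (V + lam) * measure (\<sigma> t) (\<Union>A\<in>P. A)"
    proof -
      have "A \<in> sets (borel_Omega V)" if "A \<in> P" for A using P(2) that by auto
      moreover have "disjoint_family_on (\<lambda>A. A) P"
        using P(3) by (auto simp: partition_on_def disjoint_def disjoint_family_on_def)
      ultimately show ?thesis
        using vector_measure_sum[OF vm0[OF t] P(1), of "\<lambda>A. A"] by (simp add: sum_distrib_left)
    qed
    also have "\<dots> \<le> (V + lam) * 1" using V lam by (intro mult_left_mono) auto
    finally show "(\<Sum>A\<in>P. ennreal (norm (j t A))) \<le> ennreal (V + lam)"
      by (simp add: sum_ennreal ennreal_leI)
  qed
  have "(\<integral>\<^sup>+t\<in>{0<..<T}. tv_norm (borel_Omega V) (j t) \<partial>lborel) \<le>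
      (\<integral>\<^sup>+t. ennreal (V + lam) * indicator {0<..<T} t \<partial>lborel)"
    using tv by (intro nn_integral_mono) (auto simp: indicator_def)
  also have "\<dots> < \<infinity>"
    using T by (simp add: nn_integral_cmult ennreal_mult_less_top)
  finally have tvint: "(\<integral>\<^sup>+t\<in>{0<..<T}. tv_norm (borel_Omega V) (j t) \<partial>lborel) < \<infinity>" .
  have grad: "grad_pairing V \<phi> (j r) = (\<integral>p. Q lam \<phi> p \<partial>\<sigma> r)" if \<phi>: "\<phi> \<in> C10 V" and r: "r \<in> {0<..<T}" for \<phi> r
  proof -
    note P = prob_OmegaD[OF \<sigma>[OF r]]
    have c: "continuous_on (Omega V) (dx \<phi>)" "continuous_on (Omega V) (\<lambda>p. \<phi> (flip p) - \<phi> p)"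
      by (intro C10_dx_continuous C10_continuous flip_diff_C10 \<phi>)+
    obtain K1 K2 where K: "\<And>p. p \<in> Omega V \<Longrightarrow> \<bar>dx \<phi> p\<bar> \<le> K1" "\<And>p. p \<in> Omega V \<Longrightarrow> \<bar>\<phi> (flip p) - \<phi> p\<bar> \<le> K2"
      using Omega_continuous_bounded[OF c(1)] Omega_continuous_bounded[OF c(2)] by blast
    have "signed_integral (borel_Omega V) (\<lambda>A. LINT p:A|\<sigma> r. snd p) (dx \<phi>) = (\<integral>p. dx \<phi> p * snd p \<partial>\<sigma> r)"
      by (rule signed_integral_density[OF vm1[OF r] P(3) int_snd[OF r] refl measurable_continuous_Omega[OF c(1)]])
        (use K in auto)
    moreover have "signed_integral (borel_Omega V) (\<lambda>A. lam * measure (\<sigma> r) A) (\<lambda>p. \<phi> (flip p) - \<phi> p) =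
        (\<integral>p. (\<phi> (flip p) - \<phi> p) * lam \<partial>\<sigma> r)"
    proof (rule signed_integral_density[OF vm2[OF r] P(3) _ _ measurable_continuous_Omega[OF c(2)]])
      fix A assume "A \<in> sets (borel_Omega V)"
      then have "A \<in> sets (\<sigma> r)" using P by simp
      from sets.sets_into_space[OF this] show "lam * measure (\<sigma> r) A = (LINT x:A|\<sigma> r. lam)"
        by (simp add: set_lebesgue_integral_def Int_absorb2)
    qed (use K P in \<open>auto simp: finite_measure.integrable_const\<close>)
    moreover have "(\<integral>p. Q lam \<phi> p \<partial>\<sigma> r) = (\<integral>p. snd p * dx \<phi> p \<partial>\<sigma> r) + (\<integral>p. lam * (\<phi> (flip p) - \<phi> p) \<partial>\<sigma> r)"
      unfolding Q_def
      by (intro Bochner_Integration.integral_add integrable_mult_right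
          integrable_continuous_Omega[OF \<sigma>[OF r]] continuous_on_snd_mult c)
    ultimately show ?thesis by (simp add: grad_pairing_def j_def mult.commute)
  qed
  have CE: "(\<sigma>, j) \<in> CE V T"
    unfolding CE_def mem_Collect_eq prod.case
  proof (intro conjI ballI allI impI N flux tvint)
    fix \<phi> s t assume "\<phi> \<in> C10 V" "0 \<le> s" "s \<le> t" "t \<le> T"
    then show "(\<integral>p. \<phi> p \<partial>\<sigma> t) - (\<integral>p. \<phi> p \<partial>\<sigma> s) = (LINT r:{s<..<t}|lborel. grad_pairing V \<phi> (j r))"
      unfolding weak_solutionD(3)[OF w \<open>\<phi> \<in> C10 V\<close> \<open>0 \<le> s\<close> \<open>s \<le> t\<close> \<open>t \<le> T\<close>]
      by (intro set_lebesgue_integral_cong) (auto simp: grad)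
  qed
  have "Lfun V lam (\<sigma> t) (j t) = 0" if "t \<in> {0<..<T}" for t
    unfolding Lfun_def j_def using lam prob_OmegaD(2)[OF \<sigma>[OF that]]
    by (auto intro!: Ent_eq_0 finite_measure_scale)
  then have "(\<integral>\<^sup>+t\<in>{0<..<T}. Lfun V lam (\<sigma> t) (j t) \<partial>lborel) = (\<integral>\<^sup>+t. 0 \<partial>(lborel :: real measure))"
    by (intro nn_integral_cong) (auto simp: indicator_def)
  then have "rate_functional V lam T \<sigma> j = 0"
    using CE by (simp add: rate_functional_def)
  moreover have "Ent (measure (\<sigma> 0)) \<sigma>\<^sub>0 = 0"
    using weak_solutionD(2)[OF w] prob_OmegaD(2)[OF \<sigma>\<^sub>0] by (intro Ent_eq_0) auto
  ultimately show ?thesis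
    using N flux CE unfolding variational_solution_def by (intro conjI exI[of _ j]) auto
qed

text \<open>A lower bound built only from pairings with one test function, hence measurable in time
  along a curve. The constraint on the first component is relaxed to its pairing with
  \<open>dx \<phi>\<close>, keeping the infinite penalty; the entropy is relaxed by
  \<open>Ent_ge_square\<close>, where \<open>lam\<close> is the total mass of the reference
  measure.\<close>

lemma Lfun_ge:
  assumes \<sigma>: "\<sigma> \<in> prob_Omega V" and lam: "lam > 0" and j: "vector_measure (borel_Omega V) j"
    and \<phi>: "\<phi> \<in> C10 V" and K: "\<And>p. p \<in> Omega V \<Longrightarrow> \<bar>dx \<phi> p\<bar> \<le> K"
      "\<And>p. p \<in> Omega V \<Longrightarrow> \<bar>\<phi> (flip p) - \<phi> p\<bar> \<le> K" and K0: "0 \<le> K"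
  defines "d \<equiv> signed_integral (borel_Omega V) (\<lambda>A. snd (j A)) (\<lambda>p. \<phi> (flip p) - \<phi> p) -
      lam * (\<integral>p. \<phi> (flip p) - \<phi> p \<partial>\<sigma>)"
  shows "(if signed_integral (borel_Omega V) (\<lambda>A. fst (j A)) (dx \<phi>) = (\<integral>p. dx \<phi> p * snd p \<partial>\<sigma>) then 0 else \<infinity>) +
    ennreal ((d / (1 + \<bar>d\<bar>) / (1 + K + K\<^sup>2 * lam))\<^sup>2) \<le> Lfun V lam \<sigma> j"
proof (cases "\<forall>A\<in>sets (borel_Omega V). fst (j A) = (LINT p:A|\<sigma>. snd p)")
  case True
  note P = prob_OmegaD[OF \<sigma>]
  have c: "continuous_on (Omega V) (dx \<phi>)" "continuous_on (Omega V) (\<lambda>p. \<phi> (flip p) - \<phi> p)"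
    by (intro C10_dx_continuous C10_continuous flip_diff_C10 \<phi>)+
  note m = measurable_continuous_Omega[OF c(1)] measurable_continuous_Omega[OF c(2)]
  have "signed_integral (borel_Omega V) (\<lambda>A. fst (j A)) (dx \<phi>) = (\<integral>p. dx \<phi> p * snd p \<partial>\<sigma>)"
    using True K integrable_bounded_Omega[OF \<sigma> snd_measurable_Omega abs_snd_Omega]
    by (intro signed_integral_density[OF vector_measure_bounded_linear[OF j bounded_linear_fst] P(3) _ _ m(1), where K=K]) auto
  moreover have "ennreal ((d / (1 + \<bar>d\<bar>) / (1 + K + K\<^sup>2 * lam))\<^sup>2) \<le>
      Ent (\<lambda>A. snd (j A)) (scale_measure (ennreal lam) \<sigma>)"
  proof -
    have "(\<integral>p. \<phi> (flip p) - \<phi> p \<partial>scale_measure (ennreal lam) \<sigma>) = lam * (\<integral>p. \<phi> (flip p) - \<phi> p \<partial>\<sigma>)"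
      using m(2) P(3) lam by (intro integral_scale_measure) (auto cong: measurable_cong_sets)
    moreover have "measure (scale_measure (ennreal lam) \<sigma>) (space (scale_measure (ennreal lam) \<sigma>)) = lam"
      using lam prob_space.prob_space[OF P(1)] by (simp add: space_scale_measure)
    ultimately show ?thesis
      using Ent_ge_square[OF vector_measure_bounded_linear[OF j bounded_linear_snd] _
          finite_measure_scale[OF P(2)] m(2), of lam K] K(2) K0 P(3)
      by (simp add: d_def)
  qed
  ultimately show ?thesis using True by (simp add: Lfun_def)
next
  case False
  then have "Lfun V lam \<sigma> j = \<infinity>" unfolding Lfun_def by (rule if_not_P)
  then show ?thesis by simp
qed

lemma variational_imp_weak:
  assumes V: "V > 0" and lam: "lam > 0" and T: "T > 0" and \<sigma>\<^sub>0: "\<sigma>\<^sub>0 \<in> prob_Omega V"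
    and v: "variational_solution V lam T \<sigma>\<^sub>0 \<sigma>"
  shows "weak_solution V lam T \<sigma>\<^sub>0 \<sigma>"
proof -
  obtain j where N: "\<sigma> \<in> narrow_curves V T" and flux: "measurable_flux_family V T j"
    and CE: "(\<sigma>, j) \<in> CE V T" and "Ent (measure (\<sigma> 0)) \<sigma>\<^sub>0 + rate_functional V lam T \<sigma> j = 0"
    using v unfolding variational_solution_def by blast
  then have Ent: "Ent (measure (\<sigma> 0)) \<sigma>\<^sub>0 = 0" and L: "(\<integral>\<^sup>+t\<in>{0<..<T}. Lfun V lam (\<sigma> t) (j t) \<partial>lborel) = 0"
    by (auto simp: add_eq_0_iff_both_eq_0 rate_functional_def)
  have \<sigma>: "\<sigma> t \<in> prob_Omega V" if "t \<in> {0<..<T}" for t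
    using narrow_curvesD(1)[OF N, of t] that by auto
  have init: "\<sigma> 0 = \<sigma>\<^sub>0"
    using narrow_curvesD(1)[OF N, of 0] T prob_OmegaD[OF \<sigma>\<^sub>0] prob_OmegaD[of "\<sigma> 0" V] Ent
    by (intro Ent_measure_eq_0_D) auto
  define I where "I = {0<..<T}"
  \<comment> \<open>The flux family is arbitrary outside the open interval, so measurability and
    almost-everywhere statements are formulated on the restricted measure.\<close>
  define LI where "LI = restrict_space lborel I"
  have vm: "vector_measure (borel_Omega V) (j t)" if "t \<in> I" for t
    using flux that by (simp add: measurable_flux_family_def I_def)
  have [simp]: "space LI = I" by (simp add: LI_def space_restrict_space)
  have sLI: "sets LI = sets (restrict_space borel I)"
    by (simp add: LI_def sets_restrict_space)
  have jm: "(\<lambda>t. j t A) \<in> borel_measurable LI" if "A \<in> sets (borel_Omega V)" for A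
    using flux that sLI by (simp add: measurable_flux_family_def I_def cong: measurable_cong_sets)
  have eq: "(\<integral>p. \<phi> p \<partial>\<sigma> t) - (\<integral>p. \<phi> p \<partial>\<sigma> s) = (LINT r:{s<..<t}|lborel. (\<integral>p. Q lam \<phi> p \<partial>\<sigma> r))"
    if \<phi>: "\<phi> \<in> C10 V" and st: "0 \<le> s" "s \<le> t" "t \<le> T" for \<phi> s t
  proof -
    have c: "continuous_on (Omega V) (dx \<phi>)" "continuous_on (Omega V) (\<lambda>p. \<phi> (flip p) - \<phi> p)"
      by (intro C10_dx_continuous C10_continuous flip_diff_C10 \<phi>)+
    obtain K1 K2 where K12: "K1 \<ge> 0" "\<And>p. p \<in> Omega V \<Longrightarrow> \<bar>dx \<phi> p\<bar> \<le> K1"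
      "\<And>p. p \<in> Omega V \<Longrightarrow> \<bar>\<phi> (flip p) - \<phi> p\<bar> \<le> K2"
      using Omega_continuous_bounded[OF c(1)] Omega_continuous_bounded[OF c(2)] by blast
    define K where "K = max K1 K2"
    have K: "0 \<le> K" "\<And>p. p \<in> Omega V \<Longrightarrow> \<bar>dx \<phi> p\<bar> \<le> K" "\<And>p. p \<in> Omega V \<Longrightarrow> \<bar>\<phi> (flip p) - \<phi> p\<bar> \<le> K"
      using K12 by (auto simp: K_def le_max_iff_disj)
    define s1 where "s1 r = signed_integral (borel_Omega V) (\<lambda>A. fst (j r A)) (dx \<phi>)" for r
    define s2 where "s2 r = signed_integral (borel_Omega V) (\<lambda>A. snd (j r A)) (\<lambda>p. \<phi> (flip p) - \<phi> p)" for r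
    define u1 where "u1 r = (\<integral>p. dx \<phi> p * snd p \<partial>\<sigma> r)" for r
    define u2 where "u2 r = lam * (\<integral>p. \<phi> (flip p) - \<phi> p \<partial>\<sigma> r)" for r
    have cm: "(\<lambda>r. \<integral>p. (\<psi> p :: real) \<partial>\<sigma> r) \<in> borel_measurable LI" if "continuous_on (Omega V) \<psi>" for \<psi>
    proof -
      have "(\<lambda>r. \<integral>p. (\<psi> p :: real) \<partial>\<sigma> r) \<in> borel_measurable (restrict_space borel I)"
        using narrow_curvesD(2)[OF N that] unfolding I_def
        by (intro borel_measurable_continuous_on_restrict) (auto intro: continuous_on_subset)
      then show ?thesis using sLI by (simp cong: measurable_cong_sets)
    qed
    have [measurable]: "s1 \<in> borel_measurable LI" unfolding s1_def
    proof (rule measurable_signed_integral[OF _ _ measurable_continuous_Omega[OF c(1)]])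
      show "vector_measure (borel_Omega V) (\<lambda>A. fst (j t A))" if "t \<in> space LI" for t
        using that by (intro vector_measure_bounded_linear[OF _ bounded_linear_fst] vm) simp
      show "(\<lambda>t. fst (j t A)) \<in> borel_measurable LI" if "A \<in> sets (borel_Omega V)" for A
        by (rule measurable_compose[OF jm[OF that]]) (intro borel_measurable_continuous_onI continuous_intros)
    qed (use K in auto)
    have [measurable]: "s2 \<in> borel_measurable LI" unfolding s2_def
    proof (rule measurable_signed_integral[OF _ _ measurable_continuous_Omega[OF c(2)]])
      show "vector_measure (borel_Omega V) (\<lambda>A. snd (j t A))" if "t \<in> space LI" for t
        using that by (intro vector_measure_bounded_linear[OF _ bounded_linear_snd] vm) simp
      show "(\<lambda>t. snd (j t A)) \<in> borel_measurable LI" if "A \<in> sets (borel_Omega V)" for A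
        by (rule measurable_compose[OF jm[OF that]]) (intro borel_measurable_continuous_onI continuous_intros)
    qed (use K in auto)
    have [measurable]: "u1 \<in> borel_measurable LI"
      using cm[OF continuous_on_snd_mult[OF c(1)]] by (simp add: u1_def[abs_def] mult.commute)
    have [measurable]: "u2 \<in> borel_measurable LI"
      unfolding u2_def by (intro borel_measurable_times borel_measurable_const cm c)
    define d where "d r = s2 r - u2 r" for r
    have [measurable]: "d \<in> borel_measurable LI" unfolding d_def by measurable
    define C where "C = 1 + K + K\<^sup>2 * lam"
    have C: "C > 0" using K lam by (auto simp: C_def intro!: add_pos_nonneg)
    define b where "b r = (if s1 r = u1 r then 0 else \<infinity>) + ennreal ((d r / (1 + \<bar>d r\<bar>) / C)\<^sup>2)" for r
    have [measurable]: "b \<in> borel_measurable LI" unfolding b_def by measurable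
    have "b r \<le> Lfun V lam (\<sigma> r) (j r)" if r: "r \<in> I" for r
      unfolding b_def s1_def u1_def d_def s2_def u2_def C_def
      using r by (intro Lfun_ge[OF \<sigma> lam vm \<phi> K(2,3,1)]) (auto simp: I_def)
    \<comment> \<open>The rate functional enters only through monotonicity of the nonnegative
      integral, which needs no measurability of its integrand; the conclusion for almost every time
      is then drawn from the measurable \<open>b\<close>.\<close>
    then have "(\<integral>\<^sup>+r. b r * indicator I r \<partial>lborel) \<le> 0"
      unfolding L[symmetric] I_def[symmetric] by (intro nn_integral_mono) (auto simp: indicator_def)
    then have "(\<integral>\<^sup>+r. b r \<partial>LI) = 0"
      unfolding LI_def by (subst nn_integral_restrict_space) (auto simp: I_def)
    then have "AE r in LI. b r = 0" by (subst (asm) nn_integral_0_iff_AE) auto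
    \<comment> \<open>The exceptional set of times may depend on \<open>\<phi>\<close>; this is
      harmless, since the identity is integrated in time for this \<open>\<phi>\<close>
      alone.\<close>
    then have AE: "AE r in LI. s1 r + s2 r = u1 r + u2 r"
    proof eventually_elim
      case (elim r)
      then have "s1 r = u1 r" "(d r / (1 + \<bar>d r\<bar>) / C)\<^sup>2 = 0"
        by (auto simp: b_def ennreal_eq_0_iff split: if_splits)
      then have "d r = 0" using C by (auto simp: add_nonneg_eq_0_iff)
      with \<open>s1 r = u1 r\<close> show ?case by (simp add: d_def)
    qed
    have sub: "{s<..<t} \<subseteq> I" using st by (auto simp: I_def)
    have grad: "grad_pairing V \<phi> (j r) = s1 r + s2 r" for r
      by (simp add: grad_pairing_def s1_def s2_def)
    have Qeq: "(\<integral>p. Q lam \<phi> p \<partial>\<sigma> r) = u1 r + u2 r" if "r \<in> I" for r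
    proof -
      have r: "\<sigma> r \<in> prob_Omega V" using \<sigma> that by (simp add: I_def)
      have "(\<integral>p. Q lam \<phi> p \<partial>\<sigma> r) = (\<integral>p. snd p * dx \<phi> p \<partial>\<sigma> r) + (\<integral>p. lam * (\<phi> (flip p) - \<phi> p) \<partial>\<sigma> r)"
        unfolding Q_def
        by (intro Bochner_Integration.integral_add integrable_mult_right
            integrable_continuous_Omega[OF r] continuous_on_snd_mult c)
      then show ?thesis by (simp add: u1_def u2_def mult.commute)
    qed
    have "(LINT r:{s<..<t}|lborel. grad_pairing V \<phi> (j r)) = (\<integral>r. indicator {s<..<t} r * (s1 r + s2 r) \<partial>LI)"
      unfolding LI_def grad set_lebesgue_integral_def
      by (subst integral_restrict_space) (use sub in \<open>auto simp: I_def indicator_def intro!: Bochner_Integration.integral_cong\<close>)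
    also have "\<dots> = (\<integral>r. indicator {s<..<t} r * (u1 r + u2 r) \<partial>LI)"
    proof (rule integral_cong_AE)
      have [measurable]: "{s<..<t} \<in> sets LI"
        unfolding LI_def using sub by (subst sets_restrict_space_iff) (auto simp: I_def)
      show "(\<lambda>r. indicator {s<..<t} r * (s1 r + s2 r)) \<in> borel_measurable LI"
        "(\<lambda>r. indicator {s<..<t} r * (u1 r + u2 r)) \<in> borel_measurable LI" by measurable
      show "AE r in LI. indicator {s<..<t} r * (s1 r + s2 r) = indicator {s<..<t} r * (u1 r + u2 r)"
        using AE by eventually_elim simp
    qed
    also have "\<dots> = (LINT r:{s<..<t}|lborel. u1 r + u2 r)"
      unfolding LI_def set_lebesgue_integral_def
      by (subst integral_restrict_space) (use sub in \<open>auto simp: I_def indicator_def intro!: Bochner_Integration.integral_cong\<close>)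
    also have "\<dots> = (LINT r:{s<..<t}|lborel. (\<integral>p. Q lam \<phi> p \<partial>\<sigma> r))"
      using sub by (intro set_lebesgue_integral_cong) (auto simp: Qeq)
    finally show ?thesis
      using CE \<phi> st unfolding CE_def by auto
  qed
  show ?thesis
    unfolding weak_solution_def using N init eq by blast
qed

theorem theorem2p5:
  fixes V lam T :: real and \<sigma>\<^sub>0 :: "(torus \<times> real) measure"
  assumes "V > 0" and "lam > 0" and "T > 0" and "\<sigma>\<^sub>0 \<in> prob_Omega V"
  shows "(\<exists>!\<sigma>. weak_solution V lam T \<sigma>\<^sub>0 \<sigma>) \<and>
    (\<forall>\<sigma>\<in>narrow_curves V T.
      weak_solution V lam T \<sigma>\<^sub>0 \<sigma> \<longleftrightarrow> variational_solution V lam T \<sigma>\<^sub>0 \<sigma>)"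
  using weak_solution_exists[OF assms(2-4)] weak_solution_unique[OF _ _ assms(2)]
    weak_imp_variational[OF assms] variational_imp_weak[OF assms] by blast

end
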